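(* Let $\mathcal{T}$ be a theory of Feynman graphs with vertex types $\mathcal{V}$ and edge types $\mathcal{E}$, and let $f:\mathbb{N}^{|\mathcal{V}|}\times\mathbb{N}^{|\mathcal{V}|+|\mathcal{E}|}\to\mathbb{Q}^N$ be a map. Consider the $\mathbb{Q}^N$-graduation of $\mathcal{H}_{\mathcal{FG}(\mathcal{T})}$ defined by $\deg(G)=f(V_G,S_G)$ for every Feynman graph $G$. It is a Hopf algebra graduation if, and only if, there exists $C\in M_{N,|\mathcal{V}|}(\mathbb{Q})$ such that for any Feynman graph $G$: $$\deg(G)=CV_G-(C\ \ 0)S_G,$$ where $(C\ \ 0)\in M_{N,|\mathcal{V}|+|\mathcal{E}|}(\mathbb{Q})$ is obtained by adding $|\mathcal{E}|$ zero columns (those indexed by $\mathcal E$) to $C$.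
   Context: A theory of Feynman graphs $\mathcal{T}=(\mathcal{HE},\mathcal{V},\iota)$ is given by a finite set $\mathcal{HE}$ of half-edge types with an involution $\iota:\mathcal{HE}\to\mathcal{HE}$ (the incidence rule) and a finite set $\mathcal{V}$ of vertex types, each being a finite multiset of elements of $\mathcal{HE}$ of cardinality at least $3$. The set $\mathcal{E}$ of edge types is the set of multisets $\{t,\iota(t)\}$, $t\in\mathcal{HE}$. A 1PI Feynman graph $G$ of $\mathcal{T}$ is given by a nonempty finite set $HE$ of half-edges with a map $type:HE\to\mathcal{HE}$, a nonempty finite set $V$ of vertices, an involution $i:HE\to HE$ and a source map $s:HE\to V$ such that: (1) if $i(e)\ne e$ then $\iota(type(e))=type(i(e))$; (2) for any $v\in V$ the multiset $type(v)=\{type(e)\mid s(e)=v\}$ belongs to $\mathcal{V}$; (3) with internal edges $Int(G)=\{\{e,i(e)\}\mid i(e)\neq e\}$, the graph $(V,Int(G))$ is connected, has at least one edge, and remains connected if any one edge is deleted; (4) with external half-edges $Ext(G)=\{e\mid i(e)=e\}$, the multiset $typeExt(G)=\{type(e)\mid e\in Ext(G)\}$ is either of the form $\{t,\iota(t)\}$ (external structure of type this edge type) or an element of $\mathcal{V}$ (external structure of type this vertex type). A Feynman graph is a disjoint union of a finite number (possibly $0$, giving the empty graph $1$) of 1PI Feynman graphs, called its connected components; graphs are taken up to isomorphism. It is assumed that for every element of $\mathcal{V}\sqcup\mathcal{E}$ there exist 1PI graphs with that external structure. A Feynman graph $G'=(HE',V',i',s')$ is a subgraph of $G=(HE,V,i,s)$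 if $HE'\subseteq HE$, $V'=s(HE')$, $s'=s_{|HE'}$ and, for all $e\in HE'$, $i'(e)=e$ or $i'(e)=i(e)$. For $G'$ a connected subgraph, $G/G'=(HE'',V'',i'',s'')$ is defined as follows. If the external structure of $G'$ is a vertex type: $HE''=(HE\setminus HE')\sqcup Ext(G')$, $V''=(V\setminus V')\sqcup\{0\}$, $s''=s$ on $HE\setminus HE'$ and $s''=0$ on $Ext(G')$, $i''=i$. If it is an edge type, with external half-edges $e_1,e_2$ of $G'$: $HE''=HE\setminus HE'$, $V''=V\setminus V'$, $s''=s$, $i''(i(e_1))=i(e_2)$, $i''(i(e_2))=i(e_1)$, $i''(e)=i(e)$ otherwise. For non-connected $G'$, contract its components successively. By convention $G/1=G$ and $G/G=1$ (a connected component contracted entirely disappears). $G'$ is admissible, written $G'\subseteq G$, if $G/G'$ is a Feynman graph. $\mathcal{H}_{\mathcal{FG}(\mathcal{T})}$ is the Hopf algebra with basis the set of Feynman graphs of $\mathcal{T}$, product the disjoint union, and coproduct $\Delta(G)=\sum_{G'\subseteq G}G'\otimes G/G'$. $V_G=(v_t(G))_{t\in\mathcal{V}}$, where $v_t(G)$ is the number of vertices of $G$ of type $t$; $S_G=(s_t(G))_{t\in\mathcal{V}\sqcup\mathcal{E}}$, where $s_t(G)$ is the number of connected components of $G$ with external structure of type $t$. A Hopf algebra graduation means that product and coproduct are homogeneous of degree $0$. *)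

theory Defs
  imports
    "HOL-Library.Poly_Mapping"
    "HOL-Library.Multiset"
    "HOL-Library.FuncSet"
    "HOL-Library.Nat_Bijection"
    "HOL-Analysis.Finite_Cartesian_Product"
begin

section \<open>Theories of Feynman graphs\<close>

record 'h ftheory =
  htypes :: "'h set"
  vtypes :: "'h multiset set"
  incid :: "'h \<Rightarrow> 'h"

definition feynman_theory :: "'h ftheory \<Rightarrow> bool" where
  "feynman_theory T \<longleftrightarrow>
     finite (htypes T) \<and> finite (vtypes T) \<and>
     incid T \<in> htypes T \<rightarrow> htypes T \<and>
     (\<forall>t\<in>htypes T. incid T (incid T t) = t) \<and>
     (\<forall>w\<in>vtypes T. set_mset w \<subseteq> htypes T \<and> 3 \<le> size w)"

text \<open>Edge types have two elements and vertex types at least three, so the disjoint union of the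
  two sets of types is the plain union \<^term>\<open>vtypes T \<union> etypes T\<close>.\<close>

definition etypes :: "'h ftheory \<Rightarrow> 'h multiset set" where
  "etypes T = (\<lambda>t. {#t, incid T t#}) ` htypes T"


section \<open>Graphs made of half-edges\<close>

text \<open>Half-edges and vertices are labelled by natural numbers; every finite graph is isomorphic to
  such a graph. The maps are extensional, so that two graphs with the same data on their carriers
  are equal. In particular, subgraphs of a given graph are counted without repetition.\<close>

record 'h hgraph =
  halves :: "nat set"
  verts :: "nat set"
  pairing :: "nat \<Rightarrow> nat"
  src :: "nat \<Rightarrow> nat"
  htype :: "nat \<Rightarrow> 'h"

definition wf_hgraph :: "'h hgraph \<Rightarrow> bool" where
  "wf_hgraph G \<longleftrightarrow>
     finite (halves G) \<and> finite (verts G) \<and>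
     pairing G \<in> halves G \<rightarrow>\<^sub>E halves G \<and>
     (\<forall>e\<in>halves G. pairing G (pairing G e) = e) \<and>
     src G \<in> halves G \<rightarrow>\<^sub>E verts G \<and>
     htype G \<in> extensional (halves G)"

definition vertex_type :: "'h hgraph \<Rightarrow> nat \<Rightarrow> 'h multiset" where
  "vertex_type G v = image_mset (htype G) (mset_set {e \<in> halves G. src G e = v})"

definition int_edges :: "'h hgraph \<Rightarrow> nat set set" where
  "int_edges G = {{e, pairing G e} | e. e \<in> halves G \<and> pairing G e \<noteq> e}"

definition ext_halves :: "'h hgraph \<Rightarrow> nat set" where
  "ext_halves G = {e \<in> halves G. pairing G e = e}"

definition ext_type :: "'h hgraph \<Rightarrow> 'h multiset" where
  "ext_type G = image_mset (htype G) (mset_set (ext_halves G))"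

text \<open>Reachability between vertices along a set \<open>F\<close> of internal edges.\<close>

definition reach :: "'h hgraph \<Rightarrow> nat set set \<Rightarrow> (nat \<times> nat) set" where
  "reach G F = {(u, v) \<in> verts G \<times> verts G. (u, v) \<in> {(src G e, src G e') | e e'. {e, e'} \<in> F}\<^sup>*}"

definition connected_by :: "'h hgraph \<Rightarrow> nat set set \<Rightarrow> bool" where
  "connected_by G F \<longleftrightarrow> (\<forall>u\<in>verts G. \<forall>v\<in>verts G. (u, v) \<in> reach G F)"

definition one_PI :: "'h ftheory \<Rightarrow> 'h hgraph \<Rightarrow> bool" where
  "one_PI T G \<longleftrightarrow>
     wf_hgraph G \<and> halves G \<noteq> {} \<and> verts G \<noteq> {} \<and>
     htype G ` halves G \<subseteq> htypes T \<and>
     (\<forall>e\<in>halves G. pairing G e \<noteq> e \<longrightarrow> incid T (htype G e) = htype G (pairing G e)) \<and>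
     (\<forall>v\<in>verts G. vertex_type G v \<in> vtypes T) \<and>
     connected_by G (int_edges G) \<and> int_edges G \<noteq> {} \<and>
     (\<forall>d\<in>int_edges G. connected_by G (int_edges G - {d})) \<and>
     ext_type G \<in> vtypes T \<union> etypes T"

definition restrict_graph :: "'h hgraph \<Rightarrow> nat set \<Rightarrow> nat set \<Rightarrow> 'h hgraph" where
  "restrict_graph G E W =
     \<lparr>halves = E, verts = W, pairing = restrict (pairing G) E, src = restrict (src G) E,
      htype = restrict (htype G) E\<rparr>"

definition components :: "'h hgraph \<Rightarrow> 'h hgraph set" where
  "components G =
     (\<lambda>W. restrict_graph G {e \<in> halves G. src G e \<in> W} W) ` (verts G // reach G (int_edges G))"

text \<open>A well-formed graph is the disjoint union of its connected components.\<close>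

definition feynman :: "'h ftheory \<Rightarrow> 'h hgraph \<Rightarrow> bool" where
  "feynman T G \<longleftrightarrow> wf_hgraph G \<and> (\<forall>K\<in>components G. one_PI T K)"

definition realizable :: "'h ftheory \<Rightarrow> bool" where
  "realizable T \<longleftrightarrow> (\<forall>w\<in>vtypes T \<union> etypes T. \<exists>G. one_PI T G \<and> ext_type G = w)"


section \<open>Subgraphs and contraction\<close>

definition subgraph :: "'h ftheory \<Rightarrow> 'h hgraph \<Rightarrow> 'h hgraph \<Rightarrow> bool" where
  "subgraph T G' G \<longleftrightarrow>
     feynman T G' \<and> halves G' \<subseteq> halves G \<and> verts G' = src G ` halves G' \<and>
     src G' = restrict (src G) (halves G') \<and> htype G' = restrict (htype G) (halves G') \<and>
     (\<forall>e\<in>halves G'. pairing G' e = e \<or> pairing G' e = pairing G e)"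

text \<open>Contraction of a connected subgraph \<open>C\<close> of \<open>G\<close>. The formulas below need not produce a
  well-formed graph: if a half-edge outside \<open>C\<close> is attached to a vertex of \<open>C\<close>, or if an edge type
  subgraph has an external half-edge that is also external in \<open>G\<close> while the other one is not, then
  the source map or the pairing leaves its intended codomain. Such subgraphs are discarded by the
  requirement that the quotient be a Feynman graph. The label of the new vertex avoids
  \<^term>\<open>src G ` halves G\<close> so that a half-edge whose vertex has been removed cannot be captured by a
  vertex created later.\<close>

definition new_vertex :: "'h hgraph \<Rightarrow> nat" where
  "new_vertex G = (LEAST n. n \<notin> verts G \<union> src G ` halves G)"

definition contract_to_vertex :: "'h hgraph \<Rightarrow> 'h hgraph \<Rightarrow> 'h hgraph" where
  "contract_to_vertex G C =
     (let E = (halves G - halves C) \<union> ext_halves C in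
      \<lparr>halves = E,
       verts = insert (new_vertex G) (verts G - verts C),
       pairing = restrict (pairing G) E,
       src = (\<lambda>e\<in>E. if e \<in> ext_halves C then new_vertex G else src G e),
       htype = restrict (htype G) E\<rparr>)"

text \<open>If \<open>e\<^sub>1\<close>, \<open>e\<^sub>2\<close> are the external half-edges of \<open>C\<close>, the partner of \<open>i(e\<^sub>1)\<close> becomes \<open>i(e\<^sub>2)\<close>
  and vice versa.\<close>

definition contract_to_edge :: "'h hgraph \<Rightarrow> 'h hgraph \<Rightarrow> 'h hgraph" where
  "contract_to_edge G C =
     (let E = halves G - halves C in
      \<lparr>halves = E,
       verts = verts G - verts C,
       pairing = (\<lambda>e\<in>E. if pairing G e \<in> ext_halves C
                        then pairing G (the_elem (ext_halves C - {pairing G e}))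
                        else pairing G e),
       src = restrict (src G) E,
       htype = restrict (htype G) E\<rparr>)"

definition contract_connected :: "'h ftheory \<Rightarrow> 'h hgraph \<Rightarrow> 'h hgraph \<Rightarrow> 'h hgraph" where
  "contract_connected T G C =
     (if C \<in> components G then restrict_graph G (halves G - halves C) (verts G - verts C)
      else if ext_type C \<in> vtypes T then contract_to_vertex G C
      else contract_to_edge G C)"

text \<open>The components of \<open>G'\<close> are contracted one after the other, in an arbitrary order.\<close>

definition contract :: "'h ftheory \<Rightarrow> 'h hgraph \<Rightarrow> 'h hgraph \<Rightarrow> 'h hgraph" where
  "contract T G G' =
     fold (\<lambda>C H. contract_connected T H C)
       (SOME Cs. distinct Cs \<and> set Cs = components G') G"

definition admissible :: "'h ftheory \<Rightarrow> 'h hgraph \<Rightarrow> 'h hgraph \<Rightarrow> bool" where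
  "admissible T G' G \<longleftrightarrow> subgraph T G' G \<and> feynman T (contract T G G')"

lemma finite_admissible:
  assumes "wf_hgraph G"
  shows "finite {G'. admissible T G' G}"
proof -
  let ?P = "SIGMA E : Pow (halves G). E \<rightarrow>\<^sub>E E"
  let ?g = "\<lambda>(E, p). \<lparr>halves = E, verts = src G ` E, pairing = p, src = restrict (src G) E,
                     htype = restrict (htype G) E\<rparr>"
  have "G' \<in> ?g ` ?P" if "subgraph T G' G" for G'
    using that by (intro image_eqI[of _ _ "(halves G', pairing G')"])
      (auto simp: subgraph_def feynman_def wf_hgraph_def)
  then have "{G'. admissible T G' G} \<subseteq> ?g ` ?P"
    by (auto simp: admissible_def)
  moreover have "finite (Pow (halves G))"
    using assms by (simp add: wf_hgraph_def)
  then have "finite ?P"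
    by (rule finite_SigmaI)
       (use assms in \<open>auto intro!: finite_PiE dest: finite_subset simp: wf_hgraph_def\<close>)
  ultimately show ?thesis by (blast intro: finite_subset)
qed

definition vertex_count :: "'h ftheory \<Rightarrow> 'h hgraph \<Rightarrow> 'h multiset \<Rightarrow> nat" where
  "vertex_count T G = (\<lambda>t\<in>vtypes T. card {v \<in> verts G. vertex_type G v = t})"

definition structure_count :: "'h ftheory \<Rightarrow> 'h hgraph \<Rightarrow> 'h multiset \<Rightarrow> nat" where
  "structure_count T G = (\<lambda>t\<in>vtypes T \<union> etypes T. card {K \<in> components G. ext_type K = t})"


section \<open>Isomorphism classes and disjoint union\<close>

definition graph_iso :: "'h hgraph \<Rightarrow> 'h hgraph \<Rightarrow> bool" where
  "graph_iso G H \<longleftrightarrow>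
     (\<exists>\<phi> \<psi>. bij_betw \<phi> (halves G) (halves H) \<and> bij_betw \<psi> (verts G) (verts H) \<and>
        (\<forall>e\<in>halves G. pairing H (\<phi> e) = \<phi> (pairing G e) \<and> src H (\<phi> e) = \<psi> (src G e) \<and>
           htype H (\<phi> e) = htype G e))"

definition same_graph :: "'h hgraph \<Rightarrow> 'h hgraph \<Rightarrow> bool" where
  "same_graph G H \<longleftrightarrow> wf_hgraph G \<and> wf_hgraph H \<and> graph_iso G H"

definition empty_graph :: "'h hgraph" where
  "empty_graph = \<lparr>halves = {}, verts = {}, pairing = (\<lambda>_. undefined), src = (\<lambda>_. undefined),
     htype = (\<lambda>_. undefined)\<rparr>"

definition tag_union :: "nat set \<Rightarrow> nat set \<Rightarrow> nat set" where
  "tag_union A B = sum_encode ` (A <+> B)"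

definition tag_map :: "(nat \<Rightarrow> nat) \<Rightarrow> (nat \<Rightarrow> nat) \<Rightarrow> nat \<Rightarrow> nat" where
  "tag_map g h n = sum_encode (map_sum g h (sum_decode n))"

definition disj_union :: "'h hgraph \<Rightarrow> 'h hgraph \<Rightarrow> 'h hgraph" where
  "disj_union G H =
     (let E = tag_union (halves G) (halves H) in
      \<lparr>halves = E,
       verts = tag_union (verts G) (verts H),
       pairing = restrict (tag_map (pairing G) (pairing H)) E,
       src = restrict (tag_map (src G) (src H)) E,
       htype = (\<lambda>e\<in>E. case_sum (htype G) (htype H) (sum_decode e))\<rparr>)"

lemma graph_isoI:
  assumes "bij_betw \<phi> (halves G) (halves H)" "bij_betw \<psi> (verts G) (verts H)"
    and "\<And>e. e \<in> halves G \<Longrightarrow> pairing H (\<phi> e) = \<phi> (pairing G e)"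
    and "\<And>e. e \<in> halves G \<Longrightarrow> src H (\<phi> e) = \<psi> (src G e)"
    and "\<And>e. e \<in> halves G \<Longrightarrow> htype H (\<phi> e) = htype G e"
  shows "graph_iso G H"
  using assms unfolding graph_iso_def by blast

lemma graph_iso_refl: "graph_iso G G"
  by (rule graph_isoI[of id _ _ id]) auto

lemma same_graph_sym: "same_graph G H \<Longrightarrow> same_graph H G"
proof -
  assume s: "same_graph G H"
  then obtain \<phi> \<psi> where b: "bij_betw \<phi> (halves G) (halves H)" "bij_betw \<psi> (verts G) (verts H)"
    and c: "\<And>e. e \<in> halves G \<Longrightarrow> pairing H (\<phi> e) = \<phi> (pairing G e) \<and> src H (\<phi> e) = \<psi> (src G e) \<and>
           htype H (\<phi> e) = htype G e"
    unfolding same_graph_def graph_iso_def by blast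
  have wG: "wf_hgraph G" using s by (simp add: same_graph_def)
  have "graph_iso H G"
  proof (rule graph_isoI[of "inv_into (halves G) \<phi>" _ _ "inv_into (verts G) \<psi>"])
    show "bij_betw (inv_into (halves G) \<phi>) (halves H) (halves G)"
      and "bij_betw (inv_into (verts G) \<psi>) (verts H) (verts G)"
      using b by (auto intro: bij_betw_inv_into)
    fix e assume e: "e \<in> halves H"
    define d where "d = inv_into (halves G) \<phi> e"
    have d: "d \<in> halves G" "\<phi> d = e"
      using b(1) e unfolding d_def by (auto simp: bij_betw_def inv_into_into f_inv_into_f)
    have m: "pairing G d \<in> halves G" "src G d \<in> verts G"
      using wG d(1) unfolding wf_hgraph_def by auto
    show "pairing G (inv_into (halves G) \<phi> e) = inv_into (halves G) \<phi> (pairing H e)"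
      using c[OF d(1)] d m bij_betw_inv_into_left[OF b(1) m(1)] by (simp flip: d_def)
    show "src G (inv_into (halves G) \<phi> e) = inv_into (verts G) \<psi> (src H e)"
      using c[OF d(1)] d m bij_betw_inv_into_left[OF b(2) m(2)] by (simp flip: d_def)
    show "htype G (inv_into (halves G) \<phi> e) = htype H e"
      using c[OF d(1)] d by (simp flip: d_def)
  qed
  then show ?thesis using s by (simp add: same_graph_def)
qed

lemma graph_iso_trans:
  assumes "graph_iso G H" "graph_iso H K"
  shows "graph_iso G K"
proof -
  obtain \<phi> \<psi> where b: "bij_betw \<phi> (halves G) (halves H)" "bij_betw \<psi> (verts G) (verts H)"
    and c: "\<And>e. e \<in> halves G \<Longrightarrow> pairing H (\<phi> e) = \<phi> (pairing G e) \<and> src H (\<phi> e) = \<psi> (src G e) \<and>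
           htype H (\<phi> e) = htype G e"
    using assms(1) unfolding graph_iso_def by blast
  obtain \<phi>' \<psi>' where b': "bij_betw \<phi>' (halves H) (halves K)" "bij_betw \<psi>' (verts H) (verts K)"
    and c': "\<And>e. e \<in> halves H \<Longrightarrow> pairing K (\<phi>' e) = \<phi>' (pairing H e) \<and> src K (\<phi>' e) = \<psi>' (src H e) \<and>
           htype K (\<phi>' e) = htype H e"
    using assms(2) unfolding graph_iso_def by blast
  have m: "\<phi> e \<in> halves H" if "e \<in> halves G" for e
    using b(1) that by (auto simp: bij_betw_def)
  show ?thesis
    by (rule graph_isoI[of "\<phi>' \<circ> \<phi>" _ _ "\<psi>' \<circ> \<psi>"])
       (use b b' c c' m in \<open>auto intro: bij_betw_trans\<close>)
qed

lemma wf_empty_graph: "wf_hgraph empty_graph"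
  by (auto simp: wf_hgraph_def empty_graph_def)

quotient_type 'h fgraph = "'h hgraph" / partial: same_graph
  morphisms rep_fgraph iso_class
proof (rule part_equivpI)
  show "\<exists>G :: 'h hgraph. same_graph G G"
    using wf_empty_graph graph_iso_refl by (auto simp: same_graph_def)
  show "symp (same_graph :: 'h hgraph \<Rightarrow> _)"
    by (rule sympI) (rule same_graph_sym)
  show "transp (same_graph :: 'h hgraph \<Rightarrow> _)"
    by (rule transpI) (use graph_iso_trans in \<open>unfold same_graph_def, blast\<close>)
qed

lemma mem_tag_union [simp]:
  "sum_encode (Inl a) \<in> tag_union A B \<longleftrightarrow> a \<in> A"
  "sum_encode (Inr b) \<in> tag_union A B \<longleftrightarrow> b \<in> B"
  by (auto simp: tag_union_def sum_encode_eq)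

lemma tag_unionE:
  assumes "e \<in> tag_union A B"
  obtains a where "a \<in> A" "e = sum_encode (Inl a)" | b where "b \<in> B" "e = sum_encode (Inr b)"
  using assms by (auto simp: tag_union_def)

lemma tag_map_simps [simp]:
  "tag_map g h (sum_encode (Inl a)) = sum_encode (Inl (g a))"
  "tag_map g h (sum_encode (Inr b)) = sum_encode (Inr (h b))"
  by (simp_all add: tag_map_def)

lemma disj_union_simps [simp]:
  "halves (disj_union G H) = tag_union (halves G) (halves H)"
  "verts (disj_union G H) = tag_union (verts G) (verts H)"
  "a \<in> halves G \<Longrightarrow> pairing (disj_union G H) (sum_encode (Inl a)) = sum_encode (Inl (pairing G a))"
  "b \<in> halves H \<Longrightarrow> pairing (disj_union G H) (sum_encode (Inr b)) = sum_encode (Inr (pairing H b))"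
  "a \<in> halves G \<Longrightarrow> src (disj_union G H) (sum_encode (Inl a)) = sum_encode (Inl (src G a))"
  "b \<in> halves H \<Longrightarrow> src (disj_union G H) (sum_encode (Inr b)) = sum_encode (Inr (src H b))"
  "a \<in> halves G \<Longrightarrow> htype (disj_union G H) (sum_encode (Inl a)) = htype G a"
  "b \<in> halves H \<Longrightarrow> htype (disj_union G H) (sum_encode (Inr b)) = htype H b"
  by (simp_all add: disj_union_def Let_def)

lemma wf_hgraph_mem:
  assumes "wf_hgraph G" "e \<in> halves G"
  shows "pairing G e \<in> halves G" "src G e \<in> verts G" "pairing G (pairing G e) = e"
  using assms by (auto simp: wf_hgraph_def)

lemma same_graph_wf: "same_graph G H \<Longrightarrow> wf_hgraph G"
  by (simp add: same_graph_def)

lemma wf_disj_union: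
  assumes "wf_hgraph G" "wf_hgraph H"
  shows "wf_hgraph (disj_union G H)"
  unfolding wf_hgraph_def
proof (intro conjI ballI)
  show "finite (halves (disj_union G H))" "finite (verts (disj_union G H))"
    using assms by (auto simp: wf_hgraph_def tag_union_def)
  show "pairing (disj_union G H) \<in> halves (disj_union G H) \<rightarrow>\<^sub>E halves (disj_union G H)"
    using assms
    by (intro PiE_I) (auto elim!: tag_unionE dest: wf_hgraph_mem simp: disj_union_def Let_def)
  show "src (disj_union G H) \<in> halves (disj_union G H) \<rightarrow>\<^sub>E verts (disj_union G H)"
    using assms
    by (intro PiE_I) (auto elim!: tag_unionE dest: wf_hgraph_mem simp: disj_union_def Let_def)
  show "htype (disj_union G H) \<in> extensional (halves (disj_union G H))"
    by (simp add: disj_union_def Let_def)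
  show "pairing (disj_union G H) (pairing (disj_union G H) e) = e"
    if "e \<in> halves (disj_union G H)" for e
    using that assms by (auto elim!: tag_unionE simp: wf_hgraph_mem)
qed

lemma bij_betw_tag_union:
  assumes "bij_betw f A A'" "bij_betw g B B'"
  shows "bij_betw (tag_map f g) (tag_union A B) (tag_union A' B')"
  using assms
  by (intro bij_betw_byWitness[of _ "tag_map (inv_into A f) (inv_into B g)"])
     (auto elim!: tag_unionE simp: bij_betw_def f_inv_into_f inv_into_into)

lemma same_graph_disj_union:
  assumes "same_graph G G'" "same_graph H H'"
  shows "same_graph (disj_union G H) (disj_union G' H')"
proof -
  obtain \<phi> \<psi> where b: "bij_betw \<phi> (halves G) (halves G')" "bij_betw \<psi> (verts G) (verts G')"
    and c: "\<And>e. e \<in> halves G \<Longrightarrow> pairing G' (\<phi> e) = \<phi> (pairing G e) \<and> src G' (\<phi> e) = \<psi> (src G e) \<and>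
           htype G' (\<phi> e) = htype G e"
    using assms(1) unfolding same_graph_def graph_iso_def by blast
  obtain \<phi>' \<psi>' where b': "bij_betw \<phi>' (halves H) (halves H')" "bij_betw \<psi>' (verts H) (verts H')"
    and c': "\<And>e. e \<in> halves H \<Longrightarrow> pairing H' (\<phi>' e) = \<phi>' (pairing H e) \<and> src H' (\<phi>' e) = \<psi>' (src H e) \<and>
           htype H' (\<phi>' e) = htype H e"
    using assms(2) unfolding same_graph_def graph_iso_def by blast
  have m [simp]: "\<phi> e \<in> halves G'" if "e \<in> halves G" for e
    using b(1) that by (auto simp: bij_betw_def)
  have m' [simp]: "\<phi>' e \<in> halves H'" if "e \<in> halves H" for e
    using b'(1) that by (auto simp: bij_betw_def)
  have "graph_iso (disj_union G H) (disj_union G' H')"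
    by (rule graph_isoI[of "tag_map \<phi> \<phi>'" _ _ "tag_map \<psi> \<psi>'"])
       (use b b' in \<open>auto elim!: tag_unionE simp: c c' intro: bij_betw_tag_union\<close>)
  then show ?thesis
    using assms wf_disj_union by (auto simp: same_graph_def)
qed

lemma disj_union_comm:
  assumes "wf_hgraph G" "wf_hgraph H"
  shows "same_graph (disj_union G H) (disj_union H G)"
proof -
  define s where "s n = sum_encode (case_sum Inr Inl (sum_decode n))" for n
  have s [simp]: "s (sum_encode (Inl a)) = sum_encode (Inr a)"
    "s (sum_encode (Inr a)) = sum_encode (Inl a)" for a
    by (simp_all add: s_def)
  have bij: "bij_betw s (tag_union A B) (tag_union B A)" for A B
    by (rule bij_betw_byWitness[of _ s]) (auto elim!: tag_unionE)
  have "graph_iso (disj_union G H) (disj_union H G)"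
    by (rule graph_isoI[of s _ _ s]) (auto elim!: tag_unionE simp: bij)
  then show ?thesis using assms wf_disj_union by (auto simp: same_graph_def)
qed

lemma disj_union_assoc:
  assumes "wf_hgraph G" "wf_hgraph H" "wf_hgraph K"
  shows "same_graph (disj_union (disj_union G H) K) (disj_union G (disj_union H K))"
proof -
  define s where "s n = (case sum_decode n of
      Inl m \<Rightarrow> (case sum_decode m of Inl a \<Rightarrow> sum_encode (Inl a)
                                  | Inr b \<Rightarrow> sum_encode (Inr (sum_encode (Inl b))))
    | Inr c \<Rightarrow> sum_encode (Inr (sum_encode (Inr c))))" for n
  define r where "r n = (case sum_decode n of
      Inl a \<Rightarrow> sum_encode (Inl (sum_encode (Inl a)))
    | Inr m \<Rightarrow> (case sum_decode m of Inl b \<Rightarrow> sum_encode (Inl (sum_encode (Inr b)))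
                                  | Inr c \<Rightarrow> sum_encode (Inr c)))" for n
  have s [simp]:
    "s (sum_encode (Inl (sum_encode (Inl a)))) = sum_encode (Inl a)"
    "s (sum_encode (Inl (sum_encode (Inr a)))) = sum_encode (Inr (sum_encode (Inl a)))"
    "s (sum_encode (Inr a)) = sum_encode (Inr (sum_encode (Inr a)))" for a
    by (simp_all add: s_def)
  have r [simp]:
    "r (sum_encode (Inl a)) = sum_encode (Inl (sum_encode (Inl a)))"
    "r (sum_encode (Inr (sum_encode (Inl a)))) = sum_encode (Inl (sum_encode (Inr a)))"
    "r (sum_encode (Inr (sum_encode (Inr a)))) = sum_encode (Inr a)" for a
    by (simp_all add: r_def)
  have bij: "bij_betw s (tag_union (tag_union A B) C) (tag_union A (tag_union B C))" for A B C
    by (rule bij_betw_byWitness[of _ r]) (auto elim!: tag_unionE)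
  have "graph_iso (disj_union (disj_union G H) K) (disj_union G (disj_union H K))"
    by (rule graph_isoI[of s _ _ s]) (auto elim!: tag_unionE simp: bij)
  then show ?thesis using assms wf_disj_union by (auto simp: same_graph_def)
qed

lemma disj_union_empty:
  fixes G :: "'a hgraph"
  assumes "wf_hgraph G"
  shows "same_graph (disj_union empty_graph G) G"
proof -
  define s where "s n = projr (sum_decode n)" for n
  have s [simp]: "s (sum_encode (Inr a)) = a" for a
    by (simp add: s_def)
  have bij: "bij_betw s (tag_union {} A) A" for A
    by (rule bij_betw_byWitness[of _ "\<lambda>a. sum_encode (Inr a)"]) (auto elim!: tag_unionE)
  have "halves (empty_graph :: 'a hgraph) = {}" "verts (empty_graph :: 'a hgraph) = {}"
    by (simp_all add: empty_graph_def)
  then have "graph_iso (disj_union empty_graph G) G"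
    by (intro graph_isoI[of s _ _ s]) (auto elim!: tag_unionE simp: bij)
  then show ?thesis using assms wf_disj_union wf_empty_graph by (auto simp: same_graph_def)
qed

instantiation fgraph :: (type) comm_monoid_add
begin

lift_definition zero_fgraph :: "'a fgraph" is empty_graph
  using wf_empty_graph graph_iso_refl by (auto simp: same_graph_def)

lift_definition plus_fgraph :: "'a fgraph \<Rightarrow> 'a fgraph \<Rightarrow> 'a fgraph" is disj_union
  by (rule same_graph_disj_union)

instance
proof
  fix a b c :: "'a fgraph"
  show "a + b + c = a + (b + c)"
    by transfer (blast intro: disj_union_assoc dest: same_graph_wf)
  show "a + b = b + a"
    by transfer (blast intro: disj_union_comm dest: same_graph_wf)
  show "0 + a = a"
    by transfer (blast intro: disj_union_empty dest: same_graph_wf)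
qed

end


section \<open>The Hopf algebra of Feynman graphs\<close>

text \<open>Vectors are finitely supported functions on a basis. With disjoint union as addition on
  isomorphism classes, the multiplication of \<^typ>\<open>'h fgraph \<Rightarrow>\<^sub>0 'k\<close> is the bilinear extension of
  the disjoint union, and the Hopf algebra of \<open>T\<close> is the subalgebra \<open>hopf_FG T\<close>. The tensor square
  has the pairs of basis elements as its basis.\<close>

definition pm_scale :: "'k::field \<Rightarrow> ('b \<Rightarrow>\<^sub>0 'k) \<Rightarrow> ('b \<Rightarrow>\<^sub>0 'k)" where
  "pm_scale c x = Poly_Mapping.map ((*) c) x"

lemma lookup_pm_scale: "Poly_Mapping.lookup (pm_scale c x) b = c * Poly_Mapping.lookup x b"
  by (simp add: pm_scale_def map.rep_eq when_def)

interpretation pm: vector_space "pm_scale :: 'k::field \<Rightarrow> ('b \<Rightarrow>\<^sub>0 'k) \<Rightarrow> ('b \<Rightarrow>\<^sub>0 'k)"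
  by unfold_locales
     (auto intro!: poly_mapping_eqI simp: lookup_pm_scale lookup_add algebra_simps)

definition basis_vec :: "'h hgraph \<Rightarrow> ('h fgraph \<Rightarrow>\<^sub>0 'k::field)" where
  "basis_vec G = Poly_Mapping.single (iso_class G) 1"

definition hopf_FG :: "'h ftheory \<Rightarrow> ('h fgraph \<Rightarrow>\<^sub>0 'k::field) set" where
  "hopf_FG T = pm.span {basis_vec G | G. feynman T G}"

definition tensor :: "('a \<Rightarrow>\<^sub>0 'k::field) \<Rightarrow> ('b \<Rightarrow>\<^sub>0 'k) \<Rightarrow> ('a \<times> 'b \<Rightarrow>\<^sub>0 'k)" where
  "tensor x y =
     (\<Sum>a\<in>Poly_Mapping.keys x. \<Sum>b\<in>Poly_Mapping.keys y.
        Poly_Mapping.single (a, b) (Poly_Mapping.lookup x a * Poly_Mapping.lookup y b))"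

definition coproduct_graph :: "'h ftheory \<Rightarrow> 'h hgraph \<Rightarrow> ('h fgraph \<times> 'h fgraph \<Rightarrow>\<^sub>0 'k::field)" where
  "coproduct_graph T G =
     (\<Sum>G' | admissible T G' G. tensor (basis_vec G') (basis_vec (contract T G G')))"

definition coproduct ::
  "'h ftheory \<Rightarrow> ('h fgraph \<Rightarrow>\<^sub>0 'k::field) \<Rightarrow> ('h fgraph \<times> 'h fgraph \<Rightarrow>\<^sub>0 'k)" where
  "coproduct T x =
     (\<Sum>a\<in>Poly_Mapping.keys x.
        pm_scale (Poly_Mapping.lookup x a) (coproduct_graph T (rep_fgraph a)))"

text \<open>For a vector space graduation \<open>M\<close> of \<open>hopf_FG T\<close>: the product maps \<open>M a \<otimes> M b\<close> into
  \<open>M (a + b)\<close> and the coproduct maps \<open>M a\<close> into the sum of the \<open>M b \<otimes> M c\<close> with \<open>b + c = a\<close>.\<close>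

definition hopf_graduation ::
  "'h ftheory \<Rightarrow> ('d::ab_group_add \<Rightarrow> ('h fgraph \<Rightarrow>\<^sub>0 'k::field) set) \<Rightarrow> bool" where
  "hopf_graduation T M \<longleftrightarrow>
     (\<forall>a b. \<forall>x\<in>M a. \<forall>y\<in>M b. x * y \<in> M (a + b)) \<and>
     (\<forall>a. \<forall>x\<in>M a. coproduct T x \<in> pm.span {tensor y z | y z b c. y \<in> M b \<and> z \<in> M c \<and> b + c = a})"

definition graded_part ::
  "'h ftheory \<Rightarrow> ('h hgraph \<Rightarrow> 'd) \<Rightarrow> 'd \<Rightarrow> ('h fgraph \<Rightarrow>\<^sub>0 'k::field) set" where
  "graded_part T deg a = pm.span {basis_vec G | G. feynman T G \<and> deg G = a}"

lemma span_graded_parts: "pm.span (\<Union>a. graded_part T deg a) = hopf_FG T"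
proof
  show "pm.span (\<Union>a. graded_part T deg a) \<subseteq> hopf_FG T"
    unfolding hopf_FG_def graded_part_def
    by (intro pm.span_minimal pm.subspace_span UN_least pm.span_mono) blast
  show "hopf_FG T \<subseteq> pm.span (\<Union>a. graded_part T deg a)"
    unfolding hopf_FG_def graded_part_def
    by (intro pm.span_mono) (auto intro: pm.span_base)
qed


section \<open>Rational matrices\<close>

text \<open>A matrix with \<open>N\<close> rows whose columns are indexed by a finite set \<open>I\<close> of types is given by its
  entries; only the columns in \<open>I\<close> matter.\<close>

type_synonym ('n, 'h) rat_mat = "'n \<Rightarrow> 'h multiset \<Rightarrow> rat"

definition mat_app :: "'h multiset set \<Rightarrow> ('n, 'h) rat_mat \<Rightarrow> ('h multiset \<Rightarrow> nat) \<Rightarrow> rat ^ 'n" where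
  "mat_app I C x = (\<chi> n. \<Sum>t\<in>I. C n t * of_nat (x t))"

definition adjoin_zero_columns :: "'h ftheory \<Rightarrow> ('n, 'h) rat_mat \<Rightarrow> ('n, 'h) rat_mat" where
  "adjoin_zero_columns T C = (\<lambda>n t. if t \<in> vtypes T then C n t else 0)"

end

theory Submission
  imports Defs
begin

text \<open>Write \<open>V\<^sub>G\<close> and \<open>S\<^sub>G\<close> for the vectors of vertex types and of external structures of a graph \<open>G\<close>.
  A graduation by a degree of graphs is a Hopf algebra graduation iff the degree is additive under
  disjoint union and under \<open>G \<mapsto> (G', G/G')\<close> for all admissible \<open>G'\<close>: the graded parts are spanned by
  basis vectors, and in characteristic zero no term of a coproduct cancels
  (\<open>hopf_graduation_iff\<close>).

  Sufficiency. Contracting a connected \<open>C\<close> removes its vertices. If \<open>C\<close> is of vertex type \<open>t\<close> and is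
  not a whole component, then a vertex of type \<open>t\<close> appears and no component is lost; if \<open>C\<close> is a
  component, it is lost and no vertex appears. In all cases, also for edge types, the coordinate of
  \<open>V\<^sub>G - S\<^sub>G\<close> at a vertex type is additive (\<open>contract_step\<close>, \<open>balance_contract\<close>), and the formula for the
  degree is a linear function of these coordinates. The delicate point is that the components of
  \<open>G'\<close> are contracted one after the other and only the last graph is known to be a Feynman graph. The
  intermediate graphs are controlled by two properties that pass to contractions, the absence of
  bridges and the presence of external half-edges in every component (\<open>robust\<close>).

  Necessity. Additivity under disjoint union and the dependence on \<open>V\<^sub>G\<close> and \<open>S\<^sub>G\<close> alone make the degree
  the restriction of a linear map, \<open>deg G = C V\<^sub>G + D S\<^sub>G\<close> (\<open>additive_imp_linear\<close>). Let \<open>K\<close> be an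
  irreducible graph with external structure \<open>w\<close>. If \<open>K\<close> can be inserted into an irreducible graph,
  then contracting it again shows that the column of \<open>D\<close> at \<open>w\<close> is minus that of \<open>C\<close> if \<open>w\<close> is a vertex
  type, and zero if \<open>w\<close> is an edge type (\<open>structure_coefficient\<close>). Insertion is possible at every
  vertex of type \<open>w\<close> (\<open>vertex_insertion_ex\<close>), and for every edge type (\<open>edge_insertion_ex\<close>): a row
  of three copies of \<open>K\<close>, in which the two outer copies exchange an internal edge, is irreducible. A
  vertex type that is not the type of any vertex of an irreducible graph leaves its column of \<open>C\<close>
  free, so that this column can be taken to be minus that of \<open>D\<close>.

  Connectivity is expressed by cuts: a graph is irreducible only if at least two half-edges leave each
  proper nonempty set of vertices, and the components are the minimal nonempty sets of vertices that
  no half-edge leaves (\<open>one_PI_iff\<close>, \<open>quotient_reach\<close>). Contractions and insertions are then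
  analysed by comparing cuts, without paths.\<close>


section \<open>Cuts, closed sets and connected components\<close>

text \<open>The half-edges leaving a set \<open>W\<close> of vertices. Each internal edge between \<open>W\<close> and its
  complement contributes exactly one half-edge, and the two halves of a loop contribute none.\<close>

definition cut :: "'h hgraph \<Rightarrow> nat set \<Rightarrow> nat set" where
  "cut G W = {e \<in> halves G. src G e \<in> W \<and> src G (pairing G e) \<notin> W}"

text \<open>Unions of connected components, described by their vertex sets.\<close>

definition closed_sets :: "'h hgraph \<Rightarrow> nat set set" where
  "closed_sets G = {W. W \<subseteq> verts G \<and> cut G W = {}}"

text \<open>The vertex sets of the connected components, as the minimal nonempty closed sets.\<close>

definition blocks :: "'h hgraph \<Rightarrow> nat set set" where
  "blocks G = {W \<in> closed_sets G. W \<noteq> {} \<and> (\<forall>U\<in>closed_sets G. U \<noteq> {} \<longrightarrow> U \<subseteq> W \<longrightarrow> U = W)}"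

text \<open>The condition on one-particle irreducible graphs in terms of cuts: every proper nonempty set of
  vertices is left by at least two half-edges.\<close>

definition two_connected :: "'h hgraph \<Rightarrow> bool" where
  "two_connected G \<longleftrightarrow>
     (\<forall>W. W \<subseteq> verts G \<longrightarrow> W \<noteq> {} \<longrightarrow> W \<noteq> verts G \<longrightarrow> (\<exists>e\<in>cut G W. \<exists>e'\<in>cut G W. e \<noteq> e'))"

lemma int_edge_iff:
  assumes "wf_hgraph G"
  shows "{e, e'} \<in> int_edges G \<longleftrightarrow> e \<in> halves G \<and> e' = pairing G e \<and> e' \<noteq> e"
proof
  assume "{e, e'} \<in> int_edges G"
  then obtain x where x: "x \<in> halves G" "pairing G x \<noteq> x" "{e, e'} = {x, pairing G x}"
    by (auto simp: int_edges_def)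
  with wf_hgraph_mem[OF assms x(1)] show "e \<in> halves G \<and> e' = pairing G e \<and> e' \<noteq> e"
    by (auto simp: doubleton_eq_iff)
qed (auto simp: int_edges_def)

lemma reach_image:
  assumes "wf_hgraph G" "F \<subseteq> int_edges G" "u \<in> verts G"
  defines "Z \<equiv> reach G F `` {u}"
  shows "u \<in> Z" "Z \<subseteq> verts G"
    and "\<And>e. {e, pairing G e} \<in> F \<Longrightarrow> src G e \<in> Z \<Longrightarrow> src G (pairing G e) \<in> Z"
    and "\<And>W. u \<in> W \<Longrightarrow>
      (\<And>e. {e, pairing G e} \<in> F \<Longrightarrow> src G e \<in> W \<Longrightarrow> src G (pairing G e) \<in> W) \<Longrightarrow> Z \<subseteq> W"
proof -
  let ?R = "{(src G e, src G e') | e e'. {e, e'} \<in> F}"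
  show "u \<in> Z" "Z \<subseteq> verts G"
    using assms(3) by (auto simp: Z_def reach_def)
  show "src G (pairing G e) \<in> Z" if "{e, pairing G e} \<in> F" "src G e \<in> Z" for e
  proof -
    have "(src G e, src G (pairing G e)) \<in> ?R" using that by blast
    moreover have "e \<in> halves G" using that assms(1,2) int_edge_iff by blast
    then have "src G (pairing G e) \<in> verts G"
      using assms(1) by (blast dest: wf_hgraph_mem)
    ultimately show ?thesis
      using that(2) by (auto simp: Z_def reach_def intro: rtrancl_into_rtrancl)
  qed
  show "Z \<subseteq> W" if "u \<in> W"
    and c: "\<And>e. {e, pairing G e} \<in> F \<Longrightarrow> src G e \<in> W \<Longrightarrow> src G (pairing G e) \<in> W" for W
  proof
    fix v assume "v \<in> Z"
    then have "(u, v) \<in> ?R\<^sup>*" by (simp add: Z_def reach_def)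
    then show "v \<in> W"
    proof induction
      case (step y z)
      then obtain e e' where "{e, e'} \<in> F" "y = src G e" "z = src G e'" by blast
      moreover from this have "e' = pairing G e" using assms(1,2) int_edge_iff by blast
      ultimately show ?case using c step.IH by blast
    qed (use that in simp)
  qed
qed

lemma closed_setsD:
  assumes "W \<in> closed_sets G" "e \<in> halves G" "src G e \<in> W"
  shows "src G (pairing G e) \<in> W"
  using assms by (auto simp: closed_sets_def cut_def)

lemma closed_sets_subset: "W \<in> closed_sets G \<Longrightarrow> W \<subseteq> verts G"
  by (simp add: closed_sets_def)

lemma closed_sets_Int: "U \<in> closed_sets G \<Longrightarrow> W \<in> closed_sets G \<Longrightarrow> U \<inter> W \<in> closed_sets G"
  by (auto simp: closed_sets_def cut_def)

lemma closed_sets_Diff: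
  assumes "wf_hgraph G" "U \<in> closed_sets G" "W \<in> closed_sets G"
  shows "U - W \<in> closed_sets G"
proof -
  have "src G (pairing G e) \<in> U - W" if e: "e \<in> halves G" "src G e \<in> U - W" for e
  proof -
    have "src G (pairing G e) \<in> U" using closed_setsD[OF assms(2)] e by blast
    moreover have "src G (pairing G e) \<notin> W"
      using closed_setsD[OF assms(3), of "pairing G e"] e wf_hgraph_mem[OF assms(1) e(1)] by auto
    ultimately show ?thesis by blast
  qed
  then show ?thesis using assms(2) by (auto simp: closed_sets_def cut_def)
qed

lemma empty_closed [simp]: "{} \<in> closed_sets G"
  by (simp add: closed_sets_def cut_def)

lemma verts_closed: "wf_hgraph G \<Longrightarrow> verts G \<in> closed_sets G"
  by (auto simp: closed_sets_def cut_def dest: wf_hgraph_mem)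

lemma blocks_closed: "U \<in> blocks G \<Longrightarrow> U \<in> closed_sets G"
  and blocks_nonempty: "U \<in> blocks G \<Longrightarrow> U \<noteq> {}"
  and blocks_minimal: "U \<in> blocks G \<Longrightarrow> W \<in> closed_sets G \<Longrightarrow> W \<noteq> {} \<Longrightarrow> W \<subseteq> U \<Longrightarrow> W = U"
  unfolding blocks_def by blast+

lemma quotient_reach:
  assumes "wf_hgraph G"
  shows "verts G // reach G (int_edges G) = blocks G"
proof -
  let ?Z = "\<lambda>u. reach G (int_edges G) `` {u}"
  note r = reach_image[OF assms order_refl]
  have cl: "?Z u \<in> closed_sets G" if "u \<in> verts G" for u
  proof -
    have "src G (pairing G e) \<in> ?Z u" if "e \<in> halves G" "src G e \<in> ?Z u" for e
      using r(3)[OF \<open>u \<in> verts G\<close>, of e] that int_edge_iff[OF assms, of e "pairing G e"]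
      by (cases "pairing G e = e") auto
    then show ?thesis using r(2)[OF that] by (auto simp: closed_sets_def cut_def)
  qed
  have sub: "?Z u \<subseteq> W" if "W \<in> closed_sets G" "u \<in> W" for u W
  proof (rule r(4))
    show "u \<in> verts G" using that closed_sets_subset by blast
    show "src G (pairing G e) \<in> W" if "{e, pairing G e} \<in> int_edges G" "src G e \<in> W" for e
      using that \<open>W \<in> closed_sets G\<close> int_edge_iff[OF assms] closed_setsD by blast
  qed (use that in auto)
  have blk: "?Z u \<in> blocks G" if u: "u \<in> verts G" for u
    unfolding blocks_def
  proof (intro CollectI conjI ballI impI)
    show "?Z u \<in> closed_sets G" "?Z u \<noteq> {}" using cl[OF u] r(1)[OF u] by blast+
    fix U assume U: "U \<in> closed_sets G" "U \<noteq> {}" "U \<subseteq> ?Z u"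
    have "u \<in> U"
    proof (rule ccontr)
      assume "u \<notin> U"
      then have "?Z u \<subseteq> ?Z u - U"
        using r(1)[OF u] by (intro sub closed_sets_Diff[OF assms cl[OF u] U(1)]) blast
      then show False using U by blast
    qed
    then show "U = ?Z u" using sub[OF U(1)] U(3) by blast
  qed
  show ?thesis
  proof (intro equalityI subsetI)
    fix W assume "W \<in> verts G // reach G (int_edges G)"
    then show "W \<in> blocks G" using blk by (auto simp: quotient_def)
  next
    fix W assume W: "W \<in> blocks G"
    then obtain u where u: "u \<in> W" unfolding blocks_def by blast
    have c: "W \<in> closed_sets G" using W unfolding blocks_def by blast
    then have v: "u \<in> verts G" using u closed_sets_subset by blast
    have "?Z u \<noteq> {}" using r(1)[OF v] by blast
    then have "?Z u = W" using blocks_minimal[OF W cl[OF v] _ sub[OF c u]] by blast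
    then show "W \<in> verts G // reach G (int_edges G)" using v unfolding quotient_def by blast
  qed
qed

lemma block_ex:
  assumes "wf_hgraph G" "u \<in> verts G"
  obtains U where "U \<in> blocks G" "u \<in> U"
proof (rule that)
  show "reach G (int_edges G) `` {u} \<in> blocks G"
    unfolding quotient_reach[OF assms(1), symmetric] using assms(2) by (rule quotientI)
  show "u \<in> reach G (int_edges G) `` {u}"
    using reach_image(1)[OF assms(1) order_refl assms(2)] .
qed

lemma block_subset:
  assumes "U \<in> blocks G" "W \<in> closed_sets G" "u \<in> U" "u \<in> W"
  shows "U \<subseteq> W"
proof -
  have "U \<inter> W = U"
    using blocks_minimal[OF assms(1) closed_sets_Int[OF blocks_closed[OF assms(1)] assms(2)]]
      assms(3,4) by blast
  then show ?thesis by blast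
qed

lemma block_eq: "U \<in> blocks G \<Longrightarrow> W \<in> blocks G \<Longrightarrow> u \<in> U \<Longrightarrow> u \<in> W \<Longrightarrow> U = W"
  using block_subset blocks_closed by blast

lemma connected_by_iff:
  assumes "wf_hgraph G" "F \<subseteq> int_edges G"
  shows "connected_by G F \<longleftrightarrow>
    (\<forall>W. W \<subseteq> verts G \<longrightarrow> W \<noteq> {} \<longrightarrow> W \<noteq> verts G \<longrightarrow> (\<exists>e\<in>cut G W. {e, pairing G e} \<in> F))"
proof
  assume c: "connected_by G F"
  show "\<forall>W. W \<subseteq> verts G \<longrightarrow> W \<noteq> {} \<longrightarrow> W \<noteq> verts G \<longrightarrow> (\<exists>e\<in>cut G W. {e, pairing G e} \<in> F)"
  proof (intro allI impI, rule ccontr)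
    fix W assume W: "W \<subseteq> verts G" "W \<noteq> {}" "W \<noteq> verts G"
      and n: "\<not> (\<exists>e\<in>cut G W. {e, pairing G e} \<in> F)"
    obtain u v where uv: "u \<in> W" "v \<in> verts G" "v \<notin> W" using W by blast
    have "src G (pairing G e) \<in> W" if "{e, pairing G e} \<in> F" "src G e \<in> W" for e
    proof -
      have "e \<in> halves G" using that(1) assms int_edge_iff by blast
      then show ?thesis using that n by (auto simp: cut_def)
    qed
    then have "reach G F `` {u} \<subseteq> W"
      using uv W by (intro reach_image(4)[OF assms]) auto
    moreover have "(u, v) \<in> reach G F" using c uv W by (auto simp: connected_by_def)
    ultimately show False using uv by blast
  qed
next
  assume c: "\<forall>W. W \<subseteq> verts G \<longrightarrow> W \<noteq> {} \<longrightarrow> W \<noteq> verts G \<longrightarrow> (\<exists>e\<in>cut G W. {e, pairing G e} \<in> F)"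
  have "reach G F `` {u} = verts G" if u: "u \<in> verts G" for u
  proof (rule ccontr)
    assume "reach G F `` {u} \<noteq> verts G"
    then obtain e where "e \<in> cut G (reach G F `` {u})" "{e, pairing G e} \<in> F"
      using c reach_image(1,2)[OF assms u] by blast
    then show False using reach_image(3)[OF assms u] by (auto simp: cut_def)
  qed
  then show "connected_by G F" by (auto simp: connected_by_def)
qed

text \<open>The three conditions on connectedness amount to a lower bound on cuts, which is the only form
  in which they are used from here on.\<close>

lemma one_PI_iff:
  "one_PI T G \<longleftrightarrow>
     wf_hgraph G \<and> (\<exists>e\<in>halves G. pairing G e \<noteq> e) \<and> verts G \<noteq> {} \<and>
     htype G ` halves G \<subseteq> htypes T \<and>
     (\<forall>e\<in>halves G. pairing G e \<noteq> e \<longrightarrow> incid T (htype G e) = htype G (pairing G e)) \<and>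
     (\<forall>v\<in>verts G. vertex_type G v \<in> vtypes T) \<and>
     two_connected G \<and> ext_type G \<in> vtypes T \<union> etypes T"
proof (cases "wf_hgraph G \<and> (\<exists>e\<in>halves G. pairing G e \<noteq> e)")
  case True
  then have wf: "wf_hgraph G" and ne: "int_edges G \<noteq> {}" and h: "halves G \<noteq> {}"
    by (auto simp: int_edges_def)
  have "connected_by G (int_edges G) \<and> (\<forall>d\<in>int_edges G. connected_by G (int_edges G - {d}))
      \<longleftrightarrow> two_connected G" (is "?L \<longleftrightarrow> ?R")
  proof
    assume L: ?L
    show ?R unfolding two_connected_def
    proof (intro allI impI)
      fix W assume W: "W \<subseteq> verts G" "W \<noteq> {}" "W \<noteq> verts G"
      obtain e where e: "e \<in> cut G W" "{e, pairing G e} \<in> int_edges G"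
        using L W connected_by_iff[OF wf order_refl] by blast
      let ?F = "int_edges G - {{e, pairing G e}}"
      have c: "connected_by G ?F" using L e(2) by blast
      have F: "?F \<subseteq> int_edges G" by blast
      have "\<exists>e'\<in>cut G W. {e', pairing G e'} \<in> ?F"
        using iffD1[OF connected_by_iff[OF wf F] c, rule_format, OF W] .
      then obtain e' where e': "e' \<in> cut G W" "{e', pairing G e'} \<noteq> {e, pairing G e}" by blast
      then have "e \<noteq> e'" by auto
      with e(1) e'(1) show "\<exists>e\<in>cut G W. \<exists>e'\<in>cut G W. e \<noteq> e'" by blast
    qed
  next
    assume R: ?R
    have *: "connected_by G (int_edges G - D)" if D: "D = {} \<or> D = {{x, pairing G x}}" for D x
    proof -
      have F: "int_edges G - D \<subseteq> int_edges G" by blast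
      show ?thesis unfolding connected_by_iff[OF wf F]
      proof (intro allI impI)
        fix W assume W: "W \<subseteq> verts G" "W \<noteq> {}" "W \<noteq> verts G"
        obtain e e' where e: "e \<in> cut G W" "e' \<in> cut G W" "e \<noteq> e'"
          using R W unfolding two_connected_def by blast
        have i: "{c, pairing G c} \<in> int_edges G" if "c \<in> cut G W" for c
        proof -
          have "pairing G c \<noteq> c" "c \<in> halves G" using that by (auto simp: cut_def)
          then show ?thesis by (auto simp: int_edges_def)
        qed
        have "pairing G e' \<noteq> e" using e by (auto simp: cut_def)
        then have "{e, pairing G e} \<noteq> {e', pairing G e'}"
          using e(3) by (auto simp: doubleton_eq_iff)
        then have "{e, pairing G e} \<notin> D \<or> {e', pairing G e'} \<notin> D" using D by auto
        then show "\<exists>e\<in>cut G W. {e, pairing G e} \<in> int_edges G - D" using e i by blast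
      qed
    qed
    have "connected_by G (int_edges G)" using *[of "{}"] by simp
    moreover have "connected_by G (int_edges G - {d})" if "d \<in> int_edges G" for d
      using that *[of "{d}"] by (auto simp: int_edges_def)
    ultimately show ?L by blast
  qed
  then show ?thesis using wf ne h True unfolding one_PI_def by blast
next
  case False
  then have "\<not> wf_hgraph G \<or> int_edges G = {}" by (auto simp: int_edges_def)
  then show ?thesis using False unfolding one_PI_def by blast
qed

text \<open>The part of a graph that is attached to a set of vertices, meant for closed sets.\<close>

definition graph_on :: "'h hgraph \<Rightarrow> nat set \<Rightarrow> 'h hgraph" where
  "graph_on G W = restrict_graph G {e \<in> halves G. src G e \<in> W} W"

lemma graph_on_simps [simp]:
  "halves (graph_on G W) = {e \<in> halves G. src G e \<in> W}"
  "verts (graph_on G W) = W"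
  "pairing (graph_on G W) = restrict (pairing G) {e \<in> halves G. src G e \<in> W}"
  "src (graph_on G W) = restrict (src G) {e \<in> halves G. src G e \<in> W}"
  "htype (graph_on G W) = restrict (htype G) {e \<in> halves G. src G e \<in> W}"
  by (simp_all add: graph_on_def restrict_graph_def)

lemma components_eq: "wf_hgraph G \<Longrightarrow> components G = graph_on G ` blocks G"
  by (simp add: components_def quotient_reach graph_on_def)

lemma wf_graph_on:
  assumes "wf_hgraph G" "W \<in> closed_sets G"
  shows "wf_hgraph (graph_on G W)"
proof -
  have "finite (halves G)" "finite W"
    using assms closed_sets_subset[OF assms(2)] finite_subset by (auto simp: wf_hgraph_def)
  moreover have "pairing G e \<in> halves G \<and> src G (pairing G e) \<in> W \<and> pairing G (pairing G e) = e"
    if "e \<in> halves G" "src G e \<in> W" for e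
    using that closed_setsD[OF assms(2)] wf_hgraph_mem[OF assms(1) that(1)] by blast
  ultimately show ?thesis by (auto simp: wf_hgraph_def)
qed

lemma graph_on_verts: "wf_hgraph G \<Longrightarrow> graph_on G (verts G) = G"
proof -
  assume wf: "wf_hgraph G"
  then have "{e \<in> halves G. src G e \<in> verts G} = halves G" by (auto dest: wf_hgraph_mem)
  with wf show ?thesis
    by (intro hgraph.equality) (auto simp: wf_hgraph_def PiE_def extensional_restrict)
qed

text \<open>The external half-edges at a set of vertices.\<close>

definition ext_at :: "'h hgraph \<Rightarrow> nat set \<Rightarrow> nat set" where
  "ext_at G W = {e \<in> halves G. pairing G e = e \<and> src G e \<in> W}"

lemma ext_halves_graph_on: "ext_halves (graph_on G W) = ext_at G W"
  by (auto simp: ext_halves_def ext_at_def)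

lemma ext_type_graph_on: "ext_type (graph_on G W) = image_mset (htype G) (mset_set (ext_at G W))"
proof -
  have "finite (ext_at G W) \<Longrightarrow> e \<in># mset_set (ext_at G W) \<Longrightarrow>
    htype (graph_on G W) e = htype G e" for e
    by (auto simp: ext_at_def)
  then show ?thesis
    unfolding ext_type_def ext_halves_graph_on
    by (cases "finite (ext_at G W)") (auto intro!: image_mset_cong)
qed

lemma cut_graph_on:
  assumes "wf_hgraph G" "W \<in> closed_sets G"
  shows "cut (graph_on G W) U = cut G (U \<inter> W)"
proof -
  have "pairing G e \<in> halves G \<and> src G (pairing G e) \<in> W"
    if "e \<in> halves G" "src G e \<in> W" for e
    using that closed_setsD[OF assms(2)] wf_hgraph_mem[OF assms(1) that(1)] by blast
  then show ?thesis by (auto simp: cut_def)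
qed

lemma feynman_iff:
  "feynman T G \<longleftrightarrow> wf_hgraph G \<and> (\<forall>W\<in>blocks G. one_PI T (graph_on G W))"
  by (auto simp: feynman_def components_eq)

lemma blocks_one_PI:
  assumes "one_PI T G"
  shows "closed_sets G = {{}, verts G}" "blocks G = {verts G}" "components G = {G}"
proof -
  have wf: "wf_hgraph G" and ne: "verts G \<noteq> {}" and tc: "two_connected G"
    using assms by (auto simp: one_PI_iff)
  show c: "closed_sets G = {{}, verts G}"
  proof (intro equalityI subsetI)
    fix W assume W: "W \<in> closed_sets G"
    then have "cut G W = {}" "W \<subseteq> verts G" by (auto simp: closed_sets_def)
    then show "W \<in> {{}, verts G}" using tc unfolding two_connected_def by blast
  qed (use verts_closed[OF wf] in auto)
  show b: "blocks G = {verts G}" using ne unfolding blocks_def c by auto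
  show "components G = {G}" by (simp add: components_eq wf b graph_on_verts)
qed

lemma one_PI_feynman: "one_PI T G \<Longrightarrow> feynman T G"
  using blocks_one_PI(3)[of T G] by (simp add: feynman_def one_PI_def)


section \<open>Counting vertices and components\<close>

lemma wf_finite: "wf_hgraph G \<Longrightarrow> finite (halves G)" "wf_hgraph G \<Longrightarrow> finite (verts G)"
  by (simp_all add: wf_hgraph_def)

lemma finite_closed_sets: "wf_hgraph G \<Longrightarrow> finite (closed_sets G)"
  by (rule finite_subset[of _ "Pow (verts G)"]) (auto simp: closed_sets_def wf_finite)

lemma finite_blocks: "wf_hgraph G \<Longrightarrow> finite (blocks G)"
  by (rule finite_subset[OF _ finite_closed_sets]) (auto dest: blocks_closed)

lemma image_mset_bij:
  assumes "bij_betw \<phi> A B" "\<And>a. a \<in> A \<Longrightarrow> h (\<phi> a) = h' a"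
  shows "image_mset h (mset_set B) = image_mset h' (mset_set A)"
proof (cases "finite A")
  case True
  have "mset_set B = image_mset \<phi> (mset_set A)"
    using assms(1) by (simp add: bij_betw_def image_mset_mset_set)
  then show ?thesis using assms(2) True by (auto simp: multiset.map_comp intro!: image_mset_cong)
next
  case False
  then have "infinite B" using bij_betw_finite[OF assms(1)] by simp
  with False show ?thesis by simp
qed

lemma bij_betw_card_Collect:
  assumes "bij_betw f A B" "\<And>a. a \<in> A \<Longrightarrow> P a \<longleftrightarrow> Q (f a)"
  shows "card {a \<in> A. P a} = card {b \<in> B. Q b}"
proof (rule bij_betw_same_card)
  show "bij_betw f {a \<in> A. P a} {b \<in> B. Q b}"
    using assms by (auto simp: bij_betw_def inj_on_def)
qed

lemma Collect_image_cong:
  assumes "\<And>a. a \<in> A \<Longrightarrow> P (f a) \<longleftrightarrow> Q a"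
  shows "{b \<in> f ` A. P b} = f ` {a \<in> A. Q a}"
  using assms by auto

text \<open>The external structure of the part of a graph attached to \<open>W\<close>.\<close>

definition block_type :: "'h hgraph \<Rightarrow> nat set \<Rightarrow> 'h multiset" where
  "block_type G W = image_mset (htype G) (mset_set (ext_at G W))"

text \<open>The coordinates of the vectors \<open>V\<^sub>G\<close> and \<open>S\<^sub>G\<close>, defined for all multisets.\<close>

definition vcount :: "'h hgraph \<Rightarrow> 'h multiset \<Rightarrow> nat" where
  "vcount G t = card {v \<in> verts G. vertex_type G v = t}"

definition scount :: "'h hgraph \<Rightarrow> 'h multiset \<Rightarrow> nat" where
  "scount G t = card {W \<in> blocks G. block_type G W = t}"

lemma vertex_count_eq: "vertex_count T G = (\<lambda>t\<in>vtypes T. vcount G t)"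
  by (simp add: vertex_count_def vcount_def)

lemma structure_count_eq:
  assumes "wf_hgraph G"
  shows "structure_count T G = (\<lambda>t\<in>vtypes T \<union> etypes T. scount G t)"
proof -
  have "inj_on (graph_on G) (blocks G)"
    by (rule inj_onI) (metis graph_on_simps(2))
  then have "bij_betw (graph_on G) (blocks G) (components G)"
    by (simp add: bij_betw_def components_eq[OF assms])
  then have "card {W \<in> blocks G. block_type G W = t} = card {K \<in> components G. ext_type K = t}"
    for t
    by (rule bij_betw_card_Collect) (simp add: ext_type_graph_on block_type_def)
  then show ?thesis by (simp add: structure_count_def scount_def)
qed

lemma vertex_type_graph_on:
  assumes "v \<in> Z"
  shows "vertex_type (graph_on G Z) v = vertex_type G v"
proof -
  have "{e \<in> halves (graph_on G Z). src (graph_on G Z) e = v} = {e \<in> halves G. src G e = v}"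
    using assms by auto
  moreover have "bij_betw id {e \<in> halves G. src G e = v} {e \<in> halves G. src G e = v}" by simp
  ultimately show ?thesis
    unfolding vertex_type_def by (auto intro!: image_mset_bij simp: assms)
qed

lemma vcount_graph_on: "vcount (graph_on G W) t = card {v \<in> W. vertex_type G v = t}"
  unfolding vcount_def by (rule arg_cong[of _ _ card]) (auto simp: vertex_type_graph_on)

subsection \<open>Unions of components\<close>

lemma graph_on_graph_on: "B \<subseteq> Z \<Longrightarrow> graph_on (graph_on G Z) B = graph_on G B"
  by (intro hgraph.equality) (auto simp: restrict_def fun_eq_iff)

context
  fixes G :: "'h hgraph" and Z :: "nat set"
  assumes wf: "wf_hgraph G" and Z: "Z \<in> closed_sets G"
begin

lemma closed_sets_graph_on: "closed_sets (graph_on G Z) = {B \<in> closed_sets G. B \<subseteq> Z}"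
  using closed_sets_subset[OF Z]
  by (auto simp: closed_sets_def cut_graph_on[OF wf Z] Int_absorb2)

lemma blocks_graph_on: "blocks (graph_on G Z) = {B \<in> blocks G. B \<subseteq> Z}"
  unfolding blocks_def closed_sets_graph_on by blast

lemma block_type_graph_on: "B \<subseteq> Z \<Longrightarrow> block_type (graph_on G Z) B = block_type G B"
  by (metis ext_type_graph_on block_type_def graph_on_graph_on)

lemma verts_Diff_closed: "verts G - Z \<in> closed_sets G"
  by (rule closed_sets_Diff[OF wf verts_closed[OF wf] Z])

lemma vcount_split: "vcount G t = vcount (graph_on G Z) t + vcount (graph_on G (verts G - Z)) t"
  unfolding vcount_graph_on unfolding vcount_def
  using closed_sets_subset[OF Z] wf_finite(2)[OF wf]
  by (subst card_Un_disjoint[symmetric]) (auto intro: finite_subset intro!: arg_cong[of _ _ card])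

lemma block_split: "B \<in> blocks G \<Longrightarrow> B \<subseteq> Z \<or> B \<subseteq> verts G - Z"
  using block_subset[of B G Z] Z closed_sets_subset[OF blocks_closed, of B G] by blast

end

lemma scount_split:
  assumes wf: "wf_hgraph G" and Z: "Z \<in> closed_sets G"
  shows "scount G t = scount (graph_on G Z) t + scount (graph_on G (verts G - Z)) t"
proof -
  let ?Z' = "verts G - Z"
  have Z': "?Z' \<in> closed_sets G" by (rule verts_Diff_closed[OF wf Z])
  have *: "{B \<in> blocks (graph_on G Y). block_type (graph_on G Y) B = t}
      = {B \<in> blocks G. B \<subseteq> Y \<and> block_type G B = t}" if "Y \<in> closed_sets G" for Y
    using that by (auto simp: blocks_graph_on[OF wf that] block_type_graph_on[OF wf that])
  have "{B \<in> blocks G. block_type G B = t} = {B \<in> blocks G. B \<subseteq> Z \<and> block_type G B = t}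
      \<union> {B \<in> blocks G. B \<subseteq> ?Z' \<and> block_type G B = t}"
    using block_split[OF wf Z] by blast
  moreover have "{B \<in> blocks G. B \<subseteq> Z \<and> block_type G B = t}
      \<inter> {B \<in> blocks G. B \<subseteq> ?Z' \<and> block_type G B = t} = {}"
    by (auto dest: blocks_nonempty)
  ultimately show ?thesis
    using finite_blocks[OF wf] by (simp add: scount_def * Z Z' card_Un_disjoint)
qed

lemma feynman_split:
  assumes wf: "wf_hgraph G" and Z: "Z \<in> closed_sets G"
  shows "feynman T G \<longleftrightarrow> feynman T (graph_on G Z) \<and> feynman T (graph_on G (verts G - Z))"
proof -
  have Z': "verts G - Z \<in> closed_sets G" by (rule verts_Diff_closed[OF wf Z])
  have *: "feynman T (graph_on G Y) \<longleftrightarrow> (\<forall>B\<in>blocks G. B \<subseteq> Y \<longrightarrow> one_PI T (graph_on G B))"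
    if "Y \<in> closed_sets G" for Y
    using that by (auto simp: feynman_iff blocks_graph_on[OF wf that] graph_on_graph_on
        wf_graph_on[OF wf that])
  show ?thesis
    unfolding *[OF Z] *[OF Z'] feynman_iff[of T G] using wf block_split[OF wf Z] by blast
qed

subsection \<open>Order isomorphisms of closed sets\<close>

lemma blocks_iff:
  "W \<in> blocks G \<longleftrightarrow> W \<in> closed_sets G \<and> W \<noteq> {} \<and>
     (\<forall>U\<in>closed_sets G. U \<noteq> {} \<longrightarrow> U \<subseteq> W \<longrightarrow> W \<subseteq> U)"
proof -
  have "(U \<subseteq> W \<longrightarrow> U = W) \<longleftrightarrow> (U \<subseteq> W \<longrightarrow> W \<subseteq> U)" for U by blast
  then show ?thesis by (simp only: blocks_def mem_Collect_eq)
qed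

text \<open>Being minimal and nonempty is an order-theoretic property, so components can be matched without
  following paths: an order isomorphism between the closed sets suffices.\<close>

lemma blocks_order_iso:
  assumes bij: "bij_betw \<Theta> (closed_sets G) (closed_sets H)"
    and ord: "\<And>W W'. W \<in> closed_sets G \<Longrightarrow> W' \<in> closed_sets G \<Longrightarrow> \<Theta> W \<subseteq> \<Theta> W' \<longleftrightarrow> W \<subseteq> W'"
  shows "bij_betw \<Theta> (blocks G) (blocks H)"
proof -
  have im: "closed_sets H = \<Theta> ` closed_sets G" using bij by (simp add: bij_betw_def)
  obtain W where W: "W \<in> closed_sets G" "\<Theta> W = {}"
    using im empty_closed[of H] by (metis imageE)
  then have E: "\<Theta> {} = {}" using ord[of "{}" W] by simp
  have ne: "\<Theta> U = {} \<longleftrightarrow> U = {}" if "U \<in> closed_sets G" for U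
    using ord[OF that, of "{}"] E by auto
  have key: "\<Theta> U \<in> blocks H \<longleftrightarrow> U \<in> blocks G" if "U \<in> closed_sets G" for U
  proof -
    have "(\<forall>V\<in>closed_sets G. \<Theta> V \<noteq> {} \<longrightarrow> \<Theta> V \<subseteq> \<Theta> U \<longrightarrow> \<Theta> U \<subseteq> \<Theta> V)
        \<longleftrightarrow> (\<forall>V\<in>closed_sets G. V \<noteq> {} \<longrightarrow> V \<subseteq> U \<longrightarrow> U \<subseteq> V)"
      by (rule ball_cong[OF refl]) (simp only: ne ord that)
    then show ?thesis unfolding blocks_iff im ball_simps using that ne by simp
  qed
  have "\<Theta> ` blocks G = blocks H"
  proof (intro equalityI subsetI)
    fix B assume B: "B \<in> blocks H"
    then obtain U where "U \<in> closed_sets G" "B = \<Theta> U" using im blocks_closed[OF B] by blast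
    then show "B \<in> \<Theta> ` blocks G" using key B by blast
  qed (use key blocks_closed in blast)
  moreover have "inj_on \<Theta> (blocks G)"
    by (rule inj_on_subset[OF bij_betw_imp_inj_on[OF bij]]) (auto dest: blocks_closed)
  ultimately show ?thesis by (simp add: bij_betw_def)
qed

lemma scount_order_iso:
  assumes "bij_betw \<Theta> (closed_sets G) (closed_sets H)"
    and "\<And>W W'. W \<in> closed_sets G \<Longrightarrow> W' \<in> closed_sets G \<Longrightarrow> \<Theta> W \<subseteq> \<Theta> W' \<longleftrightarrow> W \<subseteq> W'"
    and "\<And>W. W \<in> closed_sets G \<Longrightarrow> block_type H (\<Theta> W) = block_type G W"
  shows "scount G t = scount H t"
  unfolding scount_def
  by (rule bij_betw_card_Collect[OF blocks_order_iso[OF assms(1,2)]])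
     (simp_all add: assms(3) blocks_closed)


section \<open>Invariance under isomorphism\<close>

locale graph_isomorphism =
  fixes G H :: "'h hgraph" and \<phi> \<psi> :: "nat \<Rightarrow> nat"
  assumes wf_dom: "wf_hgraph G" and wf_cod: "wf_hgraph H"
    and bij_halves: "bij_betw \<phi> (halves G) (halves H)"
    and bij_verts: "bij_betw \<psi> (verts G) (verts H)"
    and commutes: "\<And>e. e \<in> halves G \<Longrightarrow> pairing H (\<phi> e) = \<phi> (pairing G e)"
      "\<And>e. e \<in> halves G \<Longrightarrow> src H (\<phi> e) = \<psi> (src G e)"
      "\<And>e. e \<in> halves G \<Longrightarrow> htype H (\<phi> e) = htype G e"
begin

lemma halves_cod: "halves H = \<phi> ` halves G"
  using bij_halves by (simp add: bij_betw_def)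

lemma verts_cod: "verts H = \<psi> ` verts G"
  using bij_verts by (simp add: bij_betw_def)

lemma \<phi>_eq_iff: "e \<in> halves G \<Longrightarrow> e' \<in> halves G \<Longrightarrow> \<phi> e = \<phi> e' \<longleftrightarrow> e = e'"
  using bij_halves by (auto simp: bij_betw_def inj_on_def)

lemma \<psi>_mem_image: "v \<in> verts G \<Longrightarrow> W \<subseteq> verts G \<Longrightarrow> \<psi> v \<in> \<psi> ` W \<longleftrightarrow> v \<in> W"
  using bij_verts by (auto simp: bij_betw_def inj_on_def)

lemmas mem = wf_hgraph_mem[OF wf_dom]

lemma cut_image: "W \<subseteq> verts G \<Longrightarrow> cut H (\<psi> ` W) = \<phi> ` cut G W"
  unfolding cut_def halves_cod
  by (rule Collect_image_cong) (simp add: commutes mem \<psi>_mem_image)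

lemma ext_at_image: "W \<subseteq> verts G \<Longrightarrow> ext_at H (\<psi> ` W) = \<phi> ` ext_at G W"
  unfolding ext_at_def halves_cod
  by (rule Collect_image_cong) (simp add: commutes mem \<psi>_mem_image \<phi>_eq_iff)

lemma halves_at_image:
  "W \<subseteq> verts G \<Longrightarrow> {e \<in> halves H. src H e \<in> \<psi> ` W} = \<phi> ` {e \<in> halves G. src G e \<in> W}"
  unfolding halves_cod
  by (rule Collect_image_cong) (simp add: commutes mem \<psi>_mem_image)

lemma bij_betw_sub: "A \<subseteq> halves G \<Longrightarrow> bij_betw \<phi> A (\<phi> ` A)"
  using bij_halves by (auto simp: bij_betw_def intro: inj_on_subset)

lemma block_type_image:
  assumes "W \<subseteq> verts G"
  shows "block_type H (\<psi> ` W) = block_type G W"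
  unfolding block_type_def ext_at_image[OF assms]
  by (rule image_mset_bij[OF bij_betw_sub]) (auto simp: ext_at_def commutes)

lemma vertex_type_image:
  assumes "v \<in> verts G"
  shows "vertex_type H (\<psi> v) = vertex_type G v"
proof -
  have "{e \<in> halves H. src H e = \<psi> v} = \<phi> ` {e \<in> halves G. src G e = v}"
    using halves_at_image[of "{v}"] assms by simp
  then show ?thesis
    unfolding vertex_type_def
    by (auto intro!: image_mset_bij[OF bij_betw_sub] simp: commutes)
qed

lemma closed_image_iff: "W \<subseteq> verts G \<Longrightarrow> \<psi> ` W \<in> closed_sets H \<longleftrightarrow> W \<in> closed_sets G"
  by (auto simp: closed_sets_def cut_image verts_cod)

lemma subset_cod: "W \<subseteq> verts H \<Longrightarrow> \<exists>U. U \<subseteq> verts G \<and> W = \<psi> ` U"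
  unfolding verts_cod by (auto elim!: subset_imageE)

lemma \<psi>_image_subset: "W \<subseteq> verts G \<Longrightarrow> W' \<subseteq> verts G \<Longrightarrow> \<psi> ` W \<subseteq> \<psi> ` W' \<longleftrightarrow> W \<subseteq> W'"
  using \<psi>_mem_image[of _ W'] by blast

lemma bij_closed_sets: "bij_betw ((`) \<psi>) (closed_sets G) (closed_sets H)"
proof (rule bij_betw_imageI)
  show "inj_on ((`) \<psi>) (closed_sets G)"
    by (rule inj_onI) (metis closed_sets_subset \<psi>_image_subset subset_antisym order_refl)
  show "(`) \<psi> ` closed_sets G = closed_sets H"
  proof (intro equalityI subsetI)
    fix W assume "W \<in> closed_sets H"
    moreover from this obtain U where "U \<subseteq> verts G" "W = \<psi> ` U"
      using subset_cod closed_sets_subset by metis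
    ultimately show "W \<in> (`) \<psi> ` closed_sets G" using closed_image_iff by blast
  qed (use closed_image_iff closed_sets_subset in blast)
qed

lemma bij_blocks: "bij_betw ((`) \<psi>) (blocks G) (blocks H)"
  by (rule blocks_order_iso[OF bij_closed_sets]) (simp add: closed_sets_subset \<psi>_image_subset)

lemma scount_iso: "scount G t = scount H t"
  by (rule scount_order_iso[OF bij_closed_sets])
     (simp_all add: closed_sets_subset \<psi>_image_subset block_type_image)

lemma vcount_iso: "vcount G t = vcount H t"
  unfolding vcount_def by (rule bij_betw_card_Collect[OF bij_verts]) (simp add: vertex_type_image)

lemma one_PI_iso:
  assumes "one_PI T G"
  shows "one_PI T H"
proof -
  have "ext_type H = ext_type G"
    using block_type_image[OF order_refl]
    by (metis block_type_def ext_type_graph_on graph_on_verts verts_cod wf_cod wf_dom)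
  moreover have "two_connected H"
    unfolding two_connected_def
  proof (intro allI impI)
    fix W assume W: "W \<subseteq> verts H" "W \<noteq> {}" "W \<noteq> verts H"
    obtain U where U: "U \<subseteq> verts G" "W = \<psi> ` U" using subset_cod[OF W(1)] by blast
    have tc: "two_connected G" using assms by (simp add: one_PI_iff)
    have "U \<noteq> {}" "U \<noteq> verts G" using W U verts_cod by auto
    then obtain e e' where "e \<in> cut G U" "e' \<in> cut G U" "e \<noteq> e'"
      using U(1) tc[unfolded two_connected_def] by blast
    moreover from this have "\<phi> e \<noteq> \<phi> e'" by (simp add: \<phi>_eq_iff cut_def)
    ultimately show "\<exists>e\<in>cut H W. \<exists>e'\<in>cut H W. e \<noteq> e'"
      unfolding U(2) cut_image[OF U(1)] by blast
  qed
  moreover have "\<exists>e\<in>halves H. pairing H e \<noteq> e"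
    using assms by (auto simp: one_PI_iff halves_cod commutes mem \<phi>_eq_iff)
  moreover have "verts H \<noteq> {}" "htype H ` halves H \<subseteq> htypes T"
    "\<forall>v\<in>verts H. vertex_type H v \<in> vtypes T"
    using assms by (auto simp: one_PI_iff halves_cod verts_cod commutes vertex_type_image)
  moreover have "\<forall>e\<in>halves H. pairing H e \<noteq> e \<longrightarrow> incid T (htype H e) = htype H (pairing H e)"
    using assms by (auto simp: one_PI_iff halves_cod commutes mem \<phi>_eq_iff)
  ultimately show ?thesis using assms wf_cod unfolding one_PI_iff by simp
qed

lemma restrict_iso:
  assumes "W \<in> closed_sets G"
  shows "graph_isomorphism (graph_on G W) (graph_on H (\<psi> ` W)) \<phi> \<psi>"
proof
  have sub: "W \<subseteq> verts G" by (rule closed_sets_subset[OF assms])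
  have cl: "\<psi> ` W \<in> closed_sets H" using assms closed_image_iff[OF sub] by simp
  show "wf_hgraph (graph_on G W)" "wf_hgraph (graph_on H (\<psi> ` W))"
    using wf_graph_on[OF wf_dom assms] wf_graph_on[OF wf_cod cl] .
  show "bij_betw \<phi> (halves (graph_on G W)) (halves (graph_on H (\<psi> ` W)))"
    using bij_betw_sub[of "{e \<in> halves G. src G e \<in> W}"] halves_at_image[OF sub] by simp
  show "bij_betw \<psi> (verts (graph_on G W)) (verts (graph_on H (\<psi> ` W)))"
    using bij_verts sub by (auto simp: bij_betw_def intro: inj_on_subset)
  fix e assume "e \<in> halves (graph_on G W)"
  then have e: "e \<in> halves G" "src G e \<in> W" by auto
  then have "\<phi> e \<in> halves H" "src H (\<phi> e) \<in> \<psi> ` W" by (auto simp: halves_cod commutes)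
  with e show "pairing (graph_on H (\<psi> ` W)) (\<phi> e) = \<phi> (pairing (graph_on G W) e)"
    "src (graph_on H (\<psi> ` W)) (\<phi> e) = \<psi> (src (graph_on G W) e)"
    "htype (graph_on H (\<psi> ` W)) (\<phi> e) = htype (graph_on G W) e"
    by (simp_all add: commutes)
qed

lemma feynman_iso:
  assumes "feynman T G"
  shows "feynman T H"
  unfolding feynman_iff
proof (intro conjI ballI)
  fix B assume "B \<in> blocks H"
  then obtain W where W: "W \<in> blocks G" "B = \<psi> ` W"
    using bij_blocks unfolding bij_betw_def by blast
  then show "one_PI T (graph_on H B)"
    using graph_isomorphism.one_PI_iso[OF restrict_iso[OF blocks_closed[OF W(1)]]] assms
    by (simp add: feynman_iff)
qed (rule wf_cod)

lemma counts_iso: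
  "vertex_count T G = vertex_count T H" "structure_count T G = structure_count T H"
  by (simp_all add: vertex_count_eq structure_count_eq wf_dom wf_cod vcount_iso scount_iso)

end

lemma same_graphE:
  assumes "same_graph G H"
  obtains \<phi> \<psi> where "graph_isomorphism G H \<phi> \<psi>"
  using assms unfolding same_graph_def graph_iso_def graph_isomorphism_def by blast


section \<open>Disjoint unions\<close>

lemma tag_union_eq:
  "tag_union A B = (\<lambda>a. sum_encode (Inl a)) ` A \<union> (\<lambda>b. sum_encode (Inr b)) ` B"
  by (auto simp: tag_union_def Plus_def image_Un image_image)

context
  fixes G H :: "'h hgraph"
  assumes wf: "wf_hgraph G" "wf_hgraph H"
begin

lemma left_closed: "(\<lambda>a. sum_encode (Inl a)) ` verts G \<in> closed_sets (disj_union G H)"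
  using wf by (auto simp: closed_sets_def cut_def wf_hgraph_mem sum_encode_eq elim!: tag_unionE)

lemma verts_Diff_left:
  "verts (disj_union G H) - (\<lambda>a. sum_encode (Inl a)) ` verts G = (\<lambda>b. sum_encode (Inr b)) ` verts H"
  by (auto simp: tag_union_eq sum_encode_eq)

lemma right_closed: "(\<lambda>b. sum_encode (Inr b)) ` verts H \<in> closed_sets (disj_union G H)"
  using closed_sets_Diff[OF wf_disj_union verts_closed[OF wf_disj_union] left_closed] wf
  by (simp add: verts_Diff_left[symmetric])

lemma left_iso:
  "graph_isomorphism G (graph_on (disj_union G H) ((\<lambda>a. sum_encode (Inl a)) ` verts G))
    (\<lambda>a. sum_encode (Inl a)) (\<lambda>a. sum_encode (Inl a))"
proof
  show "wf_hgraph (graph_on (disj_union G H) ((\<lambda>a. sum_encode (Inl a)) ` verts G))"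
    by (rule wf_graph_on[OF wf_disj_union[OF wf] left_closed])
  have "{e \<in> halves (disj_union G H). src (disj_union G H) e \<in> (\<lambda>a. sum_encode (Inl a)) ` verts G}
      = (\<lambda>a. sum_encode (Inl a)) ` halves G"
    using wf by (auto elim!: tag_unionE simp: sum_encode_eq wf_hgraph_mem)
  then show "bij_betw (\<lambda>a. sum_encode (Inl a)) (halves G)
      (halves (graph_on (disj_union G H) ((\<lambda>a. sum_encode (Inl a)) ` verts G)))"
    by (simp add: bij_betw_def inj_on_def sum_encode_eq)
qed (use wf in \<open>simp_all add: bij_betw_def inj_on_def sum_encode_eq wf_hgraph_mem\<close>)

lemma right_iso:
  "graph_isomorphism H (graph_on (disj_union G H) ((\<lambda>b. sum_encode (Inr b)) ` verts H))
    (\<lambda>b. sum_encode (Inr b)) (\<lambda>b. sum_encode (Inr b))"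
proof
  show "wf_hgraph (graph_on (disj_union G H) ((\<lambda>b. sum_encode (Inr b)) ` verts H))"
    by (rule wf_graph_on[OF wf_disj_union[OF wf] right_closed])
  have "{e \<in> halves (disj_union G H). src (disj_union G H) e \<in> (\<lambda>b. sum_encode (Inr b)) ` verts H}
      = (\<lambda>b. sum_encode (Inr b)) ` halves H"
    using wf by (auto elim!: tag_unionE simp: sum_encode_eq wf_hgraph_mem)
  then show "bij_betw (\<lambda>b. sum_encode (Inr b)) (halves H)
      (halves (graph_on (disj_union G H) ((\<lambda>b. sum_encode (Inr b)) ` verts H)))"
    by (simp add: bij_betw_def inj_on_def sum_encode_eq)
qed (use wf in \<open>simp_all add: bij_betw_def inj_on_def sum_encode_eq wf_hgraph_mem\<close>)

lemma vcount_disj_union: "vcount (disj_union G H) t = vcount G t + vcount H t"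
  using vcount_split[OF wf_disj_union[OF wf] left_closed, of t]
    graph_isomorphism.vcount_iso[OF left_iso, of t] graph_isomorphism.vcount_iso[OF right_iso, of t]
  unfolding verts_Diff_left by simp

lemma scount_disj_union: "scount (disj_union G H) t = scount G t + scount H t"
  using scount_split[OF wf_disj_union[OF wf] left_closed, of t]
    graph_isomorphism.scount_iso[OF left_iso, of t] graph_isomorphism.scount_iso[OF right_iso, of t]
  unfolding verts_Diff_left by simp

lemma feynman_disj_union:
  assumes "feynman T G" "feynman T H"
  shows "feynman T (disj_union G H)"
  using feynman_split[OF wf_disj_union[OF wf] left_closed, of T]
    graph_isomorphism.feynman_iso[OF left_iso assms(1)]
    graph_isomorphism.feynman_iso[OF right_iso assms(2)]
  unfolding verts_Diff_left by simp

end


section \<open>Contraction of a connected subgraph\<close>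

text \<open>The condition on a connected subgraph, in a form that can also be asked of the intermediate
  graphs that arise when several components are contracted one after the other.\<close>

definition lies_in :: "'h hgraph \<Rightarrow> 'h hgraph \<Rightarrow> bool" where
  "lies_in C H \<longleftrightarrow> halves C \<subseteq> halves H \<and> verts C \<subseteq> verts H \<and>
     (\<forall>e\<in>halves C. src H e = src C e \<and> htype H e = htype C e \<and>
        (pairing C e = e \<or> pairing C e = pairing H e))"

text \<open>No half-edge of \<open>H\<close> outside \<open>C\<close> is attached to a vertex of \<open>C\<close>.\<close>

definition saturated :: "'h hgraph \<Rightarrow> 'h hgraph \<Rightarrow> bool" where
  "saturated C H \<longleftrightarrow> (\<forall>e\<in>halves H. src H e \<in> verts C \<longrightarrow> e \<in> halves C)"

text \<open>The property of Feynman graphs that survives the successive contractions: there is no bridge,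
  and every component has an external half-edge. Let \<open>C\<close> be a saturated
  subgraph with two external half-edges. If one of them were external in \<open>H\<close> and the other half of
  a bridge, then contracting \<open>C\<close> would leave a half-edge without a partner; if both were the halves
  of one edge of \<open>H\<close>, then it would delete a component that \<open>C\<close> is not equal to.\<close>

definition robust :: "'h hgraph \<Rightarrow> bool" where
  "robust H \<longleftrightarrow> wf_hgraph H \<and>
     (\<forall>W. W \<subseteq> verts H \<longrightarrow> (\<forall>e\<in>cut H W. \<exists>e'\<in>cut H W. e' \<noteq> e)) \<and>
     (\<forall>W\<in>closed_sets H. W \<noteq> {} \<longrightarrow> ext_at H W \<noteq> {})"

lemma robust_wf: "robust H \<Longrightarrow> wf_hgraph H"
  by (simp add: robust_def)

lemma ext_type_eq_block_type: "wf_hgraph G \<Longrightarrow> ext_type G = block_type G (verts G)"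
  by (metis block_type_def ext_type_graph_on graph_on_verts)

lemma feynman_robust:
  assumes T: "feynman_theory T" and G: "feynman T G"
  shows "robust G"
proof -
  have wf: "wf_hgraph G" and pi: "\<And>B. B \<in> blocks G \<Longrightarrow> one_PI T (graph_on G B)"
    using G by (auto simp: feynman_iff)
  have "\<exists>e'\<in>cut G W. e' \<noteq> e" if W: "W \<subseteq> verts G" and e: "e \<in> cut G W" for W e
  proof -
    have eG: "e \<in> halves G" "src G e \<in> W" "src G (pairing G e) \<notin> W" using e by (auto simp: cut_def)
    then obtain B where B: "B \<in> blocks G" "src G e \<in> B" using block_ex[OF wf, of "src G e"] W by blast
    have cl: "B \<in> closed_sets G" by (rule blocks_closed[OF B(1)])
    have "src G (pairing G e) \<in> B" by (rule closed_setsD[OF cl eG(1) B(2)])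
    then have "W \<inter> B \<noteq> {}" "W \<inter> B \<noteq> B" using eG B(2) by auto
    moreover have "two_connected (graph_on G B)" using pi[OF B(1)] by (simp add: one_PI_iff)
    ultimately obtain c c' where c: "c \<in> cut (graph_on G B) (W \<inter> B)"
      "c' \<in> cut (graph_on G B) (W \<inter> B)" "c \<noteq> c'"
      unfolding two_connected_def graph_on_simps by (meson inf_le2)
    have "cut (graph_on G B) (W \<inter> B) \<subseteq> cut G W"
      unfolding cut_graph_on[OF wf cl] using closed_setsD[OF cl] by (auto simp: cut_def)
    then show ?thesis using c by (metis subsetD)
  qed
  moreover have "ext_at G W \<noteq> {}" if W: "W \<in> closed_sets G" "W \<noteq> {}" for W
  proof -
    obtain u where u: "u \<in> W" using W by blast
    then obtain B where B: "B \<in> blocks G" "u \<in> B"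
      using block_ex[OF wf] closed_sets_subset[OF W(1)] by blast
    have "B \<subseteq> W" by (rule block_subset[OF B(1) W(1) B(2) u])
    moreover have "block_type G B \<in> vtypes T \<union> etypes T"
      using pi[OF B(1)] by (simp add: one_PI_iff ext_type_graph_on block_type_def)
    then have "block_type G B \<noteq> {#}" using T by (auto simp: feynman_theory_def etypes_def)
    then have "ext_at G B \<noteq> {}" unfolding block_type_def by auto
    ultimately show ?thesis by (auto simp: ext_at_def)
  qed
  ultimately show ?thesis using wf unfolding robust_def by blast
qed

text \<open>A coordinate of \<open>V\<^sub>G - S\<^sub>G\<close>. For a vertex type this is the quantity that is additive under both
  disjoint union and contraction.\<close>

definition balance :: "'h hgraph \<Rightarrow> 'h multiset \<Rightarrow> int" where
  "balance G t = int (vcount G t) - int (scount G t)"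

lemma scount_one_PI: "one_PI T C \<Longrightarrow> scount C t = (if ext_type C = t then 1 else 0)"
  using blocks_one_PI(2)[of T C] ext_type_eq_block_type[of C]
  by (auto simp: scount_def one_PI_iff Collect_conv_if)

subsection \<open>Comparison of cuts\<close>

text \<open>A contraction \<open>H'\<close> of \<open>H\<close> is compared with \<open>H\<close> by a map \<open>\<Phi>\<close> that lifts sets of vertices of \<open>H'\<close>
  to \<open>H\<close> without changing their cuts and, on closed sets, their external half-edges. Everything
  that is needed about connectivity then passes from \<open>H\<close> to \<open>H'\<close>.\<close>

locale cut_comparison =
  fixes H H' :: "'h hgraph" and \<Phi> :: "nat set \<Rightarrow> nat set"
  assumes wf: "wf_hgraph H" "wf_hgraph H'"
    and \<Phi>_subset: "\<And>W. W \<subseteq> verts H' \<Longrightarrow> \<Phi> W \<subseteq> verts H"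
    and \<Phi>_nonempty: "\<And>W. W \<subseteq> verts H' \<Longrightarrow> W \<noteq> {} \<Longrightarrow> \<Phi> W \<noteq> {}"
    and \<Phi>_proper: "\<And>W. W \<subseteq> verts H' \<Longrightarrow> W \<noteq> verts H' \<Longrightarrow> \<Phi> W \<noteq> verts H"
    and cut_\<Phi>: "\<And>W. W \<subseteq> verts H' \<Longrightarrow> cut H' W = cut H (\<Phi> W)"
    and ext_\<Phi>: "\<And>W. W \<in> closed_sets H' \<Longrightarrow> ext_at H' W = ext_at H (\<Phi> W)"
    and htype_eq: "\<And>e. e \<in> halves H' \<Longrightarrow> htype H' e = htype H e"
    and \<Phi>_order: "\<And>W W'. W \<in> closed_sets H' \<Longrightarrow> W' \<in> closed_sets H' \<Longrightarrow> \<Phi> W \<subseteq> \<Phi> W' \<longleftrightarrow> W \<subseteq> W'"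
    and \<Phi>_onto: "\<And>W. W \<in> closed_sets H \<Longrightarrow> \<exists>W'. W' \<subseteq> verts H' \<and> W = \<Phi> W'"
begin

lemma closed_iff: "W \<subseteq> verts H' \<Longrightarrow> W \<in> closed_sets H' \<longleftrightarrow> \<Phi> W \<in> closed_sets H"
  by (simp add: closed_sets_def cut_\<Phi> \<Phi>_subset)

lemma bij_closed: "bij_betw \<Phi> (closed_sets H') (closed_sets H)"
proof (rule bij_betw_imageI)
  show "inj_on \<Phi> (closed_sets H')"
  proof (rule inj_onI)
    fix W W' assume W: "W \<in> closed_sets H'" "W' \<in> closed_sets H'" "\<Phi> W = \<Phi> W'"
    then show "W = W'" using \<Phi>_order[of W W'] \<Phi>_order[of W' W] by simp
  qed
  show "\<Phi> ` closed_sets H' = closed_sets H"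
  proof (intro equalityI subsetI)
    fix W assume W: "W \<in> closed_sets H"
    then obtain W' where "W' \<subseteq> verts H'" "W = \<Phi> W'" using \<Phi>_onto by blast
    then show "W \<in> \<Phi> ` closed_sets H'" using closed_iff W by blast
  next
    fix W assume "W \<in> \<Phi> ` closed_sets H'"
    then show "W \<in> closed_sets H" using closed_iff closed_sets_subset by blast
  qed
qed

lemma block_type_\<Phi>: "W \<in> closed_sets H' \<Longrightarrow> block_type H (\<Phi> W) = block_type H' W"
proof -
  assume W: "W \<in> closed_sets H'"
  have "finite (ext_at H' W)" using wf_finite(1)[OF wf(2)] by (simp add: ext_at_def)
  then show ?thesis
    unfolding block_type_def ext_\<Phi>[OF W, symmetric]
    by (intro image_mset_cong) (auto simp: ext_at_def htype_eq)
qed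

lemma scount_\<Phi>: "scount H' t = scount H t"
  by (rule scount_order_iso[OF bij_closed]) (simp_all add: \<Phi>_order block_type_\<Phi>)

lemma \<Phi>_verts: "\<Phi> (verts H') = verts H"
proof (rule ccontr)
  obtain W where W: "W \<in> closed_sets H'" "\<Phi> W = verts H"
    using bij_closed verts_closed[OF wf(1)] unfolding bij_betw_def by (metis imageE)
  then have "W \<subseteq> verts H'" using closed_sets_subset by blast
  assume "\<Phi> (verts H') \<noteq> verts H"
  then have "W \<noteq> verts H'" using W by auto
  then show False using \<Phi>_proper[OF \<open>W \<subseteq> verts H'\<close>] W by simp
qed

lemma ext_type_\<Phi>: "ext_type H' = ext_type H"
  using block_type_\<Phi>[OF verts_closed[OF wf(2)]]
  by (simp add: ext_type_eq_block_type wf \<Phi>_verts)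

lemma two_connected_\<Phi>: "two_connected H \<Longrightarrow> two_connected H'"
  unfolding two_connected_def
  by (metis \<Phi>_subset \<Phi>_nonempty \<Phi>_proper cut_\<Phi>)

lemma robust_\<Phi>: "robust H \<Longrightarrow> robust H'"
  unfolding robust_def
proof (elim conjE, intro conjI allI impI ballI)
  show "wf_hgraph H'" by (rule wf(2))
next
  fix W e assume *: "\<forall>W. W \<subseteq> verts H \<longrightarrow> (\<forall>e\<in>cut H W. \<exists>e'\<in>cut H W. e' \<noteq> e)"
    and W: "W \<subseteq> verts H'" "e \<in> cut H' W"
  show "\<exists>e'\<in>cut H' W. e' \<noteq> e"
    using * \<Phi>_subset[OF W(1)] W(2) unfolding cut_\<Phi>[OF W(1)] by blast
next
  fix W assume *: "\<forall>W\<in>closed_sets H. W \<noteq> {} \<longrightarrow> ext_at H W \<noteq> {}"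
    and W: "W \<in> closed_sets H'" "W \<noteq> {}"
  have s: "W \<subseteq> verts H'" by (rule closed_sets_subset[OF W(1)])
  show "ext_at H' W \<noteq> {}"
    unfolding ext_\<Phi>[OF W(1)] using * closed_iff[OF s] W \<Phi>_nonempty[OF s] by blast
qed

end

subsection \<open>Saturated connected subgraphs\<close>

lemma new_vertex_fresh:
  assumes "finite (halves G)" "finite (verts G)"
  shows "new_vertex G \<notin> verts G" "new_vertex G \<notin> src G ` halves G"
proof -
  have "\<exists>n. n \<notin> verts G \<union> src G ` halves G"
    using assms by (intro ex_new_if_finite infinite_UNIV_nat) auto
  then have "new_vertex G \<notin> verts G \<union> src G ` halves G"
    unfolding new_vertex_def by (rule LeastI_ex)
  then show "new_vertex G \<notin> verts G" "new_vertex G \<notin> src G ` halves G" by auto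
qed

text \<open>Here \<open>H\<close> need not be a Feynman graph: in a sequence of contractions only the last graph is
  known to be one.\<close>

locale saturated_subgraph =
  fixes T :: "'h ftheory" and H C :: "'h hgraph"
  assumes wfH: "wf_hgraph H" and C_one_PI: "one_PI T C"
    and C_in: "lies_in C H" and C_sat: "saturated C H"
begin

lemma wfC: "wf_hgraph C" using C_one_PI by (simp add: one_PI_iff)

lemmas memH = wf_hgraph_mem[OF wfH] and memC = wf_hgraph_mem[OF wfC]

lemma halves_sub: "e \<in> halves C \<Longrightarrow> e \<in> halves H"
  and verts_sub: "verts C \<subseteq> verts H"
  and src_eq: "e \<in> halves C \<Longrightarrow> src H e = src C e"
  and htype_eq: "e \<in> halves C \<Longrightarrow> htype H e = htype C e"
  using C_in by (auto simp: lies_in_def)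

lemma ext_sub: "e \<in> ext_halves C \<Longrightarrow> e \<in> halves C"
  by (simp add: ext_halves_def)

lemma src_iff: "e \<in> halves H \<Longrightarrow> src H e \<in> verts C \<longleftrightarrow> e \<in> halves C"
  using C_sat memC(2) src_eq by (auto simp: saturated_def)

lemma nonext:
  assumes "e \<in> halves C" "e \<notin> ext_halves C"
  shows "pairing H e = pairing C e" "pairing H e \<in> halves C" "pairing H e \<notin> ext_halves C"
proof -
  have p: "pairing C e \<noteq> e" using assms by (auto simp: ext_halves_def)
  then show eq: "pairing H e = pairing C e" using C_in assms(1) by (auto simp: lies_in_def)
  show "pairing H e \<in> halves C" "pairing H e \<notin> ext_halves C"
    unfolding eq using memC[OF assms(1)] p by (auto simp: ext_halves_def)
qed

lemma into_ext:
  assumes "e \<in> halves H" "pairing H e \<in> halves C" "e \<notin> halves C \<or> e \<in> ext_halves C"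
  shows "pairing H e \<in> ext_halves C"
proof (rule ccontr)
  assume "pairing H e \<notin> ext_halves C"
  from nonext(2,3)[OF assms(2) this] show False
    using memH(3)[OF assms(1)] assms(3) by auto
qed

text \<open>A union of components of \<open>H\<close> contains the connected subgraph \<open>C\<close> or avoids it.\<close>

lemma closed_cases:
  assumes "W \<in> closed_sets H"
  shows "verts C \<subseteq> W \<or> verts C \<inter> W = {}"
proof (rule ccontr)
  assume n: "\<not> (verts C \<subseteq> W \<or> verts C \<inter> W = {})"
  have "two_connected C" using C_one_PI by (simp add: one_PI_iff)
  moreover have "W \<inter> verts C \<subseteq> verts C" "W \<inter> verts C \<noteq> {}" "W \<inter> verts C \<noteq> verts C"
    using n by auto
  ultimately obtain e where e: "e \<in> cut C (W \<inter> verts C)"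
    unfolding two_connected_def by blast
  then have c: "e \<in> halves C" "src C e \<in> W" "src C (pairing C e) \<notin> W" "e \<notin> ext_halves C"
    using memC by (auto simp: cut_def ext_halves_def)
  have "src H (pairing H e) \<in> W"
    using closed_setsD[OF assms halves_sub[OF c(1)]] c by (simp add: src_eq)
  then show False using c nonext[OF c(1,4)] by (simp add: src_eq)
qed

lemma vertex_type_C:
  assumes "v \<in> verts C"
  shows "vertex_type H v = vertex_type C v"
proof -
  have "{e \<in> halves H. src H e = v} = {e \<in> halves C. src C e = v}"
    using assms src_iff halves_sub src_eq by auto
  moreover have "finite {e \<in> halves C. src C e = v}" using wf_finite[OF wfC] by simp
  ultimately show ?thesis
    unfolding vertex_type_def by (auto intro!: image_mset_cong simp: htype_eq)
qed

lemma vcount_outside: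
  "vcount H t = vcount C t + card {v \<in> verts H - verts C. vertex_type H v = t}"
proof -
  have "{v \<in> verts H. vertex_type H v = t} =
      {v \<in> verts C. vertex_type C v = t} \<union> {v \<in> verts H - verts C. vertex_type H v = t}"
    using verts_sub vertex_type_C by auto
  then show ?thesis
    unfolding vcount_def using wf_finite[OF wfH] wf_finite[OF wfC]
    by (auto simp: card_Un_disjoint disjoint_iff)
qed

lemma ext_fixed_component:
  assumes "\<forall>e\<in>ext_halves C. pairing H e = e"
  shows "C \<in> components H"
proof -
  have pr: "pairing H e = pairing C e" if "e \<in> halves C" for e
    using assms nonext(1)[OF that] by (cases "e \<in> ext_halves C") (auto simp: ext_halves_def)
  have cl: "verts C \<in> closed_sets H"
    using verts_sub memC src_iff by (auto simp: closed_sets_def cut_def pr src_eq)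
  have ne: "verts C \<noteq> {}" using C_one_PI by (simp add: one_PI_iff)
  have "verts C \<in> blocks H"
    unfolding blocks_iff
  proof (intro conjI ballI impI)
    fix U assume "U \<in> closed_sets H" "U \<noteq> {}" "U \<subseteq> verts C"
    then show "verts C \<subseteq> U" using closed_cases[of U] by blast
  qed (rule cl, rule ne)
  moreover have "{e \<in> halves H. src H e \<in> verts C} = halves C"
    using src_iff halves_sub by auto
  then have "C = graph_on H (verts C)"
    using wfC pr src_eq htype_eq
    by (intro hgraph.equality) (auto simp: wf_hgraph_def PiE_def extensional_def fun_eq_iff)
  ultimately show ?thesis unfolding components_eq[OF wfH] by blast
qed

lemma component_removed:
  assumes "C \<in> components H"
  shows "verts C \<in> blocks H" "C = graph_on H (verts C)"
    "restrict_graph H (halves H - halves C) (verts H - verts C) = graph_on H (verts H - verts C)"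
proof -
  obtain B where "B \<in> blocks H" "C = graph_on H B" using assms components_eq[OF wfH] by auto
  then show "verts C \<in> blocks H" "C = graph_on H (verts C)" by auto
  have "halves H - halves C = {e \<in> halves H. src H e \<in> verts H - verts C}"
    using src_iff memH by auto
  then show "restrict_graph H (halves H - halves C) (verts H - verts C)
      = graph_on H (verts H - verts C)"
    by (simp add: graph_on_def)
qed

lemma robust_component_removed:
  assumes "robust H" "C \<in> components H"
  shows "robust (graph_on H (verts H - verts C))"
proof -
  let ?Z = "verts H - verts C"
  have Z: "?Z \<in> closed_sets H"
    by (rule verts_Diff_closed[OF wfH blocks_closed[OF component_removed(1)[OF assms(2)]]])
  show ?thesis unfolding robust_def
  proof (intro conjI allI impI ballI)
    show "wf_hgraph (graph_on H ?Z)" by (rule wf_graph_on[OF wfH Z])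
  next
    fix W e assume W: "W \<subseteq> verts (graph_on H ?Z)" and e: "e \<in> cut (graph_on H ?Z) W"
    have "cut (graph_on H ?Z) W = cut H W" "W \<subseteq> verts H"
      using W by (simp_all add: cut_graph_on[OF wfH Z] Int_absorb2 subset_iff)
    then show "\<exists>e'\<in>cut (graph_on H ?Z) W. e' \<noteq> e"
      using assms(1) e unfolding robust_def by simp
  next
    fix W assume W: "W \<in> closed_sets (graph_on H ?Z)" "W \<noteq> {}"
    then have "W \<in> closed_sets H" "W \<subseteq> ?Z" by (auto simp: closed_sets_graph_on[OF wfH Z])
    moreover from this have "ext_at (graph_on H ?Z) W = ext_at H W" by (auto simp: ext_at_def)
    ultimately show "ext_at (graph_on H ?Z) W \<noteq> {}"
      using assms(1) W(2) unfolding robust_def by simp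
  qed
qed

end

subsection \<open>Contraction to a vertex\<close>

context saturated_subgraph
begin

abbreviation (input) "z \<equiv> new_vertex H"
abbreviation (input) "K \<equiv> contract_to_vertex H C"

lemma z_fresh: "z \<notin> verts H" "e \<in> halves H \<Longrightarrow> src H e \<noteq> z" "z \<notin> verts C"
proof -
  show z: "z \<notin> verts H" by (rule new_vertex_fresh(1)[OF wf_finite[OF wfH]])
  then show "z \<notin> verts C" using verts_sub by blast
  show "src H e \<noteq> z" if "e \<in> halves H" using memH(2)[OF that] z by metis
qed

lemma K_simps:
  "halves K = (halves H - halves C) \<union> ext_halves C"
  "verts K = insert z (verts H - verts C)"
  "e \<in> halves K \<Longrightarrow> pairing K e = pairing H e"
  "e \<in> halves K \<Longrightarrow> src K e = (if e \<in> ext_halves C then z else src H e)"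
  "e \<in> halves K \<Longrightarrow> htype K e = htype H e"
  by (auto simp: contract_to_vertex_def Let_def)

lemma K_halves: "e \<in> halves K \<Longrightarrow> e \<in> halves H"
  by (auto simp: K_simps halves_sub ext_sub)

lemma K_pairing: "e \<in> halves K \<Longrightarrow> pairing H e \<in> halves K"
  using K_halves[of e] memH[of e] into_ext[of e] by (auto simp: K_simps(1))

lemma wf_K: "wf_hgraph K"
  unfolding wf_hgraph_def
proof (intro conjI ballI)
  show "finite (halves K)" "finite (verts K)"
    using wf_finite[OF wfH] wf_finite[OF wfC] by (auto simp: K_simps ext_halves_def)
  show "pairing K \<in> halves K \<rightarrow>\<^sub>E halves K"
    using K_pairing by (intro PiE_I) (auto simp: K_simps(3), auto simp: contract_to_vertex_def Let_def)
  have "src K e \<in> verts K" if "e \<in> halves K" for e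
    using that K_halves[OF that] src_iff[of e] memH(2)[of e]
    unfolding K_simps(4)[OF that] by (auto simp: K_simps(1,2))
  then show "src K \<in> halves K \<rightarrow>\<^sub>E verts K"
    by (intro PiE_I) (auto, auto simp: contract_to_vertex_def Let_def)
  show "htype K \<in> extensional (halves K)" by (auto simp: contract_to_vertex_def Let_def)
  show "pairing K (pairing K e) = e" if "e \<in> halves K" for e
    using that K_pairing[OF that] K_halves[OF that] by (simp add: K_simps(3) memH)
qed

text \<open>The preimage of a set of vertices when the vertices of \<open>C\<close> are collapsed to \<open>z\<close>.\<close>

definition lift_vertex :: "nat set \<Rightarrow> nat set" where
  "lift_vertex W = (if z \<in> W then (W - {z}) \<union> verts C else W)"

lemma src_lift_vertex:
  assumes "W \<subseteq> verts K" "e \<in> halves K"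
  shows "src H e \<in> lift_vertex W \<longleftrightarrow> src K e \<in> W"
proof (cases "e \<in> ext_halves C")
  case True
  then have "src H e \<in> verts C" using src_iff[OF K_halves[OF assms(2)]] ext_sub by blast
  moreover from this have "src H e \<noteq> z" using z_fresh(3) by auto
  ultimately have "src H e \<notin> W" using assms(1) by (auto simp: K_simps(2))
  then show ?thesis
    using True K_simps(4)[OF assms(2)] \<open>src H e \<in> verts C\<close> by (simp add: lift_vertex_def)
next
  case False
  then have "e \<in> halves H" "e \<notin> halves C" using assms(2) by (auto simp: K_simps(1))
  then have "src H e \<noteq> z" "src H e \<notin> verts C" using z_fresh(2) src_iff by auto
  then show ?thesis using False K_simps(4)[OF assms(2)] by (simp add: lift_vertex_def)
qed

lemma cut_lift_vertex:
  assumes "W \<subseteq> verts K"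
  shows "cut K W = cut H (lift_vertex W)"
proof -
  have vC: "src H e \<in> lift_vertex W \<longleftrightarrow> z \<in> W" if "e \<in> halves C" for e
    using src_iff[OF halves_sub[OF that]] that assms z_fresh verts_sub
    by (auto simp: lift_vertex_def K_simps(2))
  have "e \<in> halves K" if "e \<in> cut H (lift_vertex W)" for e
  proof (rule ccontr)
    assume "e \<notin> halves K"
    then have "e \<in> halves C" "e \<notin> ext_halves C" using that by (auto simp: cut_def K_simps(1))
    then show False using that nonext(2)[of e] vC by (auto simp: cut_def)
  qed
  moreover have "e \<in> cut K W \<longleftrightarrow> e \<in> cut H (lift_vertex W)" if "e \<in> halves K" for e
    unfolding cut_def mem_Collect_eq K_simps(3)[OF that] src_lift_vertex[OF assms that]
      src_lift_vertex[OF assms K_pairing[OF that]] using that K_halves[OF that] by blast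
  moreover have "e \<in> halves K" if "e \<in> cut K W" for e using that unfolding cut_def by blast
  ultimately show ?thesis by blast
qed

lemma ext_lift_vertex:
  assumes "W \<subseteq> verts K"
  shows "ext_at K W = ext_at H (lift_vertex W)"
proof -
  have "e \<in> halves K" if "e \<in> ext_at H (lift_vertex W)" for e
  proof (rule ccontr)
    assume n: "e \<notin> halves K"
    have "e \<in> halves H" "pairing H e = e" using that by (simp_all add: ext_at_def)
    with n have c: "e \<in> halves C" "e \<notin> ext_halves C" by (simp_all add: K_simps(1))
    then have "pairing C e = e" using nonext(1) \<open>pairing H e = e\<close> by metis
    with c show False by (simp add: ext_halves_def)
  qed
  moreover have "e \<in> ext_at K W \<longleftrightarrow> e \<in> ext_at H (lift_vertex W)" if "e \<in> halves K" for e
    unfolding ext_at_def mem_Collect_eq K_simps(3)[OF that] src_lift_vertex[OF assms that]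
    using that K_halves[OF that] by blast
  moreover have "e \<in> halves K" if "e \<in> ext_at K W" for e using that unfolding ext_at_def by blast
  ultimately show ?thesis by blast
qed

lemma vertex_comparison: "cut_comparison H K lift_vertex"
proof
  have ne: "verts C \<noteq> {}" using C_one_PI by (simp add: one_PI_iff)
  show "wf_hgraph H" "wf_hgraph K" by (rule wfH, rule wf_K)
  show "lift_vertex W \<subseteq> verts H" if "W \<subseteq> verts K" for W
    using that verts_sub by (auto simp: lift_vertex_def K_simps(2))
  show "lift_vertex W \<noteq> {}" if "W \<subseteq> verts K" "W \<noteq> {}" for W
    using that ne by (auto simp: lift_vertex_def)
  show "lift_vertex W \<noteq> verts H" if "W \<subseteq> verts K" "W \<noteq> verts K" for W
    using that ne verts_sub z_fresh(1) by (auto simp: lift_vertex_def K_simps(2) split: if_splits)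
  show "cut K W = cut H (lift_vertex W)" if "W \<subseteq> verts K" for W
    by (rule cut_lift_vertex[OF that])
  show "ext_at K W = ext_at H (lift_vertex W)" if "W \<in> closed_sets K" for W
    by (rule ext_lift_vertex[OF closed_sets_subset[OF that]])
  show "htype K e = htype H e" if "e \<in> halves K" for e by (rule K_simps(5)[OF that])
  show "lift_vertex W \<subseteq> lift_vertex W' \<longleftrightarrow> W \<subseteq> W'"
    if "W \<in> closed_sets K" "W' \<in> closed_sets K" for W W'
    using closed_sets_subset[OF that(1)] closed_sets_subset[OF that(2)] ne verts_sub z_fresh(1)
    by (auto simp: lift_vertex_def K_simps(2) split: if_splits)
  show "\<exists>W'. W' \<subseteq> verts K \<and> W = lift_vertex W'" if W: "W \<in> closed_sets H" for W
  proof (intro exI conjI)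
    let ?W = "if verts C \<subseteq> W then insert z (W - verts C) else W"
    show "?W \<subseteq> verts K" "W = lift_vertex ?W"
      using closed_sets_subset[OF W] closed_cases[OF W] z_fresh(1)
      by (auto simp: lift_vertex_def K_simps(2))
  qed
qed

lemma vertex_type_new: "vertex_type K z = ext_type C"
proof -
  have "{e \<in> halves K. src K e = z} = ext_halves C"
    using z_fresh(2) K_halves by (auto simp: K_simps(4) split: if_splits) (auto simp: K_simps)
  moreover have "finite (ext_halves C)" using wf_finite[OF wfC] by (simp add: ext_halves_def)
  ultimately show ?thesis
    unfolding vertex_type_def ext_type_def
    by (auto intro!: image_mset_cong simp: K_simps htype_eq ext_sub)
qed

lemma vertex_type_old:
  assumes "v \<in> verts H - verts C"
  shows "vertex_type K v = vertex_type H v"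
proof -
  have n: "e \<notin> halves C" if "e \<in> halves H" "src H e = v" for e
    using that assms src_iff by auto
  have "{e \<in> halves K. src K e = v} = {e \<in> halves H. src H e = v}"
  proof (intro equalityI subsetI)
    fix e assume "e \<in> {e \<in> halves K. src K e = v}"
    then show "e \<in> {e \<in> halves H. src H e = v}"
      using assms z_fresh K_halves by (auto simp: K_simps(4) split: if_splits)
  next
    fix e assume "e \<in> {e \<in> halves H. src H e = v}"
    then have "e \<in> halves K" "e \<notin> ext_halves C" "src H e = v"
      using n ext_sub by (auto simp: K_simps(1))
    then show "e \<in> {e \<in> halves K. src K e = v}" by (simp add: K_simps(4))
  qed
  moreover have "e \<in> halves K" if "e \<in> halves H" "src H e = v" for e
    using n that by (simp add: K_simps(1))
  moreover have "finite {e \<in> halves H. src H e = v}" using wf_finite[OF wfH] by simp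
  ultimately show ?thesis
    unfolding vertex_type_def by (auto intro!: image_mset_cong simp: K_simps(5))
qed

lemma vcount_vertex:
  "vcount K t + vcount C t = vcount H t + (if ext_type C = t then 1 else 0)"
proof -
  let ?A = "{v \<in> verts H - verts C. vertex_type H v = t}"
  have "{v \<in> verts K. vertex_type K v = t} = (if ext_type C = t then insert z ?A else ?A)"
    using vertex_type_new vertex_type_old by (auto simp: K_simps(2))
  moreover have "z \<notin> ?A" "finite ?A" using z_fresh wf_finite[OF wfH] by auto
  ultimately have "vcount K t = card ?A + (if ext_type C = t then 1 else 0)"
    by (simp add: vcount_def)
  then show ?thesis using vcount_outside[of t] by simp
qed

lemma scount_vertex: "scount K t = scount H t"
  by (rule cut_comparison.scount_\<Phi>[OF vertex_comparison])

lemma one_PI_vertex: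
  assumes H: "one_PI T H" and ext: "ext_type C \<in> vtypes T"
    and e: "e \<in> ext_halves C" "pairing H e \<noteq> e"
  shows "one_PI T K"
  unfolding one_PI_iff
proof (intro conjI)
  show "wf_hgraph K" by (rule wf_K)
  show "\<exists>e\<in>halves K. pairing K e \<noteq> e"
    using e by (intro bexI[of _ e]) (auto simp: K_simps)
  show "verts K \<noteq> {}" by (simp add: K_simps)
  show "htype K ` halves K \<subseteq> htypes T"
    using H K_halves by (auto simp: one_PI_iff K_simps(5))
  show "\<forall>e\<in>halves K. pairing K e \<noteq> e \<longrightarrow> incid T (htype K e) = htype K (pairing K e)"
    using H K_halves K_pairing by (auto simp: one_PI_iff K_simps(3,5))
  show "\<forall>v\<in>verts K. vertex_type K v \<in> vtypes T"
    using H ext vertex_type_new vertex_type_old by (auto simp: one_PI_iff K_simps(2))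
  show "two_connected K"
    using H cut_comparison.two_connected_\<Phi>[OF vertex_comparison] by (simp add: one_PI_iff)
  show "ext_type K \<in> vtypes T \<union> etypes T"
    using H cut_comparison.ext_type_\<Phi>[OF vertex_comparison] by (simp add: one_PI_iff)
qed

end

subsection \<open>Contraction to an edge\<close>

lemma pair_mset_eq: "{#a, b#} = {#c, d#} \<longleftrightarrow> a = c \<and> b = d \<or> a = d \<and> b = c"
  by (auto simp: add_eq_conv_ex)

text \<open>The situation in which \<open>contract_to_edge\<close> does what its name says: the two external half-edges
  of \<open>C\<close> are joined in \<open>H\<close> to half-edges \<open>d\<^sub>1\<close>, \<open>d\<^sub>2\<close> outside \<open>C\<close>, which become partners.\<close>

locale edge_subgraph = saturated_subgraph +
  fixes e\<^sub>1 e\<^sub>2 :: nat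
  assumes legs: "ext_halves C = {e\<^sub>1, e\<^sub>2}" "e\<^sub>1 \<noteq> e\<^sub>2"
    and legs_out: "pairing H e\<^sub>1 \<notin> halves C" "pairing H e\<^sub>2 \<notin> halves C"
begin

abbreviation (input) "L \<equiv> contract_to_edge H C"
abbreviation (input) "d\<^sub>1 \<equiv> pairing H e\<^sub>1"
abbreviation (input) "d\<^sub>2 \<equiv> pairing H e\<^sub>2"

lemma legs_mem: "e\<^sub>1 \<in> halves C" "e\<^sub>2 \<in> halves C" "e\<^sub>1 \<in> halves H" "e\<^sub>2 \<in> halves H"
  using legs ext_sub halves_sub by auto

lemma ends_mem: "d\<^sub>1 \<in> halves H" "d\<^sub>2 \<in> halves H"
  using legs_mem memH by auto

lemma pairing_ends: "pairing H d\<^sub>1 = e\<^sub>1" "pairing H d\<^sub>2 = e\<^sub>2"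
  using legs_mem memH by auto

lemma ends_neq: "d\<^sub>1 \<noteq> d\<^sub>2"
  using legs(2) pairing_ends by metis

lemma L_simps:
  "halves L = halves H - halves C"
  "verts L = verts H - verts C"
  "e \<in> halves L \<Longrightarrow> src L e = src H e"
  "e \<in> halves L \<Longrightarrow> htype L e = htype H e"
  by (auto simp: contract_to_edge_def Let_def)

lemma pairing_L:
  assumes "e \<in> halves L"
  shows "pairing L e = (if e = d\<^sub>1 then d\<^sub>2 else if e = d\<^sub>2 then d\<^sub>1 else pairing H e)"
proof -
  have e: "e \<in> halves H" "e \<notin> halves C" using assms by (simp_all add: L_simps(1))
  have i: "pairing H e = e\<^sub>1 \<longleftrightarrow> e = d\<^sub>1" "pairing H e = e\<^sub>2 \<longleftrightarrow> e = d\<^sub>2"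
    using memH(3)[OF e(1)] pairing_ends by metis+
  have "{e\<^sub>1, e\<^sub>2} - {e\<^sub>1} = {e\<^sub>2}" "{e\<^sub>1, e\<^sub>2} - {e\<^sub>2} = {e\<^sub>1}" using legs(2) by auto
  then have s: "the_elem ({e\<^sub>1, e\<^sub>2} - {e\<^sub>1}) = e\<^sub>2" "the_elem ({e\<^sub>1, e\<^sub>2} - {e\<^sub>2}) = e\<^sub>1"
    by simp_all
  have "pairing L e = (if pairing H e \<in> {e\<^sub>1, e\<^sub>2}
      then pairing H (the_elem ({e\<^sub>1, e\<^sub>2} - {pairing H e})) else pairing H e)"
    using e by (simp add: contract_to_edge_def Let_def legs(1))
  then show ?thesis using i s by (cases "e = d\<^sub>1"; cases "e = d\<^sub>2") (simp_all add: pairing_ends)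
qed

lemma ends_L: "d\<^sub>1 \<in> halves L" "d\<^sub>2 \<in> halves L"
  using ends_mem legs_out by (simp_all add: L_simps(1))

lemma L_outside: "e \<in> halves L \<Longrightarrow> e \<in> halves H \<and> e \<notin> halves C"
  by (simp add: L_simps(1))

lemma pairing_H_L:
  assumes "e \<in> halves L" "e \<noteq> d\<^sub>1" "e \<noteq> d\<^sub>2"
  shows "pairing H e \<in> halves L" "pairing H e \<noteq> d\<^sub>1" "pairing H e \<noteq> d\<^sub>2"
proof -
  have e: "e \<in> halves H" "e \<notin> halves C" using L_outside[OF assms(1)] by auto
  have "pairing H e \<noteq> e\<^sub>1" "pairing H e \<noteq> e\<^sub>2" using assms(2,3) memH(3)[OF e(1)] by auto
  then have "pairing H e \<notin> ext_halves C" by (simp add: legs(1))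
  then show "pairing H e \<in> halves L"
    using into_ext[OF e(1)] e memH(1)[OF e(1)] by (auto simp: L_simps(1))
  have "e \<noteq> e\<^sub>1" "e \<noteq> e\<^sub>2" using e(2) legs_mem by auto
  then show "pairing H e \<noteq> d\<^sub>1" "pairing H e \<noteq> d\<^sub>2"
    using memH(3)[OF e(1)] pairing_ends by metis+
qed

lemma pairing_L_mem: "e \<in> halves L \<Longrightarrow> pairing L e \<in> halves L"
  using pairing_H_L ends_L by (simp add: pairing_L)

lemma wf_L: "wf_hgraph L"
  unfolding wf_hgraph_def
proof (intro conjI ballI)
  show "finite (halves L)" "finite (verts L)"
    using wf_finite[OF wfH] by (simp_all add: L_simps)
  show "pairing L \<in> halves L \<rightarrow>\<^sub>E halves L"
    using pairing_L_mem by (intro PiE_I) (auto, auto simp: contract_to_edge_def Let_def)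
  have "src L e \<in> verts L" if "e \<in> halves L" for e
    using L_outside[OF that] src_iff[of e] memH(2)[of e]
    unfolding L_simps(3)[OF that] by (auto simp: L_simps(2))
  then show "src L \<in> halves L \<rightarrow>\<^sub>E verts L"
    by (intro PiE_I) (auto, auto simp: contract_to_edge_def Let_def)
  show "htype L \<in> extensional (halves L)" by (auto simp: contract_to_edge_def Let_def)
  fix e assume e: "e \<in> halves L"
  show "pairing L (pairing L e) = e"
  proof (cases "e = d\<^sub>1 \<or> e = d\<^sub>2")
    case True
    then show ?thesis using ends_L ends_neq by (auto simp: pairing_L)
  next
    case False
    with pairing_H_L[OF e] e show ?thesis
      by (simp add: pairing_L memH(3) L_outside)
  qed
qed

text \<open>If only one end of the new edge lies in \<open>W\<close>, then adding the vertices of \<open>C\<close> or not makes no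
  difference for the size of the cut; they are not added, so that the cut is literally the same.\<close>

definition lift_edge :: "nat set \<Rightarrow> nat set" where
  "lift_edge W = (if src H d\<^sub>1 \<in> W \<and> src H d\<^sub>2 \<in> W then W \<union> verts C else W)"

lemma src_outside: "e \<in> halves L \<Longrightarrow> src H e \<notin> verts C"
  using src_iff L_outside by blast

lemma src_lift_edge: "e \<in> halves L \<Longrightarrow> src H e \<in> lift_edge W \<longleftrightarrow> src H e \<in> W"
  using src_outside by (simp add: lift_edge_def)

lemma src_lift_edge_C:
  assumes "W \<subseteq> verts L" "e \<in> halves C"
  shows "src H e \<in> lift_edge W \<longleftrightarrow> src H d\<^sub>1 \<in> W \<and> src H d\<^sub>2 \<in> W"
proof -
  have "src H e \<in> verts C" using src_iff halves_sub assms(2) by blast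
  moreover from this have "src H e \<notin> W" using assms(1) by (auto simp: L_simps(2))
  ultimately show ?thesis by (simp add: lift_edge_def)
qed

lemma cut_lift_edge:
  assumes "W \<subseteq> verts L"
  shows "cut L W = cut H (lift_edge W)"
proof -
  have "e \<in> cut L W \<longleftrightarrow> e \<in> cut H (lift_edge W)" if e: "e \<in> halves L" for e
  proof -
    have eH: "e \<in> halves H" using L_outside[OF e] by simp
    have "src H (pairing H e) \<in> lift_edge W \<longleftrightarrow> src L (pairing L e) \<in> W"
      if in_W: "src H e \<in> W"
    proof (cases "e = d\<^sub>1 \<or> e = d\<^sub>2")
      case True
      then show ?thesis
        using in_W ends_L ends_neq
        by (auto simp: pairing_L pairing_ends src_lift_edge_C[OF assms] legs_mem L_simps(3))
    next
      case False
      then show ?thesis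
        using pairing_H_L[OF e] e by (simp add: pairing_L L_simps(3) src_lift_edge)
    qed
    then show ?thesis
      unfolding cut_def using e eH by (auto simp: L_simps(3) src_lift_edge)
  qed
  moreover have "e \<in> halves L" if c: "e \<in> cut H (lift_edge W)" for e
  proof (rule ccontr)
    assume "e \<notin> halves L"
    then have e: "e \<in> halves C" using c by (simp add: cut_def L_simps(1))
    have c': "src H e \<in> lift_edge W" "src H (pairing H e) \<notin> lift_edge W"
      using c by (simp_all add: cut_def)
    show False
    proof (cases "e \<in> ext_halves C")
      case True
      then have "e = e\<^sub>1 \<or> e = e\<^sub>2" by (simp add: legs(1))
      then show False
        using c' ends_L by (auto simp: src_lift_edge src_lift_edge_C[OF assms e])
    next
      case False
      show False
        using c' src_lift_edge_C[OF assms e] src_lift_edge_C[OF assms nonext(2)[OF e False]]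
        by simp
    qed
  qed
  moreover have "e \<in> halves L" if "e \<in> cut L W" for e using that unfolding cut_def by blast
  ultimately show ?thesis by blast
qed

lemma ext_lift_edge: "ext_at L W = ext_at H (lift_edge W)"
proof -
  have "e \<in> ext_at L W \<longleftrightarrow> e \<in> ext_at H (lift_edge W)" if e: "e \<in> halves L" for e
  proof (cases "e = d\<^sub>1 \<or> e = d\<^sub>2")
    case True
    have "d\<^sub>1 \<noteq> e\<^sub>1" "d\<^sub>2 \<noteq> e\<^sub>2" using legs_out legs_mem by auto
    then show ?thesis using True ends_neq e by (auto simp: ext_at_def pairing_L pairing_ends)
  next
    case False
    then show ?thesis
      using e L_outside[OF e] by (simp add: ext_at_def pairing_L L_simps(3) src_lift_edge)
  qed
  moreover have "e \<in> halves L" if x: "e \<in> ext_at H (lift_edge W)" for e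
  proof (rule ccontr)
    assume "e \<notin> halves L"
    then have e: "e \<in> halves C" "pairing H e = e" using x by (simp_all add: ext_at_def L_simps(1))
    then have "e \<in> ext_halves C" using nonext(1)[OF e(1)] by (auto simp: ext_halves_def)
    then show False using e legs_out by (auto simp: legs(1))
  qed
  moreover have "e \<in> halves L" if "e \<in> ext_at L W" for e using that unfolding ext_at_def by blast
  ultimately show ?thesis by blast
qed

lemma edge_comparison: "cut_comparison H L lift_edge"
proof
  have ne: "verts C \<noteq> {}" using C_one_PI by (simp add: one_PI_iff)
  show "wf_hgraph H" "wf_hgraph L" by (rule wfH, rule wf_L)
  show "lift_edge W \<subseteq> verts H" if "W \<subseteq> verts L" for W
    using that verts_sub by (auto simp: lift_edge_def L_simps(2))
  show "lift_edge W \<noteq> {}" if "W \<subseteq> verts L" "W \<noteq> {}" for W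
    using that by (auto simp: lift_edge_def)
  show "lift_edge W \<noteq> verts H" if W: "W \<subseteq> verts L" "W \<noteq> verts L" for W
  proof -
    obtain v where "v \<in> verts L" "v \<notin> W" using W by blast
    then have "v \<in> verts H" "v \<notin> lift_edge W" by (auto simp: L_simps(2) lift_edge_def)
    then show ?thesis by blast
  qed
  show "cut L W = cut H (lift_edge W)" if "W \<subseteq> verts L" for W
    by (rule cut_lift_edge[OF that])
  show "ext_at L W = ext_at H (lift_edge W)" for W
    by (rule ext_lift_edge)
  show "htype L e = htype H e" if "e \<in> halves L" for e by (rule L_simps(4)[OF that])
  have both: "src H d\<^sub>1 \<in> W \<longleftrightarrow> src H d\<^sub>2 \<in> W" if "W \<in> closed_sets L" for W
    using closed_setsD[OF that ends_L(1)] closed_setsD[OF that ends_L(2)] ends_L ends_neq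
    by (auto simp: pairing_L L_simps(3))
  show "lift_edge W \<subseteq> lift_edge W' \<longleftrightarrow> W \<subseteq> W'"
    if W: "W \<in> closed_sets L" "W' \<in> closed_sets L" for W W'
  proof
    have d: "W \<inter> verts C = {}" using closed_sets_subset[OF W(1)] by (auto simp: L_simps(2))
    assume "lift_edge W \<subseteq> lift_edge W'"
    moreover have "W \<subseteq> lift_edge W" "lift_edge W' \<subseteq> W' \<union> verts C"
      by (auto simp: lift_edge_def)
    ultimately show "W \<subseteq> W'" using d by blast
  next
    assume "W \<subseteq> W'"
    then show "lift_edge W \<subseteq> lift_edge W'" by (auto simp: lift_edge_def)
  qed
  show "\<exists>W'. W' \<subseteq> verts L \<and> W = lift_edge W'" if W: "W \<in> closed_sets H" for W
  proof (intro exI conjI)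
    show "W - verts C \<subseteq> verts L"
      using closed_sets_subset[OF W] by (auto simp: L_simps(2))
    have s: "src H e\<^sub>1 \<in> verts C" "src H e\<^sub>2 \<in> verts C" using src_iff legs_mem by auto
    have o: "src H d\<^sub>1 \<notin> verts C" "src H d\<^sub>2 \<notin> verts C" using src_outside ends_L by auto
    show "W = lift_edge (W - verts C)"
    proof (cases "verts C \<subseteq> W")
      case True
      then have "src H d\<^sub>1 \<in> W" "src H d\<^sub>2 \<in> W"
        using closed_setsD[OF W legs_mem(3)] closed_setsD[OF W legs_mem(4)] s by auto
      then show ?thesis using True o by (auto simp: lift_edge_def)
    next
      case False
      then have disj: "verts C \<inter> W = {}" using closed_cases[OF W] by blast
      then have "src H d\<^sub>1 \<notin> W"
        using closed_setsD[OF W ends_mem(1)] s by (auto simp: pairing_ends)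
      then show ?thesis using disj by (auto simp: lift_edge_def)
    qed
  qed
qed

lemma vertex_type_L:
  assumes "v \<in> verts L"
  shows "vertex_type L v = vertex_type H v"
proof -
  have v: "v \<notin> verts C" using assms by (simp add: L_simps(2))
  have "{e \<in> halves L. src L e = v} = {e \<in> halves H. src H e = v}"
    using v src_iff by (auto simp: L_simps(1,3))
  moreover have "e \<in> halves L" if "e \<in> halves H" "src H e = v" for e
    using v that src_iff by (auto simp: L_simps(1))
  moreover have "finite {e \<in> halves H. src H e = v}" using wf_finite[OF wfH] by simp
  ultimately show ?thesis
    unfolding vertex_type_def by (auto intro!: image_mset_cong simp: L_simps(4))
qed

lemma vcount_edge: "vcount L t + vcount C t = vcount H t"
proof -
  have "{v \<in> verts L. vertex_type L v = t} = {v \<in> verts H - verts C. vertex_type H v = t}"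
    using vertex_type_L by (auto simp: L_simps(2))
  then show ?thesis unfolding vcount_outside[of t] by (simp add: vcount_def)
qed

lemma scount_edge: "scount L t = scount H t"
  by (rule cut_comparison.scount_\<Phi>[OF edge_comparison])

lemma one_PI_edge:
  assumes T: "feynman_theory T" and H: "one_PI T H" and ext: "ext_type C \<in> etypes T"
  shows "one_PI T L"
  unfolding one_PI_iff
proof (intro conjI)
  show "wf_hgraph L" by (rule wf_L)
  show "\<exists>e\<in>halves L. pairing L e \<noteq> e"
    using ends_L ends_neq by (intro bexI[of _ d\<^sub>1]) (auto simp: pairing_L)
  show "verts L \<noteq> {}" using wf_hgraph_mem(2)[OF wf_L ends_L(1)] by auto
  show "htype L ` halves L \<subseteq> htypes T"
    using H L_outside by (auto simp: one_PI_iff L_simps(4))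
  have inc: "incid T (htype H e) = htype H (pairing H e)"
    if "e \<in> halves H" "pairing H e \<noteq> e" for e
    using H that by (simp add: one_PI_iff)
  show "\<forall>e\<in>halves L. pairing L e \<noteq> e \<longrightarrow> incid T (htype L e) = htype L (pairing L e)"
  proof (intro ballI impI)
    fix e assume e: "e \<in> halves L" "pairing L e \<noteq> e"
    have in1: "htype H d\<^sub>1 = incid T (htype H e\<^sub>1)" "htype H d\<^sub>2 = incid T (htype H e\<^sub>2)"
      using inc[OF legs_mem(3)] inc[OF legs_mem(4)] legs_out legs_mem by metis+
    have "ext_type C = {#htype H e\<^sub>1, htype H e\<^sub>2#}"
      using legs by (simp add: ext_type_def htype_eq legs_mem)
    then obtain s where s: "s \<in> htypes T" "{#htype H e\<^sub>1, htype H e\<^sub>2#} = {#s, incid T s#}"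
      using ext by (auto simp: etypes_def)
    have "incid T (incid T s) = s" using T s(1) by (simp add: feynman_theory_def)
    moreover have "htype H e\<^sub>1 = s \<and> htype H e\<^sub>2 = incid T s \<or> htype H e\<^sub>1 = incid T s \<and> htype H e\<^sub>2 = s"
      using s(2) by (simp add: pair_mset_eq)
    ultimately have "incid T (htype H d\<^sub>1) = htype H d\<^sub>2" "incid T (htype H d\<^sub>2) = htype H d\<^sub>1"
      using in1 by auto
    then show "incid T (htype L e) = htype L (pairing L e)"
      using e ends_L ends_neq pairing_H_L[OF e(1)] inc[of e] L_outside[OF e(1)]
      by (auto simp: pairing_L L_simps(4) split: if_splits)
  qed
  show "\<forall>v\<in>verts L. vertex_type L v \<in> vtypes T"
    using H vertex_type_L by (simp add: one_PI_iff L_simps(2))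
  show "two_connected L"
    using H cut_comparison.two_connected_\<Phi>[OF edge_comparison] by (simp add: one_PI_iff)
  show "ext_type L \<in> vtypes T \<union> etypes T"
    using H cut_comparison.ext_type_\<Phi>[OF edge_comparison] by (simp add: one_PI_iff)
qed

end

lemma size_ext_type: "size (ext_type C) = card (ext_halves C)"
  by (simp add: ext_type_def)

context saturated_subgraph
begin

text \<open>In a robust graph the only way to miss the situation of the previous locale is a subgraph that
  is a whole component, which is contracted by removing it.\<close>

lemma edge_legs:
  assumes rob: "robust H" and ext: "ext_type C \<in> etypes T" and nc: "C \<notin> components H"
  obtains e\<^sub>1 e\<^sub>2 where "edge_subgraph T H C e\<^sub>1 e\<^sub>2"
proof -
  have "card (ext_halves C) = 2" using ext size_ext_type[of C] by (auto simp: etypes_def)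
  then obtain a b where ab: "ext_halves C = {a, b}" "a \<noteq> b" by (auto simp: card_2_iff)
  have cl_sub: "verts C \<subseteq> verts H" by (rule verts_sub)
  have stay: "pairing H e \<in> halves C" if "e \<in> halves C - ext_halves C" for e
    using that nonext(2) by blast
  have out: "pairing H x \<notin> halves C" if xy: "ext_halves C = {x, y}" "x \<noteq> y" for x y
  proof
    have x: "x \<in> halves C" "y \<in> halves C" using xy ext_sub by auto
    assume "pairing H x \<in> halves C"
    then have px: "pairing H x = x \<or> pairing H x = y"
      using into_ext[OF halves_sub[OF x(1)]] xy by auto
    show False
    proof (cases "pairing H y \<in> halves C")
      case True
      \<comment> \<open>Then \<open>C\<close> fills a component of \<open>H\<close>, which needs an external half-edge.\<close>
      then have py: "pairing H y = x \<or> pairing H y = y"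
        using into_ext[OF halves_sub[OF x(2)]] xy by auto
      have "pairing H e \<in> halves C" if "e \<in> halves C" for e
      proof (cases "e \<in> ext_halves C")
        case True
        then have "e = x \<or> e = y" using xy(1) by simp
        then show ?thesis using px py x by metis
      qed (use stay that in blast)
      then have "src H (pairing H e) \<in> verts C" if "e \<in> halves H" "src H e \<in> verts C" for e
        using that src_iff[OF that(1)] src_iff[OF memH(1)[OF that(1)]] by blast
      then have "verts C \<in> closed_sets H"
        using cl_sub by (auto simp: closed_sets_def cut_def)
      moreover have "verts C \<noteq> {}" using C_one_PI by (simp add: one_PI_iff)
      ultimately have "ext_at H (verts C) \<noteq> {}" using rob by (auto simp: robust_def)
      then obtain e where e: "e \<in> halves C" "pairing H e = e"
        using src_iff by (auto simp: ext_at_def)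
      then have "e = x \<or> e = y" using nonext(1)[OF e(1)] xy(1) by (auto simp: ext_halves_def)
      then have "pairing H x = x \<and> pairing H y = y"
        using e px py memH(3)[OF halves_sub[OF x(1)]] memH(3)[OF halves_sub[OF x(2)]] xy(2) by metis
      then have "C \<in> components H" using ext_fixed_component xy(1) by auto
      then show False using nc by blast
    next
      case False
      \<comment> \<open>Then the edge at \<open>y\<close> is a bridge between \<open>C\<close> and the rest of \<open>H\<close>.\<close>
      then have "pairing H x = x"
        using px memH(3)[OF halves_sub[OF x(1)]] x by auto
      have "e = y" if c: "e \<in> cut H (verts C)" for e
      proof -
        have e: "e \<in> halves H" "src H e \<in> verts C" "src H (pairing H e) \<notin> verts C"
          using c by (simp_all add: cut_def)
        then have "e \<in> halves C" "pairing H e \<notin> halves C"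
          using src_iff[OF e(1)] src_iff[OF memH(1)[OF e(1)]] by auto
        moreover from this have "e = x \<or> e = y" using stay xy(1) by blast
        ultimately show ?thesis using \<open>pairing H x = x\<close> by metis
      qed
      moreover have "y \<in> cut H (verts C)"
        using False src_iff[of y] src_iff[of "pairing H y"] x halves_sub memH(1)[of y]
        by (auto simp: cut_def)
      ultimately show False using rob cl_sub unfolding robust_def by metis
    qed
  qed
  have "edge_subgraph T H C a b"
    using ab out[of a b] out[of b a]
    by unfold_locales (simp_all add: insert_commute)
  then show ?thesis by (rule that)
qed

lemma contract_step:
  assumes T: "feynman_theory T" and rob: "robust H" and t: "t \<in> vtypes T"
  shows "robust (contract_connected T H C)"
    "balance (contract_connected T H C) t = balance H t - balance C t"
proof -
  let ?H = "contract_connected T H C"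
  have "robust ?H \<and> balance ?H t = balance H t - balance C t"
  proof (cases "C \<in> components H")
    case True
    note r = component_removed[OF True]
    have e: "?H = graph_on H (verts H - verts C)"
      using True r(3) by (simp add: contract_connected_def)
    have "balance H t = balance C t + balance ?H t"
      unfolding e balance_def
      using vcount_split[OF wfH blocks_closed[OF r(1)], of t]
        scount_split[OF wfH blocks_closed[OF r(1)], of t] r(2) by simp
    then show ?thesis using robust_component_removed[OF rob True] e by simp
  next
    case nc: False
    have bC: "balance C t = int (vcount C t) - (if ext_type C = t then 1 else 0)"
      by (simp add: balance_def scount_one_PI[OF C_one_PI])
    show ?thesis
    proof (cases "ext_type C \<in> vtypes T")
      case True
      then have e: "?H = contract_to_vertex H C" using nc by (simp add: contract_connected_def)
      show ?thesis unfolding e bC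
        using cut_comparison.robust_\<Phi>[OF vertex_comparison rob]
          vcount_vertex[of t] scount_vertex[of t]
        by (auto simp: balance_def)
    next
      case False
      then have e: "?H = contract_to_edge H C" using nc by (simp add: contract_connected_def)
      have "ext_type C \<in> etypes T" using C_one_PI False by (auto simp: one_PI_iff)
      then obtain a b where "edge_subgraph T H C a b" using edge_legs[OF rob _ nc] by blast
      then interpret edge_subgraph T H C a b .
      have "ext_type C \<noteq> t" using False t by blast
      then show ?thesis unfolding e bC
        using cut_comparison.robust_\<Phi>[OF edge_comparison rob]
          vcount_edge[of t] scount_edge[of t]
        by (auto simp: balance_def)
    qed
  qed
  then show "robust ?H" "balance ?H t = balance H t - balance C t" by auto
qed

end


section \<open>Admissible subgraphs\<close>

text \<open>A subgraph that is not saturated leaves behind a half-edge without a vertex, and no later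
  contraction repairs this, because a new vertex avoids all sources of half-edges. Hence all
  components of an admissible subgraph are saturated at the time of their contraction.\<close>

lemma dangling_step:
  fixes T :: "'h ftheory"
  assumes fin: "finite (halves H)" "finite (verts H)" and wf: "wf_hgraph C"
    and e: "e \<in> halves H" "src H e \<notin> verts H" "e \<notin> halves C"
  defines "H' \<equiv> contract_connected T H C"
  shows "finite (halves H')" "finite (verts H')" "e \<in> halves H'" "src H' e \<notin> verts H'"
proof -
  have x: "e \<notin> ext_halves C" "finite (ext_halves C)"
    using e(3) wf_finite(1)[OF wf] by (auto simp: ext_halves_def)
  have n: "src H e \<noteq> new_vertex H" using new_vertex_fresh(2)[OF fin] e(1) by (metis imageI)
  show "finite (halves H')" "finite (verts H')" "e \<in> halves H'" "src H' e \<notin> verts H'"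
    using fin e x n
    by (auto simp: H'_def contract_connected_def restrict_graph_def contract_to_vertex_def
        contract_to_edge_def Let_def)
qed

lemma dangling_fold:
  assumes "finite (halves H)" "finite (verts H)" "e \<in> halves H" "src H e \<notin> verts H"
    and "\<forall>C\<in>set Cs. wf_hgraph C \<and> e \<notin> halves C"
  shows "\<not> wf_hgraph (fold (\<lambda>C H. contract_connected T H C) Cs H)"
  using assms
proof (induction Cs arbitrary: H)
  case Nil
  then show ?case by (auto dest: wf_hgraph_mem)
next
  case (Cons C Cs)
  have C: "wf_hgraph C" "e \<notin> halves C" using Cons.prems(5) by simp_all
  show ?case
    using Cons.IH[OF dangling_step[OF Cons.prems(1,2) C(1) Cons.prems(3,4) C(2)]] Cons.prems(5)
    by simp
qed

lemma lies_in_step: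
  assumes D: "lies_in D H" "wf_hgraph D"
    and disj: "halves D \<inter> halves C = {}" "verts D \<inter> verts C = {}"
  shows "lies_in D (contract_connected T H C)"
proof -
  have x: "e \<notin> ext_halves C" if "e \<in> halves D" for e
    using that disj(1) by (auto simp: ext_halves_def)
  have i: "e \<in> halves H \<and> e \<notin> halves C \<and> src H e = src D e \<and> htype H e = htype D e \<and>
      (pairing D e = e \<or> pairing D e = pairing H e \<and> pairing H e \<notin> ext_halves C)"
    if "e \<in> halves D" for e
    using D(1) that disj(1) x wf_hgraph_mem(1)[OF D(2) that] by (auto simp: lies_in_def)
  have v: "verts D \<subseteq> verts H - verts C" using D(1) disj(2) by (auto simp: lies_in_def)
  show ?thesis
    unfolding lies_in_def
  proof (intro conjI ballI)
    show "halves D \<subseteq> halves (contract_connected T H C)"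
      "verts D \<subseteq> verts (contract_connected T H C)"
      using i v by (auto simp: contract_connected_def restrict_graph_def contract_to_vertex_def
          contract_to_edge_def Let_def)
    fix e assume e: "e \<in> halves D"
    show "src (contract_connected T H C) e = src D e"
      "htype (contract_connected T H C) e = htype D e"
      "pairing D e = e \<or> pairing D e = pairing (contract_connected T H C) e"
      using i[OF e] x[OF e] by (auto simp: contract_connected_def restrict_graph_def
          contract_to_vertex_def contract_to_edge_def Let_def)
  qed
qed

lemma balance_fold:
  assumes T: "feynman_theory T" and t: "t \<in> vtypes T"
    and "robust H" "distinct Cs" "\<forall>C\<in>set Cs. one_PI T C \<and> lies_in C H"
    and "\<forall>C\<in>set Cs. \<forall>D\<in>set Cs. C \<noteq> D \<longrightarrow> halves D \<inter> halves C = {} \<and> verts D \<inter> verts C = {}"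
    and "wf_hgraph (fold (\<lambda>C H. contract_connected T H C) Cs H)"
  shows "balance (fold (\<lambda>C H. contract_connected T H C) Cs H) t =
    balance H t - (\<Sum>C\<in>set Cs. balance C t)"
  using assms(3-)
proof (induction Cs arbitrary: H)
  case (Cons C Cs)
  let ?H = "contract_connected T H C"
  have wfH: "wf_hgraph H" using Cons.prems(1) by (rule robust_wf)
  have C: "one_PI T C" "lies_in C H" using Cons.prems(3) by simp_all
  have disj: "halves D \<inter> halves C = {} \<and> verts D \<inter> verts C = {}" if "D \<in> set Cs" for D
    using Cons.prems(2,4) that by auto
  have pi: "one_PI T D" "lies_in D H" if "D \<in> set Cs" for D using Cons.prems(3) that by simp_all
  have "saturated C H"
    unfolding saturated_def
  proof (intro ballI impI, rule ccontr)
    fix e assume e: "e \<in> halves H" "src H e \<in> verts C" "e \<notin> halves C"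
    have wfC: "wf_hgraph C" using C(1) by (simp add: one_PI_iff)
    have x: "e \<notin> ext_halves C" using e(3) by (simp add: ext_halves_def)
    have v: "src H e \<noteq> new_vertex H"
      using wf_hgraph_mem(2)[OF wfH e(1)] new_vertex_fresh(1)[OF wf_finite[OF wfH]] by metis
    \<comment> \<open>The half-edge \<open>e\<close> loses its vertex.\<close>
    have d: "e \<in> halves ?H" "src ?H e \<notin> verts ?H"
      using e x v
      by (auto simp: contract_connected_def restrict_graph_def
          contract_to_vertex_def contract_to_edge_def Let_def)
    have f: "finite (halves ?H)" "finite (verts ?H)"
      using wf_finite[OF wfH] wf_finite[OF wfC]
      by (auto simp: contract_connected_def restrict_graph_def ext_halves_def
          contract_to_vertex_def contract_to_edge_def Let_def)
    have "wf_hgraph D \<and> e \<notin> halves D" if D: "D \<in> set Cs" for D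
    proof -
      have w: "wf_hgraph D" using pi(1)[OF D] by (simp add: one_PI_iff)
      moreover have "e \<notin> halves D"
      proof
        assume eD: "e \<in> halves D"
        then have "src H e = src D e" using pi(2)[OF D] by (simp add: lies_in_def)
        then have "src H e \<in> verts D" using wf_hgraph_mem(2)[OF w eD] by simp
        then show False using disj[OF D] e(2) by blast
      qed
      ultimately show ?thesis by blast
    qed
    then show False using dangling_fold[OF f d] Cons.prems(5) by auto
  qed
  then interpret saturated_subgraph T H C
    using wfH C by unfold_locales
  note st = contract_step[OF T Cons.prems(1) t]
  have l: "\<forall>D\<in>set Cs. one_PI T D \<and> lies_in D ?H"
  proof (intro ballI conjI)
    fix D assume D: "D \<in> set Cs"
    show "one_PI T D" by (rule pi(1)[OF D])
    then have "wf_hgraph D" by (simp add: one_PI_iff)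
    with pi(2)[OF D] show "lies_in D ?H" by (rule lies_in_step) (use disj[OF D] in auto)
  qed
  have "balance (fold (\<lambda>C H. contract_connected T H C) Cs ?H) t =
      balance ?H t - (\<Sum>C\<in>set Cs. balance C t)"
    by (rule Cons.IH[OF st(1) _ l]) (use Cons.prems in simp_all)
  then show ?case using st(2) Cons.prems(2) by simp
qed simp

lemma balance_components:
  assumes "feynman T G"
  shows "balance G t = (\<Sum>C\<in>components G. balance C t)"
proof -
  have wf: "wf_hgraph G" and pi: "\<And>B. B \<in> blocks G \<Longrightarrow> one_PI T (graph_on G B)"
    using assms by (auto simp: feynman_iff)
  note fin = finite_blocks[OF wf]
  have "inj_on (graph_on G) (blocks G)"
    by (rule inj_onI) (metis graph_on_simps(2))
  then have "(\<Sum>C\<in>components G. balance C t) = (\<Sum>B\<in>blocks G. balance (graph_on G B) t)"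
    by (simp add: components_eq[OF wf] sum.reindex)
  moreover have "scount (graph_on G B) t = (if block_type G B = t then 1 else 0)"
    if "B \<in> blocks G" for B
    by (simp add: scount_one_PI[OF pi[OF that]] ext_type_graph_on block_type_def)
  then have "(\<Sum>B\<in>blocks G. scount (graph_on G B) t) = scount G t"
    by (simp add: scount_def sum.If_cases[OF fin] Int_def)
  moreover have "(\<Sum>B\<in>blocks G. vcount (graph_on G B) t) = vcount G t"
  proof -
    have "{v \<in> verts G. vertex_type G v = t} = (\<Union>B\<in>blocks G. {v \<in> B. vertex_type G v = t})"
    proof (intro equalityI subsetI)
      fix v assume v: "v \<in> {v \<in> verts G. vertex_type G v = t}"
      then obtain B where "B \<in> blocks G" "v \<in> B" using block_ex[OF wf, of v] by blast
      with v show "v \<in> (\<Union>B\<in>blocks G. {v \<in> B. vertex_type G v = t})" by blast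
    qed (use closed_sets_subset[OF blocks_closed] in blast)
    moreover have "card (\<Union>B\<in>blocks G. {v \<in> B. vertex_type G v = t})
        = (\<Sum>B\<in>blocks G. card {v \<in> B. vertex_type G v = t})"
    proof (rule card_UN_disjoint[OF fin])
      show "\<forall>B\<in>blocks G. finite {v \<in> B. vertex_type G v = t}"
        using wf_finite(2)[OF wf] closed_sets_subset[OF blocks_closed]
        by (metis (no_types, lifting) finite_subset mem_Collect_eq subsetI subset_trans)
      show "\<forall>B\<in>blocks G. \<forall>B'\<in>blocks G. B \<noteq> B' \<longrightarrow>
          {v \<in> B. vertex_type G v = t} \<inter> {v \<in> B'. vertex_type G v = t} = {}"
        using block_eq[of _ G] by (auto simp: disjoint_iff)
    qed
    ultimately show ?thesis by (simp add: vcount_def[of G] vcount_graph_on)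
  qed
  ultimately show ?thesis
    by (simp add: balance_def sum_subtractf flip: of_nat_sum)
qed

text \<open>The identity behind the easy direction: the coefficients of \<open>V\<^sub>G - S\<^sub>G\<close> at vertex types add up
  along the coproduct.\<close>

lemma balance_contract:
  assumes T: "feynman_theory T" and G: "feynman T G" and adm: "admissible T G' G"
    and t: "t \<in> vtypes T"
  shows "balance G t = balance G' t + balance (contract T G G') t"
proof -
  have sub: "subgraph T G' G" and fe: "feynman T (contract T G G')"
    using adm by (auto simp: admissible_def)
  have fG': "feynman T G'" using sub by (simp add: subgraph_def)
  have wf: "wf_hgraph G" and wf': "wf_hgraph G'" using G fG' by (auto simp: feynman_iff)
  define Cs where "Cs = (SOME Cs. distinct Cs \<and> set Cs = components G')"
  have "finite (components G')" by (simp add: components_eq[OF wf'] finite_blocks[OF wf'])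
  then have "\<exists>Cs. distinct Cs \<and> set Cs = components G'" using finite_distinct_list by metis
  then have Cs: "distinct Cs" "set Cs = components G'"
    unfolding Cs_def by (metis (mono_tags, lifting) someI_ex)+
  have c: "contract T G G' = fold (\<lambda>C H. contract_connected T H C) Cs G"
    by (simp add: contract_def Cs_def)
  have sv: "verts G' \<subseteq> verts G" using sub wf_hgraph_mem(2)[OF wf] by (auto simp: subgraph_def)
  have s: "e \<in> halves G \<and> src G' e = src G e \<and> htype G' e = htype G e \<and>
      (pairing G' e = e \<or> pairing G' e = pairing G e)" if "e \<in> halves G'" for e
    using sub that by (auto simp: subgraph_def)
  have l: "one_PI T C \<and> lies_in C G" if C: "C \<in> components G'" for C
  proof -
    obtain B where B: "B \<in> blocks G'" "C = graph_on G' B"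
      using C by (auto simp: components_eq[OF wf'])
    have "B \<subseteq> verts G" using closed_sets_subset[OF blocks_closed[OF B(1)]] sv by blast
    then have "lies_in C G" using s by (auto simp: B(2) lies_in_def)
    moreover have "one_PI T C" using fG' B by (simp add: feynman_iff)
    ultimately show ?thesis by blast
  qed
  have "halves D \<inter> halves C = {} \<and> verts D \<inter> verts C = {}"
    if CD: "C \<in> components G'" "D \<in> components G'" "C \<noteq> D" for C D
  proof -
    obtain A B where "A \<in> blocks G'" "C = graph_on G' A" "B \<in> blocks G'" "D = graph_on G' B"
      using CD by (auto simp: components_eq[OF wf'])
    then show ?thesis using block_eq[of A G' B] CD(3) by auto
  qed
  then have "balance (contract T G G') t = balance G t - (\<Sum>C\<in>components G'. balance C t)"
    using balance_fold[OF T t feynman_robust[OF T G] Cs(1)] l fe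
    unfolding c Cs(2) feynman_iff by blast
  then show ?thesis using balance_components[OF fG'] by simp
qed

text \<open>A saturated connected subgraph of an irreducible graph is admissible as soon as one of its
  external half-edges belongs to an internal edge of the graph. Here the two counts are needed
  separately.\<close>

lemma contract_one_PI:
  assumes T: "feynman_theory T" and H: "one_PI T H" and C: "saturated_subgraph T H C"
    and x: "\<exists>e\<in>ext_halves C. pairing H e \<noteq> e"
  shows "admissible T C H"
    "vcount (contract T H C) t + vcount C t =
      vcount H t + (if ext_type C \<in> vtypes T \<and> ext_type C = t then 1 else 0)"
    "scount (contract T H C) t = scount H t"
proof -
  interpret saturated_subgraph T H C by (rule C)
  have rob: "robust H" by (rule feynman_robust[OF T one_PI_feynman[OF H]])
  obtain e where e: "e \<in> ext_halves C" "pairing H e \<noteq> e" using x by blast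
  have nc: "C \<notin> components H" using e blocks_one_PI(3)[OF H] by (auto simp: ext_halves_def)
  have "Cs = [C]" if "distinct Cs" "set Cs = {C}" for Cs
  proof (cases Cs)
    case (Cons D Ds)
    then have "D = C" "C \<notin> set Ds" "set Ds \<subseteq> {C}" using that by auto
    then have "set Ds = {}" using subset_singletonD[of "set Ds" C] by auto
    then show ?thesis using Cons \<open>D = C\<close> by simp
  qed (use that in simp)
  then have "distinct Cs \<and> set Cs = {C} \<longleftrightarrow> Cs = [C]" for Cs by auto
  then have c: "contract T H C = contract_connected T H C"
    by (simp add: contract_def blocks_one_PI(3)[OF C_one_PI])
  have "one_PI T (contract T H C) \<and>
    vcount (contract T H C) t + vcount C t =
      vcount H t + (if ext_type C \<in> vtypes T \<and> ext_type C = t then 1 else 0) \<and>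
    scount (contract T H C) t = scount H t"
  proof (cases "ext_type C \<in> vtypes T")
    case True
    then have "contract T H C = contract_to_vertex H C" using nc c by (simp add: contract_connected_def)
    then show ?thesis
      using one_PI_vertex[OF H True e] vcount_vertex[of t] scount_vertex[of t] True by simp
  next
    case False
    then have eq: "contract T H C = contract_to_edge H C" using nc c by (simp add: contract_connected_def)
    have et: "ext_type C \<in> etypes T" using C_one_PI False by (auto simp: one_PI_iff)
    then obtain a b where "edge_subgraph T H C a b" using edge_legs[OF rob _ nc] by blast
    then interpret edge_subgraph T H C a b .
    show ?thesis
      using one_PI_edge[OF T H et] vcount_edge[of t] scount_edge[of t] False eq by simp
  qed
  moreover have "subgraph T C H"
    unfolding subgraph_def
  proof (intro conjI ballI)
    show "feynman T C" by (rule one_PI_feynman[OF C_one_PI])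
    show "halves C \<subseteq> halves H" using halves_sub by blast
    show "src C = restrict (src H) (halves C)" "htype C = restrict (htype H) (halves C)"
      using wfC src_eq htype_eq
      by (auto simp: wf_hgraph_def PiE_def extensional_def fun_eq_iff)
    show "pairing C e = e \<or> pairing C e = pairing H e" if "e \<in> halves C" for e
      using C_in that by (simp add: lies_in_def)
    show "verts C = src H ` halves C"
    proof (intro equalityI subsetI)
      fix v assume v: "v \<in> verts C"
      then have "vertex_type C v \<in> vtypes T" using C_one_PI by (simp add: one_PI_iff)
      then have "vertex_type C v \<noteq> {#}" using T by (auto simp: feynman_theory_def)
      then have "{e \<in> halves C. src C e = v} \<noteq> {}"
        unfolding vertex_type_def by (metis image_mset_empty mset_set.empty)
      then obtain e where "e \<in> halves C" "src C e = v" by blast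
      then show "v \<in> src H ` halves C" using src_eq[of e] by (metis imageI)
    qed (use memC src_eq in auto)
  qed
  ultimately show "admissible T C H"
    "vcount (contract T H C) t + vcount C t =
      vcount H t + (if ext_type C \<in> vtypes T \<and> ext_type C = t then 1 else 0)"
    "scount (contract T H C) t = scount H t"
    using one_PI_feynman by (auto simp: admissible_def)
qed


section \<open>Embedded subgraphs\<close>

text \<open>\<open>K\<close> occurs in \<open>H\<close> as a saturated subgraph that is not a component, up to the renaming \<open>\<phi>\<close> of
  half-edges and \<open>\<psi>\<close> of vertices. External half-edges of \<open>K\<close> may be paired in \<open>H\<close>, and at least one
  of them is.\<close>

definition embeds :: "'h hgraph \<Rightarrow> 'h hgraph \<Rightarrow> (nat \<Rightarrow> nat) \<Rightarrow> (nat \<Rightarrow> nat) \<Rightarrow> bool" where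
  "embeds K H \<phi> \<psi> \<longleftrightarrow> inj_on \<phi> (halves K) \<and> inj_on \<psi> (verts K) \<and>
     \<phi> ` halves K \<subseteq> halves H \<and> \<psi> ` verts K \<subseteq> verts H \<and>
     (\<forall>e\<in>halves K. src H (\<phi> e) = \<psi> (src K e) \<and> htype H (\<phi> e) = htype K e \<and>
        (pairing K e \<noteq> e \<longrightarrow> pairing H (\<phi> e) = \<phi> (pairing K e))) \<and>
     (\<forall>e\<in>halves H. src H e \<in> \<psi> ` verts K \<longrightarrow> e \<in> \<phi> ` halves K) \<and>
     (\<exists>e\<in>ext_halves K. pairing H (\<phi> e) \<noteq> \<phi> e)"

text \<open>The copy of \<open>K\<close> along renamings that are injective on its half-edges and vertices.\<close>

definition image_graph :: "(nat \<Rightarrow> nat) \<Rightarrow> (nat \<Rightarrow> nat) \<Rightarrow> 'h hgraph \<Rightarrow> 'h hgraph" where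
  "image_graph \<phi> \<psi> K =
     (let E = \<phi> ` halves K; g = inv_into (halves K) \<phi> in
      \<lparr>halves = E, verts = \<psi> ` verts K, pairing = (\<lambda>e\<in>E. \<phi> (pairing K (g e))),
       src = (\<lambda>e\<in>E. \<psi> (src K (g e))), htype = (\<lambda>e\<in>E. htype K (g e))\<rparr>)"

lemma image_graph_iso:
  assumes wf: "wf_hgraph K" and inj: "inj_on \<phi> (halves K)" "inj_on \<psi> (verts K)"
  shows "graph_isomorphism K (image_graph \<phi> \<psi> K) \<phi> \<psi>"
proof
  let ?I = "image_graph \<phi> \<psi> K"
  show c: "pairing ?I (\<phi> e) = \<phi> (pairing K e)" "src ?I (\<phi> e) = \<psi> (src K e)"
    "htype ?I (\<phi> e) = htype K e" if "e \<in> halves K" for e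
    using that inj by (simp_all add: image_graph_def Let_def)
  have h: "halves ?I = \<phi> ` halves K" "verts ?I = \<psi> ` verts K"
    by (simp_all add: image_graph_def Let_def)
  show "bij_betw \<phi> (halves K) (halves ?I)" "bij_betw \<psi> (verts K) (verts ?I)"
    using inj by (simp_all add: h bij_betw_def)
  show "wf_hgraph K" by (rule wf)
  show "wf_hgraph ?I"
    unfolding wf_hgraph_def
  proof (intro conjI ballI)
    show "finite (halves ?I)" "finite (verts ?I)" using wf_finite[OF wf] by (simp_all add: h)
    show "pairing ?I \<in> halves ?I \<rightarrow>\<^sub>E halves ?I" "src ?I \<in> halves ?I \<rightarrow>\<^sub>E verts ?I"
      using wf_hgraph_mem[OF wf]
      by (auto simp: image_graph_def Let_def inj)
    show "htype ?I \<in> extensional (halves ?I)" by (simp add: image_graph_def Let_def)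
    show "pairing ?I (pairing ?I e) = e" if "e \<in> halves ?I" for e
      using that wf_hgraph_mem[OF wf] by (auto simp: h c)
  qed
qed

lemma embeds_saturated_subgraph:
  assumes K: "one_PI T K" and H: "wf_hgraph H" and emb: "embeds K H \<phi> \<psi>"
  shows "saturated_subgraph T H (image_graph \<phi> \<psi> K)"
    "\<exists>e\<in>ext_halves (image_graph \<phi> \<psi> K). pairing H e \<noteq> e"
proof -
  let ?I = "image_graph \<phi> \<psi> K"
  have inj: "inj_on \<phi> (halves K)" "inj_on \<psi> (verts K)" using emb by (auto simp: embeds_def)
  have wfK: "wf_hgraph K" using K by (simp add: one_PI_iff)
  interpret graph_isomorphism K ?I \<phi> \<psi> by (rule image_graph_iso[OF wfK inj])
  have l: "pairing ?I (\<phi> e) = \<phi> e \<or> pairing ?I (\<phi> e) = pairing H (\<phi> e)" if "e \<in> halves K" for e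
    using emb that commutes(1)[OF that] by (cases "pairing K e = e") (simp_all add: embeds_def)
  show "saturated_subgraph T H ?I"
  proof
    show "wf_hgraph H" by (rule H)
    show "one_PI T ?I" by (rule one_PI_iso[OF K])
    show "lies_in ?I H"
      using emb commutes(2,3) l unfolding lies_in_def halves_cod verts_cod
      by (auto simp: embeds_def)
    show "saturated ?I H"
      using emb unfolding saturated_def halves_cod verts_cod by (simp add: embeds_def)
  qed
  obtain e where e: "e \<in> ext_halves K" "pairing H (\<phi> e) \<noteq> \<phi> e" using emb by (auto simp: embeds_def)
  then have "\<phi> e \<in> ext_halves ?I" by (simp add: ext_halves_def halves_cod commutes(1))
  with e(2) show "\<exists>e\<in>ext_halves ?I. pairing H e \<noteq> e" by blast
qed

lemma embeds_iso:
  assumes K: "wf_hgraph K" and emb: "embeds K B \<phi> \<psi>" and iso: "graph_isomorphism B R \<alpha> \<beta>"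
  shows "embeds K R (\<alpha> \<circ> \<phi>) (\<beta> \<circ> \<psi>)"
proof -
  interpret graph_isomorphism B R \<alpha> \<beta> by (rule iso)
  have m: "\<phi> e \<in> halves B" if "e \<in> halves K" for e using emb that by (auto simp: embeds_def)
  have sub: "\<psi> ` verts K \<subseteq> verts B" "\<phi> ` halves K \<subseteq> halves B" using emb by (auto simp: embeds_def)
  show ?thesis
    unfolding embeds_def
  proof (intro conjI ballI impI)
    show "inj_on (\<alpha> \<circ> \<phi>) (halves K)" "inj_on (\<beta> \<circ> \<psi>) (verts K)"
      using emb bij_halves bij_verts sub
      by (auto simp: embeds_def bij_betw_def intro!: comp_inj_on intro: inj_on_subset)
    show "(\<alpha> \<circ> \<phi>) ` halves K \<subseteq> halves R" "(\<beta> \<circ> \<psi>) ` verts K \<subseteq> verts R"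
      using sub halves_cod verts_cod by auto
    show "src R ((\<alpha> \<circ> \<phi>) e) = (\<beta> \<circ> \<psi>) (src K e)" "htype R ((\<alpha> \<circ> \<phi>) e) = htype K e"
      if "e \<in> halves K" for e
      using that emb by (simp_all add: commutes m) (simp_all add: embeds_def)
    show "pairing R ((\<alpha> \<circ> \<phi>) e) = (\<alpha> \<circ> \<phi>) (pairing K e)"
      if "e \<in> halves K" "pairing K e \<noteq> e" for e
      using that emb by (simp add: commutes m) (simp add: embeds_def)
    show "e \<in> (\<alpha> \<circ> \<phi>) ` halves K"
      if x: "e \<in> halves R" "src R e \<in> (\<beta> \<circ> \<psi>) ` verts K" for e
    proof -
      obtain d where d: "d \<in> halves B" "e = \<alpha> d" using x(1) unfolding halves_cod by blast
      have "\<beta> (src B d) \<in> \<beta> ` \<psi> ` verts K" using x(2) d by (simp add: commutes image_comp)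
      then have "src B d \<in> \<psi> ` verts K" using \<psi>_mem_image[OF mem(2)[OF d(1)] sub(1)] by simp
      then have "d \<in> \<phi> ` halves K" using emb d(1) by (simp add: embeds_def)
      then show ?thesis using d(2) by auto
    qed
    obtain e where e: "e \<in> ext_halves K" "pairing B (\<phi> e) \<noteq> \<phi> e"
      using emb by (auto simp: embeds_def)
    then have "e \<in> halves K" by (simp add: ext_halves_def)
    then have "pairing R ((\<alpha> \<circ> \<phi>) e) \<noteq> (\<alpha> \<circ> \<phi>) e"
      using e(2) m mem by (simp add: commutes \<phi>_eq_iff)
    then show "\<exists>e\<in>ext_halves K. pairing R ((\<alpha> \<circ> \<phi>) e) \<noteq> (\<alpha> \<circ> \<phi>) e" using e(1) by blast
  qed
qed

text \<open>The coproduct is computed on a chosen representative \<open>R\<close> of an isomorphism class; an embedding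
  into any \<open>B\<close> in the class yields a term of the coproduct.\<close>

lemma embedded_contraction:
  assumes T: "feynman_theory T" and B: "one_PI T B" and K: "one_PI T K"
    and emb: "embeds K B \<phi> \<psi>" and same: "same_graph B R"
  obtains C where "admissible T C R"
    "\<And>t. vcount C t = vcount K t" "\<And>t. scount C t = scount K t"
    "\<And>t. vcount (contract T R C) t + vcount K t =
      vcount R t + (if ext_type K \<in> vtypes T \<and> ext_type K = t then 1 else 0)"
    "\<And>t. scount (contract T R C) t = scount R t"
proof -
  obtain \<alpha> \<beta> where iso: "graph_isomorphism B R \<alpha> \<beta>" by (rule same_graphE[OF same])
  have wfK: "wf_hgraph K" using K by (simp add: one_PI_iff)
  have R: "one_PI T R" by (rule graph_isomorphism.one_PI_iso[OF iso B])
  then have wfR: "wf_hgraph R" by (simp add: one_PI_iff)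
  note e = embeds_iso[OF wfK emb iso]
  let ?C = "image_graph (\<alpha> \<circ> \<phi>) (\<beta> \<circ> \<psi>) K"
  have "inj_on (\<alpha> \<circ> \<phi>) (halves K)" "inj_on (\<beta> \<circ> \<psi>) (verts K)" using e by (simp_all add: embeds_def)
  then interpret C: graph_isomorphism K ?C "\<alpha> \<circ> \<phi>" "\<beta> \<circ> \<psi>" by (rule image_graph_iso[OF wfK])
  note c = contract_one_PI[OF T R embeds_saturated_subgraph[OF K wfR e]]
  have x: "ext_type ?C = ext_type K"
    using C.block_type_image[OF order_refl]
    by (simp add: ext_type_eq_block_type C.wf_dom C.wf_cod C.verts_cod)
  show ?thesis
  proof (rule that)
    show "admissible T ?C R" by (rule c(1))
    show "vcount ?C t = vcount K t" "scount ?C t = scount K t" for t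
      using C.vcount_iso C.scount_iso by simp_all
    show "vcount (contract T R ?C) t + vcount K t =
      vcount R t + (if ext_type K \<in> vtypes T \<and> ext_type K = t then 1 else 0)" for t
      using c(2)[of t] C.vcount_iso[of t] x by simp
    show "scount (contract T R ?C) t = scount R t" for t by (rule c(3))
  qed
qed


section \<open>Insertion at a vertex\<close>

lemma image_mset_eq_bij:
  assumes "finite A" "finite B" "image_mset f (mset_set A) = image_mset g (mset_set B)"
  shows "\<exists>\<beta>. bij_betw \<beta> A B \<and> (\<forall>a\<in>A. g (\<beta> a) = f a)"
  using assms
proof (induction A arbitrary: B rule: finite_induct)
  case empty
  then have "B = {}" by (simp add: mset_set_empty_iff)
  then show ?case by (simp add: bij_betw_def)
next
  case (insert a A)
  have "f a \<in># image_mset g (mset_set B)" using insert.prems(2) insert.hyps by (metis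
        finite.insertI finite_set_mset_mset_set image_eqI insertI1 set_image_mset insert.hyps(1))
  then obtain b where b: "b \<in> B" "g b = f a" using insert.prems(1) by auto
  have "mset_set B = add_mset b (mset_set (B - {b}))"
    using b(1) insert.prems(1) by (simp add: mset_set.remove)
  then have "image_mset f (mset_set A) = image_mset g (mset_set (B - {b}))"
    using insert.prems(2) insert.hyps b(2) by simp
  then obtain \<beta> where \<beta>: "bij_betw \<beta> A (B - {b})" "\<forall>a\<in>A. g (\<beta> a) = f a"
    using insert.IH[of "B - {b}"] insert.prems(1) by auto
  have "bij_betw (\<beta>(a := b)) (insert a A) (insert b (B - {b}))"
    using \<beta>(1) insert.hyps(2) by (auto simp: bij_betw_def inj_on_def)
  moreover have "insert b (B - {b}) = B" using b(1) by blast
  ultimately have "bij_betw (\<beta>(a := b)) (insert a A) B" by (simp only:)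
  moreover have "\<forall>c\<in>insert a A. g ((\<beta>(a := b)) c) = f c" using \<beta>(2) b(2) by simp
  ultimately show ?case by blast
qed

text \<open>The vertex \<open>v\<close> of \<open>G\<close> is replaced by the graph \<open>K\<close>, whose external half-edges are identified with
  the half-edges at \<open>v\<close> by a bijection \<open>\<beta>\<close> that preserves types.\<close>

locale vertex_insertion =
  fixes T :: "'h ftheory" and G K :: "'h hgraph" and v :: nat and \<beta> :: "nat \<Rightarrow> nat"
  assumes G: "one_PI T G" and K: "one_PI T K" and v: "v \<in> verts G"
    and \<beta>_bij: "bij_betw \<beta> (ext_halves K) {e \<in> halves G. src G e = v}"
    and \<beta>_type: "\<And>e. e \<in> ext_halves K \<Longrightarrow> htype G (\<beta> e) = htype K e"
begin

abbreviation (input) "inl e \<equiv> sum_encode (Inl e)"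
abbreviation (input) "inr e \<equiv> sum_encode (Inr e)"

text \<open>The inverse of \<open>\<beta>\<close>.\<close>

definition \<gamma> :: "nat \<Rightarrow> nat" where "\<gamma> = inv_into (ext_halves K) \<beta>"

text \<open>The result of the insertion. Of two identified half-edges the one from \<open>G\<close> is kept, with its
  partner in \<open>G\<close> and its source in \<open>K\<close>.\<close>

definition glued :: "'h hgraph" where
  "glued =
     (let E = tag_union (halves G) (halves K - ext_halves K) in
      \<lparr>halves = E, verts = tag_union (verts G - {v}) (verts K),
       pairing = restrict (tag_map (pairing G) (pairing K)) E,
       src = (\<lambda>n\<in>E. case sum_decode n of
         Inl e \<Rightarrow> if src G e = v then inr (src K (\<gamma> e)) else inl (src G e) | Inr e \<Rightarrow> inr (src K e)),
       htype = (\<lambda>n\<in>E. case_sum (htype G) (htype K) (sum_decode n))\<rparr>)"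

lemma wfG: "wf_hgraph G" and wfK: "wf_hgraph K"
  using G K by (simp_all add: one_PI_iff)

lemmas memG = wf_hgraph_mem[OF wfG] and memK = wf_hgraph_mem[OF wfK]

lemma glued_halves: "halves glued = tag_union (halves G) (halves K - ext_halves K)"
  and glued_verts: "verts glued = tag_union (verts G - {v}) (verts K)"
  by (simp_all add: glued_def Let_def)

lemma glued_simps:
  "e \<in> halves G \<Longrightarrow> pairing glued (inl e) = inl (pairing G e)"
  "e \<in> halves K - ext_halves K \<Longrightarrow> pairing glued (inr e) = inr (pairing K e)"
  "e \<in> halves G \<Longrightarrow>
    src glued (inl e) = (if src G e = v then inr (src K (\<gamma> e)) else inl (src G e))"
  "e \<in> halves K - ext_halves K \<Longrightarrow> src glued (inr e) = inr (src K e)"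
  "e \<in> halves G \<Longrightarrow> htype glued (inl e) = htype G e"
  "e \<in> halves K - ext_halves K \<Longrightarrow> htype glued (inr e) = htype K e"
  by (simp_all add: glued_def Let_def)

lemma \<gamma>_mem:
  assumes "e \<in> halves G" "src G e = v"
  shows "\<gamma> e \<in> ext_halves K" "\<beta> (\<gamma> e) = e"
proof -
  have "e \<in> \<beta> ` ext_halves K" using assms \<beta>_bij by (simp add: bij_betw_def)
  then show "\<gamma> e \<in> ext_halves K" "\<beta> (\<gamma> e) = e"
    unfolding \<gamma>_def by (rule inv_into_into, rule f_inv_into_f)
qed

lemma \<beta>_mem:
  assumes "e \<in> ext_halves K"
  shows "\<beta> e \<in> halves G" "src G (\<beta> e) = v" "\<gamma> (\<beta> e) = e"
  using bij_betw_apply[OF \<beta>_bij assms] bij_betw_inv_into_left[OF \<beta>_bij assms]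
  by (simp_all add: \<gamma>_def)

lemma ext_K: "e \<in> ext_halves K \<Longrightarrow> e \<in> halves K"
  by (simp add: ext_halves_def)

lemma nonext_K:
  assumes "e \<in> halves K - ext_halves K"
  shows "pairing K e \<in> halves K - ext_halves K" "pairing K e \<noteq> e"
proof -
  have e: "e \<in> halves K" "pairing K e \<noteq> e" using assms by (simp_all add: ext_halves_def)
  then show "pairing K e \<noteq> e" by blast
  show "pairing K e \<in> halves K - ext_halves K"
    using memK[OF e(1)] e(2) by (simp add: ext_halves_def)
qed

lemma wf_glued: "wf_hgraph glued"
  unfolding wf_hgraph_def
proof (intro conjI ballI)
  show "finite (halves glued)" "finite (verts glued)"
    using wf_finite[OF wfG] wf_finite[OF wfK] by (simp_all add: glued_halves glued_verts tag_union_def)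
  have p: "pairing glued n \<in> halves glued \<and> src glued n \<in> verts glued \<and>
      pairing glued (pairing glued n) = n" if n: "n \<in> halves glued" for n
    using n[unfolded glued_halves]
  proof (cases rule: tag_unionE)
    case (1 e)
    then show ?thesis
      using memG[OF 1(1)] \<gamma>_mem(1)[OF 1(1)] ext_K memK(2)
      by (simp add: glued_simps(1,3) glued_halves glued_verts)
  next
    case (2 e)
    then show ?thesis
      using nonext_K[OF 2(1)] memK[of e]
      by (simp add: glued_simps(2,4) glued_halves glued_verts)
  qed
  show "pairing glued \<in> halves glued \<rightarrow>\<^sub>E halves glued"
    using p by (intro PiE_I) (auto, auto simp: glued_def Let_def)
  show "src glued \<in> halves glued \<rightarrow>\<^sub>E verts glued"
    using p by (intro PiE_I) (auto, auto simp: glued_def Let_def)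
  show "pairing glued (pairing glued n) = n" if "n \<in> halves glued" for n using p that by blast
  show "htype glued \<in> extensional (halves glued)" by (simp add: glued_def Let_def)
qed

text \<open>The half-edges of \<open>K\<close> inside the glued graph.\<close>

definition \<kappa> :: "nat \<Rightarrow> nat" where "\<kappa> e = (if e \<in> ext_halves K then inl (\<beta> e) else inr e)"

lemma \<kappa>_mem:
  assumes "e \<in> halves K"
  shows "\<kappa> e \<in> halves glued" "src glued (\<kappa> e) = inr (src K e)" "htype glued (\<kappa> e) = htype K e"
    "pairing K e \<noteq> e \<Longrightarrow> pairing glued (\<kappa> e) = \<kappa> (pairing K e)"
proof -
  have "\<kappa> e \<in> halves glued \<and> src glued (\<kappa> e) = inr (src K e) \<and> htype glued (\<kappa> e) = htype K e \<and>
    (pairing K e \<noteq> e \<longrightarrow> pairing glued (\<kappa> e) = \<kappa> (pairing K e))"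
  proof (cases "e \<in> ext_halves K")
    case True
    then have "pairing K e = e" by (simp add: ext_halves_def)
    with True show ?thesis
      using \<beta>_mem[OF True] \<beta>_type[OF True]
      by (simp add: \<kappa>_def glued_halves glued_simps(1,3,5))
  next
    case False
    then have e: "e \<in> halves K - ext_halves K" using assms by simp
    from False nonext_K(1)[OF e] show ?thesis
      by (simp add: \<kappa>_def glued_halves glued_simps(2,4,6)[OF e] assms)
  qed
  then show "\<kappa> e \<in> halves glued" "src glued (\<kappa> e) = inr (src K e)"
    "htype glued (\<kappa> e) = htype K e" "pairing K e \<noteq> e \<Longrightarrow> pairing glued (\<kappa> e) = \<kappa> (pairing K e)"
    by blast+
qed

lemma inj_\<kappa>: "inj_on \<kappa> (halves K)"
  using \<beta>_bij by (auto simp: inj_on_def \<kappa>_def bij_betw_def sum_encode_eq)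

lemma src_inr:
  assumes "n \<in> halves glued" "src glued n = inr u"
  shows "\<exists>e\<in>halves K. src K e = u \<and> n = \<kappa> e"
  using assms(1) unfolding glued_halves
proof (cases rule: tag_unionE)
  case (1 e)
  then have "src G e = v" "src K (\<gamma> e) = u"
    using assms(2) by (auto simp: glued_simps(3) sum_encode_eq split: if_splits)
  then show ?thesis
    using 1 \<gamma>_mem[OF 1(1)] ext_K by (intro bexI[of _ "\<gamma> e"]) (auto simp: \<kappa>_def)
next
  case (2 e)
  then show ?thesis
    using assms(2) by (intro bexI[of _ e]) (auto simp: \<kappa>_def glued_simps(4) sum_encode_eq)
qed

lemma glued_vertex_types:
  "u \<in> verts K \<Longrightarrow> vertex_type glued (inr u) = vertex_type K u"
  "u \<in> verts G - {v} \<Longrightarrow> vertex_type glued (inl u) = vertex_type G u"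
proof -
  assume u: "u \<in> verts K"
  have "bij_betw \<kappa> {e \<in> halves K. src K e = u} {n \<in> halves glued. src glued n = inr u}"
    using inj_\<kappa> src_inr[of _ u] \<kappa>_mem(1,2)
    by (intro bij_betw_imageI) (auto intro: inj_on_subset)
  then show "vertex_type glued (inr u) = vertex_type K u"
    unfolding vertex_type_def by (rule image_mset_bij) (simp add: \<kappa>_mem(3))
next
  assume u: "u \<in> verts G - {v}"
  have "bij_betw (\<lambda>e. inl e) {e \<in> halves G. src G e = u} {n \<in> halves glued. src glued n = inl u}"
  proof (rule bij_betw_imageI)
    show "(\<lambda>e. inl e) ` {e \<in> halves G. src G e = u} = {n \<in> halves glued. src glued n = inl u}"
    proof (intro equalityI subsetI)
      fix n assume "n \<in> {n \<in> halves glued. src glued n = inl u}"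
      then have n: "n \<in> tag_union (halves G) (halves K - ext_halves K)" "src glued n = inl u"
        by (simp_all add: glued_halves)
      from n(1) show "n \<in> (\<lambda>e. inl e) ` {e \<in> halves G. src G e = u}"
        by (cases rule: tag_unionE)
           (use n(2) in \<open>auto simp: glued_simps(3,4) sum_encode_eq split: if_splits\<close>)
    qed (use u in \<open>auto simp: glued_halves glued_simps(3)\<close>)
  qed (simp add: inj_on_def sum_encode_eq)
  then show "vertex_type glued (inl u) = vertex_type G u"
    unfolding vertex_type_def by (rule image_mset_bij) (simp add: glued_simps(5))
qed

lemma glued_two_connected: "two_connected glued"
  unfolding two_connected_def
proof (intro allI impI)
  fix W assume W: "W \<subseteq> verts glued" "W \<noteq> {}" "W \<noteq> verts glued"
  have tc: "two_connected G" "two_connected K" using G K by (simp_all add: one_PI_iff)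
  define U where "U = {u \<in> verts K. inr u \<in> W}"
  \<comment> \<open>Either \<open>W\<close> cuts \<open>K\<close> itself, or \<open>K\<close> lies on one side and behaves like the single vertex \<open>v\<close> of \<open>G\<close>.\<close>
  show "\<exists>e\<in>cut glued W. \<exists>e'\<in>cut glued W. e \<noteq> e'"
  proof (cases "U \<noteq> {} \<and> U \<noteq> verts K")
    case True
    have "U \<subseteq> verts K" by (auto simp: U_def)
    then obtain e e' where e: "e \<in> cut K U" "e' \<in> cut K U" "e \<noteq> e'"
      using tc(2) True unfolding two_connected_def by meson
    have "\<kappa> c \<in> cut glued W" if "c \<in> cut K U" for c
    proof -
      have c: "c \<in> halves K" "src K c \<in> U" "src K (pairing K c) \<notin> U" "pairing K c \<noteq> c"
        using that by (auto simp: cut_def)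
      then show ?thesis
        using \<kappa>_mem[OF c(1)] \<kappa>_mem(2)[OF memK(1)[OF c(1)]] memK[OF c(1)]
          memK(2)[OF memK(1)[OF c(1)]]
        by (simp add: cut_def U_def)
    qed
    moreover have "\<kappa> e \<noteq> \<kappa> e'"
      using e inj_\<kappa> by (auto simp: inj_on_def cut_def)
    ultimately show ?thesis using e by blast
  next
    case False
    define S where "S = {u \<in> verts G. if u = v then U = verts K else inl u \<in> W}"
    have uK: "inr u \<in> W \<longleftrightarrow> v \<in> S" if "u \<in> verts K" for u
      using False that v by (auto simp: S_def U_def)
    have "S \<subseteq> verts G" by (auto simp: S_def)
    moreover have "S \<noteq> {}"
    proof -
      obtain n where n: "n \<in> W" "n \<in> tag_union (verts G - {v}) (verts K)"
        using W(1,2) glued_verts by blast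
      from n(2) show ?thesis
        by (cases rule: tag_unionE) (use n(1) uK in \<open>auto simp: S_def\<close>)
    qed
    moreover have "S \<noteq> verts G"
    proof -
      obtain n where n: "n \<notin> W" "n \<in> tag_union (verts G - {v}) (verts K)"
        using W(1,3) glued_verts by blast
      from n(2) show ?thesis
      proof (cases rule: tag_unionE)
        case (1 u)
        then have "u \<in> verts G" "u \<notin> S" using n(1) by (auto simp: S_def)
        then show ?thesis by blast
      next
        case (2 u)
        then have "v \<notin> S" using uK n(1) by blast
        then show ?thesis using v by blast
      qed
    qed
    ultimately obtain e e' where e: "e \<in> cut G S" "e' \<in> cut G S" "e \<noteq> e'"
      using tc(1) unfolding two_connected_def by meson
    have s: "src glued (inl c) \<in> W \<longleftrightarrow> src G c \<in> S" if "c \<in> halves G" for c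
      using that uK[OF memK(2)[OF ext_K[OF \<gamma>_mem(1)[OF that]]]] memG(2)[OF that]
      by (auto simp: glued_simps(3)) (auto simp: S_def)
    have "inl c \<in> cut glued W" if "c \<in> cut G S" for c
      using that s memG(1)[of c] by (simp add: cut_def glued_halves glued_simps(1))
    moreover have "inl e \<noteq> inl e'" using e(3) by (simp add: sum_encode_eq)
    ultimately show ?thesis using e by blast
  qed
qed

lemma glued_ext_type: "ext_type glued = ext_type G"
proof -
  have "bij_betw (\<lambda>e. inl e) (ext_halves G) (ext_halves glued)"
  proof (rule bij_betw_imageI)
    show "(\<lambda>e. inl e) ` ext_halves G = ext_halves glued"
    proof (intro equalityI subsetI)
      fix n assume "n \<in> ext_halves glued"
      then have n: "n \<in> tag_union (halves G) (halves K - ext_halves K)" "pairing glued n = n"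
        by (simp_all add: ext_halves_def glued_halves)
      from n(1) show "n \<in> (\<lambda>e. inl e) ` ext_halves G"
      proof (cases rule: tag_unionE)
        case (1 e)
        then have "pairing G e = e" using n(2) by (simp add: glued_simps(1) sum_encode_eq)
        with 1 show ?thesis by (simp add: ext_halves_def)
      next
        case (2 e)
        then have "pairing K e = e" using n(2) by (simp add: glued_simps(2) sum_encode_eq)
        with nonext_K(2)[OF 2(1)] show ?thesis by blast
      qed
    qed (auto simp: ext_halves_def glued_halves glued_simps(1))
  qed (simp add: inj_on_def sum_encode_eq)
  then show ?thesis
    unfolding ext_type_def by (rule image_mset_bij) (simp add: glued_simps(5) ext_halves_def)
qed

lemma glued_one_PI: "one_PI T glued"
  unfolding one_PI_iff
proof (intro conjI)
  show "wf_hgraph glued" by (rule wf_glued)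
  obtain e where "e \<in> halves G" "pairing G e \<noteq> e" using G by (auto simp: one_PI_iff)
  then show "\<exists>n\<in>halves glued. pairing glued n \<noteq> n"
    by (intro bexI[of _ "inl e"]) (simp_all add: glued_halves glued_simps(1) sum_encode_eq)
  obtain u where "u \<in> verts K" using K by (auto simp: one_PI_iff)
  then have "inr u \<in> verts glued" by (simp add: glued_verts)
  then show "verts glued \<noteq> {}" by blast
  have tG: "htype G e \<in> htypes T" "pairing G e \<noteq> e \<Longrightarrow> incid T (htype G e) = htype G (pairing G e)"
    if "e \<in> halves G" for e using G that by (auto simp: one_PI_iff)
  have tK: "htype K e \<in> htypes T" "pairing K e \<noteq> e \<Longrightarrow> incid T (htype K e) = htype K (pairing K e)"
    if "e \<in> halves K" for e using K that by (auto simp: one_PI_iff)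
  show "htype glued ` halves glued \<subseteq> htypes T"
    using tG(1) tK(1) by (auto simp: glued_halves glued_simps elim!: tag_unionE)
  show "\<forall>n\<in>halves glued. pairing glued n \<noteq> n \<longrightarrow>
      incid T (htype glued n) = htype glued (pairing glued n)"
  proof (intro ballI impI)
    fix n assume n: "n \<in> halves glued" "pairing glued n \<noteq> n"
    from n(1) show "incid T (htype glued n) = htype glued (pairing glued n)"
      unfolding glued_halves
    proof (cases rule: tag_unionE)
      case (1 e)
      then show ?thesis
        using n(2) tG(2)[of e] memG[of e] by (simp add: glued_simps(1,5) sum_encode_eq)
    next
      case (2 e)
      then show ?thesis
        using n(2) tK(2)[of e] nonext_K[OF 2(1)] by (simp add: glued_simps(2,6) sum_encode_eq)
    qed
  qed
  show "\<forall>n\<in>verts glued. vertex_type glued n \<in> vtypes T"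
    using G K glued_vertex_types by (auto simp: one_PI_iff glued_verts elim!: tag_unionE)
  show "two_connected glued" by (rule glued_two_connected)
  show "ext_type glued \<in> vtypes T \<union> etypes T"
    using G by (simp add: glued_ext_type one_PI_iff)
qed

lemma glued_embeds: "embeds K glued \<kappa> (\<lambda>u. inr u)"
  unfolding embeds_def
proof (intro conjI ballI impI)
  show "inj_on \<kappa> (halves K)" "inj_on (\<lambda>u. inr u) (verts K)"
    using inj_\<kappa> by (simp_all add: inj_on_def sum_encode_eq)
  show "\<kappa> ` halves K \<subseteq> halves glued" "(\<lambda>u. inr u) ` verts K \<subseteq> verts glued"
    using \<kappa>_mem(1) by (auto simp: glued_verts)
  show "n \<in> \<kappa> ` halves K" if "n \<in> halves glued" "src glued n \<in> (\<lambda>u. inr u) ` verts K" for n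
    using that src_inr by blast
  show "src glued (\<kappa> e) = inr (src K e)" "htype glued (\<kappa> e) = htype K e" if "e \<in> halves K" for e
    using \<kappa>_mem(2,3)[OF that] .
  show "pairing glued (\<kappa> e) = \<kappa> (pairing K e)" if "e \<in> halves K" "pairing K e \<noteq> e" for e
    using \<kappa>_mem(4)[OF that] .
  have "\<exists>e\<in>halves G. src G e = v \<and> pairing G e \<noteq> e"
  proof (cases "verts G = {v}")
    case True
    then show ?thesis using G memG(2) by (auto simp: one_PI_iff)
  next
    case False
    then have "\<exists>e. e \<in> cut G {v}"
      using G v unfolding one_PI_iff two_connected_def by blast
    then show ?thesis by (auto simp: cut_def)
  qed
  then obtain e where e: "e \<in> halves G" "src G e = v" "pairing G e \<noteq> e" by blast
  then show "\<exists>e\<in>ext_halves K. pairing glued (\<kappa> e) \<noteq> \<kappa> e"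
    using \<gamma>_mem[OF e(1,2)]
    by (intro bexI[of _ "\<gamma> e"]) (simp_all add: \<kappa>_def glued_simps(1) sum_encode_eq)
qed

end

lemma vertex_insertion_ex:
  assumes G: "one_PI T G" and K: "one_PI T K" and v: "v \<in> verts G"
    and type: "vertex_type G v = ext_type K"
  obtains B \<phi> \<psi> where "one_PI T B" "embeds K B \<phi> \<psi>"
proof -
  have "wf_hgraph G" "wf_hgraph K" using G K by (simp_all add: one_PI_iff)
  then have "finite (ext_halves K)" "finite {e \<in> halves G. src G e = v}"
    by (simp_all add: ext_halves_def wf_finite)
  then obtain \<beta> where "bij_betw \<beta> (ext_halves K) {e \<in> halves G. src G e = v}"
    "\<forall>e\<in>ext_halves K. htype G (\<beta> e) = htype K e"
    using image_mset_eq_bij[of "ext_halves K" "{e \<in> halves G. src G e = v}" "htype K" "htype G"] type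
    by (auto simp: vertex_type_def ext_type_def)
  then interpret vertex_insertion T G K v \<beta> using G K v by unfold_locales auto
  show ?thesis by (rule that[OF glued_one_PI glued_embeds])
qed


section \<open>Insertion at an edge\<close>

text \<open>For a graph \<open>P\<close> with external structure of an edge type, an irreducible graph is needed in
  which \<open>P\<close> sits on an internal edge. Three copies of \<open>P\<close>, numbered 0, 1, 2, are joined in a row by
  their external half-edges \<open>a\<close> and \<open>b\<close>. The two joining edges would be bridges; to avoid this, an
  internal edge \<open>{x, y}\<close> of \<open>P\<close> is exchanged between the copies 0 and 2, that is, \<open>x\<close> in either copy
  is paired with \<open>y\<close> in the other. The copy 1 remains intact, and the row has the same external
  structure as \<open>P\<close>.\<close>

locale edge_chain =
  fixes T :: "'h ftheory" and P :: "'h hgraph" and a b x y :: nat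
  assumes T: "feynman_theory T" and P: "one_PI T P"
    and legs: "ext_halves P = {a, b}" "a \<noteq> b" "incid T (htype P a) = htype P b"
      "incid T (htype P b) = htype P a"
    and xy: "x \<in> halves P" "pairing P x = y" "x \<noteq> y"
begin

abbreviation (input) "cp i e \<equiv> prod_encode (i, e)"

text \<open>The partner of the half-edge \<open>e\<close> in copy \<open>i\<close>.\<close>

definition chain_pairing :: "nat \<Rightarrow> nat \<Rightarrow> nat" where
  "chain_pairing i e =
     (if e \<in> {x, y} \<and> i \<noteq> 1 then cp (2 - i) (pairing P e)
      else if e = a \<and> i < 2 then cp (Suc i) b
      else if e = b \<and> 0 < i then cp (i - 1) a
      else cp i (pairing P e))"

definition chain :: "'h hgraph" where
  "chain =
     (let E = prod_encode ` ({..2} \<times> halves P) in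
      \<lparr>halves = E, verts = prod_encode ` ({..2} \<times> verts P),
       pairing = (\<lambda>n\<in>E. case prod_decode n of (i, e) \<Rightarrow> chain_pairing i e),
       src = (\<lambda>n\<in>E. case prod_decode n of (i, e) \<Rightarrow> cp i (src P e)),
       htype = (\<lambda>n\<in>E. case prod_decode n of (i, e) \<Rightarrow> htype P e)\<rparr>)"

lemma wfP: "wf_hgraph P" using P by (simp add: one_PI_iff)

lemmas memP = wf_hgraph_mem[OF wfP]

lemma legs_mem: "a \<in> halves P" "b \<in> halves P" "pairing P a = a" "pairing P b = b"
proof -
  have "a \<in> ext_halves P" "b \<in> ext_halves P" by (simp_all add: legs(1))
  then show "a \<in> halves P" "b \<in> halves P" "pairing P a = a" "pairing P b = b"
    by (simp_all add: ext_halves_def)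
qed

lemma fixed_iff: "e \<in> halves P \<Longrightarrow> pairing P e = e \<longleftrightarrow> e = a \<or> e = b"
proof -
  assume e: "e \<in> halves P"
  have "e \<in> ext_halves P \<longleftrightarrow> e = a \<or> e = b" by (simp add: legs(1))
  with e show ?thesis by (simp add: ext_halves_def)
qed

lemma xy_mem: "y \<in> halves P" "pairing P y = x"
  using memP[OF xy(1)] xy(2) by auto

lemma distinct_marks: "x \<noteq> a" "x \<noteq> b" "y \<noteq> a" "y \<noteq> b"
  using legs_mem xy xy_mem by auto

lemma chain_mem [simp]:
  "cp i e \<in> halves chain \<longleftrightarrow> i \<le> 2 \<and> e \<in> halves P"
  "cp i u \<in> verts chain \<longleftrightarrow> i \<le> 2 \<and> u \<in> verts P"
  by (auto simp: chain_def Let_def)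

lemma chain_halvesE:
  assumes "n \<in> halves chain"
  obtains i e where "i \<le> 2" "e \<in> halves P" "n = cp i e"
  using assms by (auto simp: chain_def Let_def)

lemma chain_vertsE:
  assumes "n \<in> verts chain"
  obtains i u where "i \<le> 2" "u \<in> verts P" "n = cp i u"
  using assms by (auto simp: chain_def Let_def)

lemma chain_simps [simp]:
  assumes "i \<le> 2" "e \<in> halves P"
  shows "pairing chain (cp i e) = chain_pairing i e" "src chain (cp i e) = cp i (src P e)"
    "htype chain (cp i e) = htype P e"
  using assms by (simp_all add: chain_def Let_def)

lemma index_cases: "(i::nat) \<le> 2 \<Longrightarrow> i = 0 \<or> i = 1 \<or> i = 2"
  by linarith

lemma chain_pairing_swap:
  "i \<noteq> 1 \<Longrightarrow> chain_pairing i x = cp (2 - i) y" "i \<noteq> 1 \<Longrightarrow> chain_pairing i y = cp (2 - i) x"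
  using xy xy_mem by (simp_all add: chain_pairing_def)

lemma chain_pairing_legs:
  "i < 2 \<Longrightarrow> chain_pairing i a = cp (Suc i) b" "0 < i \<Longrightarrow> chain_pairing i b = cp (i - 1) a"
  "chain_pairing 2 a = cp 2 a" "chain_pairing 0 b = cp 0 b"
  using distinct_marks legs legs_mem by (auto simp: chain_pairing_def)

lemma chain_pairing_other:
  assumes "e \<notin> {a, b}" "e \<notin> {x, y} \<or> i = 1"
  shows "chain_pairing i e = cp i (pairing P e)"
  using assms by (auto simp: chain_pairing_def)

lemma mark_cases:
  fixes i e :: nat
  assumes "i \<le> 2" "e \<in> halves P"
  obtains "e = x" "i \<noteq> 1" | "e = y" "i \<noteq> 1" | "e = a" "i < 2" | "e = b" "0 < i"
  | "e = a" "i = 2" | "e = b" "i = 0" | "e \<notin> {a, b}" "e \<notin> {x, y} \<or> i = 1"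
  using assms(1) by atomize_elim auto

lemma chain_pairing_involution:
  assumes "i \<le> 2" "e \<in> halves P"
  shows "chain_pairing i e \<in> halves chain \<and> pairing chain (chain_pairing i e) = cp i e"
  using assms
proof (cases rule: mark_cases)
  case 7
  have n: "pairing P e \<noteq> e" using 7 fixed_iff[OF assms(2)] by simp
  have "pairing P e \<notin> {a, b}"
    using n memP(1,3)[OF assms(2)] legs_mem by (metis insertE singletonD)
  moreover have "pairing P e \<notin> {x, y} \<or> i = 1"
    using 7(2) memP(3)[OF assms(2)] xy(2) xy_mem(2) by (metis insertCI insertE singletonD)
  ultimately show ?thesis
    using assms memP[OF assms(2)] by (simp add: chain_pairing_other[OF 7] chain_pairing_other)
next
  case 1
  then show ?thesis using assms xy xy_mem index_cases[OF assms(1)]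
    by (auto simp: chain_pairing_swap)
next
  case 2
  then show ?thesis using assms xy xy_mem index_cases[OF assms(1)]
    by (auto simp: chain_pairing_swap)
qed (use assms(1) legs_mem in \<open>auto simp: chain_pairing_legs\<close>)

lemma wf_chain: "wf_hgraph chain"
  unfolding wf_hgraph_def
proof (intro conjI ballI)
  show "finite (halves chain)" "finite (verts chain)"
    using wf_finite[OF wfP] by (simp_all add: chain_def Let_def)
  have p: "pairing chain n \<in> halves chain \<and> src chain n \<in> verts chain \<and>
      pairing chain (pairing chain n) = n" if n: "n \<in> halves chain" for n
  proof -
    obtain i e where "i \<le> 2" "e \<in> halves P" "n = cp i e" by (rule chain_halvesE[OF n])
    then show ?thesis using chain_pairing_involution[of i e] memP by simp
  qed
  show "pairing chain \<in> halves chain \<rightarrow>\<^sub>E halves chain"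
    using p by (intro PiE_I) (auto, auto simp: chain_def Let_def)
  show "src chain \<in> halves chain \<rightarrow>\<^sub>E verts chain"
    using p by (intro PiE_I) (auto, auto simp: chain_def Let_def)
  show "pairing chain (pairing chain n) = n" if "n \<in> halves chain" for n using p that by blast
  show "htype chain \<in> extensional (halves chain)" by (simp add: chain_def Let_def)
qed

lemma chain_vertex_type:
  assumes "i \<le> 2"
  shows "vertex_type chain (cp i u) = vertex_type P u"
proof -
  have "bij_betw (\<lambda>e. cp i e) {e \<in> halves P. src P e = u} {n \<in> halves chain. src chain n = cp i u}"
  proof (rule bij_betw_imageI)
    show "(\<lambda>e. cp i e) ` {e \<in> halves P. src P e = u} = {n \<in> halves chain. src chain n = cp i u}"
      using assms by (auto elim!: chain_halvesE)
  qed (simp add: inj_on_def)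
  then show ?thesis
    unfolding vertex_type_def by (rule image_mset_bij) (use assms in simp)
qed

lemma chain_ext: "ext_halves chain = {cp 0 b, cp 2 a}"
proof (intro equalityI subsetI)
  fix n assume "n \<in> ext_halves chain"
  then have n: "n \<in> halves chain" "pairing chain n = n" by (simp_all add: ext_halves_def)
  obtain i e where e: "i \<le> 2" "e \<in> halves P" "n = cp i e" by (rule chain_halvesE[OF n(1)])
  then have f: "chain_pairing i e = cp i e" using n(2) by simp
  from e(1,2) show "n \<in> {cp 0 b, cp 2 a}"
  proof (cases rule: mark_cases)
    case 7
    then show ?thesis using f fixed_iff[OF e(2)] by (simp add: chain_pairing_other)
  qed (use e f xy in \<open>auto simp: chain_pairing_swap chain_pairing_legs\<close>)
qed (use legs_mem in \<open>auto simp: ext_halves_def chain_pairing_legs\<close>)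

lemma chain_ext_type: "ext_type chain = ext_type P"
  using legs legs_mem by (simp add: ext_type_def chain_ext add_mset_commute)

text \<open>The part of a set of vertices in copy \<open>i\<close>.\<close>

definition slice :: "nat set \<Rightarrow> nat \<Rightarrow> nat set" where
  "slice W i = {u \<in> verts P. cp i u \<in> W}"

lemma cut_slice:
  assumes "i \<le> 2" "e \<in> cut P (slice W i)" "e \<notin> {x, y} \<or> i = 1"
  shows "cp i e \<in> cut chain W"
proof -
  have e: "e \<in> halves P" "src P e \<in> slice W i" "src P (pairing P e) \<notin> slice W i"
    using assms(2) by (simp_all add: cut_def)
  then have "e \<notin> {a, b}" using legs_mem by auto
  then have "chain_pairing i e = cp i (pairing P e)" by (rule chain_pairing_other[OF _ assms(3)])
  then show ?thesis
    using e assms(1) memP(1)[OF e(1)] memP(2)[OF memP(1)[OF e(1)]] by (simp add: cut_def slice_def)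
qed

lemma cut_swap:
  assumes "i = 0 \<or> i = 2" "e = x \<or> e = y" "src P e \<in> slice W i" "src P (pairing P e) \<notin> slice W (2 - i)"
  shows "cp i e \<in> cut chain W"
proof -
  have e: "e \<in> halves P" "i \<le> 2" using assms(1,2) xy xy_mem by auto
  have "chain_pairing i e = cp (2 - i) (pairing P e)"
    using assms(1,2) xy xy_mem by (auto simp: chain_pairing_def)
  then show ?thesis
    using e assms(3,4) memP(1)[OF e(1)] memP(2)[OF memP(1)[OF e(1)]]
    by (simp add: cut_def slice_def)
qed

lemma cut_leg:
  assumes "i \<le> 2" "e = a \<and> i < 2 \<and> j = Suc i \<or> e = b \<and> i = Suc j"
    "slice W i = verts P" "slice W j = {}"
  shows "cp i e \<in> cut chain W"
proof -
  have e: "e \<in> halves P" using assms(2) legs_mem by auto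
  have all: "cp i u \<in> W" "cp j u \<notin> W" if "u \<in> verts P" for u
    using assms(3,4) that by (auto simp: slice_def)
  show ?thesis
    using assms(1,2) e all memP(2) legs_mem by (auto simp: cut_def chain_pairing_legs)
qed

text \<open>A set \<open>W\<close> that meets a copy properly is left there by two half-edges of the intact \<open>P\<close>, and one of
  them may be lost to the exchange. If so, a replacement is found from copy \<open>2 - i\<close>: either \<open>W\<close> meets
  that copy properly too, or an exchanged edge leaves \<open>W\<close>. If \<open>W\<close> is a union of copies, two of the
  exchanged or of the joining edges leave it.\<close>

lemma chain_two_connected: "two_connected chain"
  unfolding two_connected_def
proof (intro allI impI)
  fix W assume W: "W \<subseteq> verts chain" "W \<noteq> {}" "W \<noteq> verts chain"
  let ?S = "slice W"
  have tc: "\<exists>e\<in>cut P (?S i). \<exists>e'\<in>cut P (?S i). e \<noteq> e'" if "?S i \<noteq> {}" "?S i \<noteq> verts P" for i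
  proof -
    have "?S i \<subseteq> verts P" by (auto simp: slice_def)
    then show ?thesis using P that unfolding one_PI_iff two_connected_def by meson
  qed
  show "\<exists>e\<in>cut chain W. \<exists>e'\<in>cut chain W. e \<noteq> e'"
  proof (cases "\<exists>i\<le>2. ?S i \<noteq> {} \<and> ?S i \<noteq> verts P")
    case True
    then obtain i where i: "i \<le> 2" "?S i \<noteq> {}" "?S i \<noteq> verts P" by blast
    obtain c c' where c: "c \<in> cut P (?S i)" "c' \<in> cut P (?S i)" "c \<noteq> c'"
      using tc[OF i(2,3)] by blast
    \<comment> \<open>At most one of the two halves of the exchanged edge leaves a given slice.\<close>
    have one: "d' \<notin> {x, y}" if "d \<in> {x, y}" "d \<in> cut P (?S k)" "d' \<in> cut P (?S k)" "d \<noteq> d'" for d d' k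
      using that xy xy_mem by (auto simp: cut_def)
    show ?thesis
    proof (cases "i = 1 \<or> c \<notin> {x, y} \<and> c' \<notin> {x, y}")
      case True
      then have "cp i c \<in> cut chain W" "cp i c' \<in> cut chain W"
        using cut_slice[OF i(1)] c by blast+
      then show ?thesis using c(3) by (metis prod.inject prod_encode_eq)
    next
      case False
      obtain d d' where d: "d \<in> cut P (?S i)" "d' \<in> cut P (?S i)" "d \<noteq> d'" "d \<in> {x, y}"
        using c False by (cases "c \<in> {x, y}") auto
      have i': "i = 0 \<or> i = 2" using False index_cases[OF i(1)] by blast
      let ?j = "2 - i"
      have j: "?j \<le> 2" "?j \<noteq> i" "2 - ?j = i" using i' by auto
      have d': "cp i d' \<in> cut chain W"
        using cut_slice[OF i(1) d(2)] one[OF d(4) d(1,2,3)] by blast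
      have dm: "src P d \<in> ?S i" "src P (pairing P d) \<notin> ?S i" "d \<in> halves P"
        using d(1) by (simp_all add: cut_def)
      consider "?S ?j = {}" | "?S ?j = verts P" | "?S ?j \<noteq> {}" "?S ?j \<noteq> verts P" by blast
      then show ?thesis
      proof cases
        case 1
        then have "cp i d \<in> cut chain W" using cut_swap[OF i', of d W] d(4) dm by auto
        then show ?thesis using d' d(3) by (metis prod.inject prod_encode_eq)
      next
        case 2
        then have "cp ?j d \<in> cut chain W"
          using cut_swap[of ?j d W] i' d(4) dm(2) memP(2)[OF dm(3)] j(3) by auto
        then show ?thesis using d' j(2) by (metis prod.inject prod_encode_eq)
      next
        case 3
        obtain f f' where f: "f \<in> cut P (?S ?j)" "f' \<in> cut P (?S ?j)" "f \<noteq> f'"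
          using tc[OF 3] by blast
        then obtain g where "g \<in> cut P (?S ?j)" "g \<notin> {x, y}" using one[of f ?j f'] by blast
        then have "cp ?j g \<in> cut chain W" using cut_slice[OF j(1)] by blast
        then show ?thesis using d' j(2) by (metis prod.inject prod_encode_eq)
      qed
    qed
  next
    case False
    then have triv: "?S i = {} \<or> ?S i = verts P" if "i \<le> 2" for i using that by blast
    have ne: "verts P \<noteq> {}" using P by (simp add: one_PI_iff)
    obtain n where n: "n \<in> W" using W(2) by blast
    then obtain i u where "i \<le> 2" "u \<in> verts P" "n = cp i u" using chain_vertsE W(1) by blast
    then have "?S i \<noteq> {}" "i \<le> 2" using n by (auto simp: slice_def)
    then have some: "?S 0 = verts P \<or> ?S 1 = verts P \<or> ?S 2 = verts P"
      using triv index_cases[of i] by metis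
    obtain n' where n': "n' \<in> verts chain" "n' \<notin> W" using W(1,3) by blast
    obtain j w where "j \<le> 2" "w \<in> verts P" "n' = cp j w" by (rule chain_vertsE[OF n'(1)])
    then have "?S j \<noteq> verts P" "j \<le> 2" using n'(2) by (auto simp: slice_def)
    then have some': "?S 0 = {} \<or> ?S 1 = {} \<or> ?S 2 = {}"
      using triv index_cases[of j] by metis
    have sw: ?thesis if "i = 0 \<or> i = 2" "?S i = verts P" "?S (2 - i) = {}" for i
    proof -
      have "cp i x \<in> cut chain W" "cp i y \<in> cut chain W"
        using cut_swap[OF that(1), of x W] cut_swap[OF that(1), of y W] that(2,3) xy xy_mem memP(2)
        by auto
      then show ?thesis using xy(3) by (metis prod.inject prod_encode_eq)
    qed
    consider "?S 0 = verts P" "?S 2 = {}" | "?S 2 = verts P" "?S 0 = {}"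
      | "?S 1 = verts P" "?S 0 = {}" "?S 2 = {}" | "?S 1 = {}" "?S 0 = verts P" "?S 2 = verts P"
      using some some' triv[of 0] triv[of 1] triv[of 2] ne by auto
    then show ?thesis
    proof cases
      case 1 then show ?thesis using sw[of 0] by simp
    next
      case 2 then show ?thesis using sw[of 2] by simp
    next
      case 3
      then have "cp 1 a \<in> cut chain W" "cp 1 b \<in> cut chain W"
        using cut_leg[of 1 a 2 W] cut_leg[of 1 b 0 W] by simp_all
      then show ?thesis using legs(2) by (metis prod.inject prod_encode_eq)
    next
      case 4
      then have "cp 0 a \<in> cut chain W" "cp 2 b \<in> cut chain W"
        using cut_leg[of 0 a 1 W] cut_leg[of 2 b 1 W] by simp_all
      then show ?thesis using legs(2) by (metis prod.inject prod_encode_eq)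
    qed
  qed
qed

lemma chain_one_PI: "one_PI T chain"
  unfolding one_PI_iff
proof (intro conjI)
  show "wf_hgraph chain" by (rule wf_chain)
  show "\<exists>n\<in>halves chain. pairing chain n \<noteq> n"
    using legs_mem by (intro bexI[of _ "cp 0 a"]) (simp_all add: chain_pairing_legs)
  obtain u where "u \<in> verts P" using P by (auto simp: one_PI_iff)
  then have "cp 0 u \<in> verts chain" by simp
  then show "verts chain \<noteq> {}" by blast
  show "htype chain ` halves chain \<subseteq> htypes T"
    using P by (auto simp: one_PI_iff elim!: chain_halvesE)
  have inc: "incid T (htype P e) = htype P (pairing P e)" if "e \<in> halves P" "pairing P e \<noteq> e" for e
    using P that by (simp add: one_PI_iff)
  show "\<forall>n\<in>halves chain. pairing chain n \<noteq> n \<longrightarrow>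
      incid T (htype chain n) = htype chain (pairing chain n)"
  proof (intro ballI impI)
    fix n assume n: "n \<in> halves chain" "pairing chain n \<noteq> n"
    obtain i e where e: "i \<le> 2" "e \<in> halves P" "n = cp i e" by (rule chain_halvesE[OF n(1)])
    from e(1,2) show "incid T (htype chain n) = htype chain (pairing chain n)"
    proof (cases rule: mark_cases)
      case 7
      then show ?thesis
        using e inc[OF e(2)] fixed_iff[OF e(2)] memP(1)[OF e(2)] by (simp add: chain_pairing_other)
    next
      case 1
      then show ?thesis using e inc[OF xy(1)] xy xy_mem by (simp add: chain_pairing_swap)
    next
      case 2
      then show ?thesis using e inc[OF xy_mem(1)] xy xy_mem by (simp add: chain_pairing_swap)
    qed (use n e legs legs_mem in \<open>auto simp: chain_pairing_legs\<close>)
  qed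
  show "\<forall>n\<in>verts chain. vertex_type chain n \<in> vtypes T"
    using P by (auto simp: one_PI_iff chain_vertex_type elim!: chain_vertsE)
  show "two_connected chain" by (rule chain_two_connected)
  show "ext_type chain \<in> vtypes T \<union> etypes T"
    using P by (simp add: chain_ext_type one_PI_iff)
qed

lemma chain_embeds: "embeds P chain (\<lambda>e. cp 1 e) (\<lambda>u. cp 1 u)"
  unfolding embeds_def
proof (intro conjI ballI impI)
  show "inj_on (\<lambda>e. cp 1 e) (halves P)" "inj_on (\<lambda>u. cp 1 u) (verts P)"
    by (simp_all add: inj_on_def)
  show "(\<lambda>e. cp 1 e) ` halves P \<subseteq> halves chain" "(\<lambda>u. cp 1 u) ` verts P \<subseteq> verts chain"
    by auto
  show "src chain (cp 1 e) = cp 1 (src P e)" "htype chain (cp 1 e) = htype P e"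
    if "e \<in> halves P" for e using that by simp_all
  show "pairing chain (cp 1 e) = cp 1 (pairing P e)"
    if "e \<in> halves P" "pairing P e \<noteq> e" for e
    using that fixed_iff[OF that(1)] by (simp add: chain_pairing_other)
  show "n \<in> (\<lambda>e. cp 1 e) ` halves P" if "n \<in> halves chain" "src chain n \<in> (\<lambda>u. cp 1 u) ` verts P" for n
    using that by (auto elim!: chain_halvesE)
  show "\<exists>e\<in>ext_halves P. pairing chain (cp 1 e) \<noteq> cp 1 e"
    using legs_mem by (intro bexI[of _ a]) (simp_all add: chain_pairing_legs legs(1))
qed

end

lemma edge_insertion_ex:
  assumes T: "feynman_theory T" and P: "one_PI T P" and ext: "ext_type P \<in> etypes T"
  obtains B \<phi> \<psi> where "one_PI T B" "embeds P B \<phi> \<psi>"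
proof -
  have "card (ext_halves P) = 2" using ext size_ext_type[of P] by (auto simp: etypes_def)
  then obtain a b where ab: "ext_halves P = {a, b}" "a \<noteq> b" by (auto simp: card_2_iff)
  obtain t where t: "t \<in> htypes T" "ext_type P = {#t, incid T t#}" using ext by (auto simp: etypes_def)
  have "{#htype P a, htype P b#} = {#t, incid T t#}" using t(2) ab by (simp add: ext_type_def)
  moreover have "incid T (incid T t) = t" using T t(1) by (simp add: feynman_theory_def)
  ultimately have i: "incid T (htype P a) = htype P b" "incid T (htype P b) = htype P a"
    by (auto simp: pair_mset_eq)
  obtain x where x: "x \<in> halves P" "pairing P x \<noteq> x" using P by (auto simp: one_PI_iff)
  interpret edge_chain T P a b x "pairing P x"
    using T P ab i x by unfold_locales auto
  show ?thesis by (rule that[OF chain_one_PI chain_embeds])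
qed


section \<open>Additive functions on vectors of counts\<close>

lemma pm_scale_single: "pm_scale c (Poly_Mapping.single i d) = Poly_Mapping.single i (c * d)"
  by (rule poly_mapping_eqI) (simp add: lookup_pm_scale lookup_single when_def)

text \<open>An additive function of finitely many natural-number counts, defined only on a semigroup of
  count vectors, is the restriction of a rational linear form.\<close>

lemma additive_imp_linear:
  fixes v :: "'g \<Rightarrow> 'i \<Rightarrow> nat" and g :: "'g \<Rightarrow> rat"
  assumes I: "finite I"
    and add: "\<And>a b. a \<in> A \<Longrightarrow> b \<in> A \<Longrightarrow>
      \<exists>c\<in>A. g c = g a + g b \<and> (\<forall>i\<in>I. v c i = v a i + v b i)"
    and dep: "\<And>a b. a \<in> A \<Longrightarrow> b \<in> A \<Longrightarrow> (\<forall>i\<in>I. v a i = v b i) \<Longrightarrow> g a = g b"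
  shows "\<exists>c. \<forall>a\<in>A. g a = (\<Sum>i\<in>I. c i * of_nat (v a i))"
proof -
  \<comment> \<open>The count vector of \<open>a\<close>, in the rational vector space with basis \<open>I\<close>.\<close>
  define w :: "'g \<Rightarrow> ('i \<Rightarrow>\<^sub>0 rat)"
    where "w a = (\<Sum>i\<in>I. Poly_Mapping.single i (of_nat (v a i)))" for a
  have lw: "Poly_Mapping.lookup (w a) i = (if i \<in> I then of_nat (v a i) else 0)" for a i
    using I by (simp add: w_def lookup_sum lookup_single when_def if_distrib sum.delta cong: if_cong)
  have w_eq: "g a = g b" if "a \<in> A" "b \<in> A" "w a = w b" for a b
  proof (rule dep[OF that(1,2)], rule ballI)
    fix i assume "i \<in> I"
    then show "v a i = v b i"
      using arg_cong[OF that(3), of "\<lambda>x. Poly_Mapping.lookup x i"] by (simp add: lw)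
  qed
  have plus: "\<exists>c\<in>A. g c = g a + g b \<and> w c = w a + w b" if ab: "a \<in> A" "b \<in> A" for a b
  proof -
    obtain c where c: "c \<in> A" "g c = g a + g b" "\<forall>i\<in>I. v c i = v a i + v b i"
      using add[OF ab] by blast
    then have "w c = w a + w b" by (intro poly_mapping_eqI) (simp add: lw lookup_add)
    with c show ?thesis by blast
  qed
  have mult: "\<exists>c\<in>A. g c = of_nat (Suc n) * g a \<and> w c = pm_scale (of_nat (Suc n)) (w a)"
    if a: "a \<in> A" for n a
  proof (induction n)
    case 0
    show ?case using a by (intro bexI[of _ a]) (simp_all add: pm.scale_one)
  next
    case (Suc n)
    then obtain c where c: "c \<in> A" "g c = of_nat (Suc n) * g a" "w c = pm_scale (of_nat (Suc n)) (w a)"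
      by blast
    obtain d where "d \<in> A" "g d = g c + g a" "w d = w c + w a" using plus[OF c(1) a] by blast
    moreover have "pm_scale (of_nat (Suc (Suc n))) (w a) = pm_scale (of_nat (Suc n)) (w a) + w a"
      unfolding of_nat_Suc[of "Suc n"] by (simp only: pm.scale_left_distrib pm.scale_one add.commute)
    ultimately show ?case
      using c by (intro bexI[of _ d]) (simp_all add: algebra_simps del: of_nat_Suc, simp add: algebra_simps)
  qed
  obtain B where B: "B \<subseteq> w ` A" "pm.independent B" "w ` A \<subseteq> pm.span B"
    using pm.maximal_independent_subset by blast
  interpret L: vector_space_pair "pm_scale :: rat \<Rightarrow> ('i \<Rightarrow>\<^sub>0 rat) \<Rightarrow> _" "(*) :: rat \<Rightarrow> rat \<Rightarrow> rat"
    by unfold_locales (simp_all add: algebra_simps)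
  obtain l where l: "Vector_Spaces.linear pm_scale (*) l" "\<forall>x\<in>B. l x = g (inv_into A w x)"
    using L.linear_independent_extend[OF B(2), of "\<lambda>x. g (inv_into A w x)"] by blast
  note l_add = L.linear_add[OF l(1)] and l_scale = L.linear_scale[OF l(1)]
    and l_0 = L.linear_0[OF l(1)] and l_sum = L.linear_sum[OF l(1)]
  have l_B: "l (w a) = g a" if "a \<in> A" "w a \<in> B" for a
  proof -
    have "w a \<in> w ` A" using that by blast
    then have "inv_into A w (w a) \<in> A" "w (inv_into A w (w a)) = w a"
      by (rule inv_into_into, rule f_inv_into_f)
    then show ?thesis using w_eq[OF _ that(1)] l(2) that(2) by auto
  qed
  have l_w: "l (w a) = g a" if a: "a \<in> A" for a
  proof -
    \<comment> \<open>Every vector in the span has a positive multiple that is a difference of count vectors.\<close>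
    define S where "S = {x. \<exists>n. \<exists>p\<in>A. \<exists>q\<in>A. pm_scale (of_nat (Suc n)) x + w q = w p \<and>
      of_nat (Suc n) * l x + g q = g p}"
    have S_pos: "pm_scale (of_nat m / of_nat (Suc k)) x \<in> S" if x: "x \<in> S" for x m k
    proof (cases m)
      case 0
      then show ?thesis using a by (auto simp: S_def l_0)
    next
      case (Suc m')
      obtain n p q where npq: "p \<in> A" "q \<in> A" "pm_scale (of_nat (Suc n)) x + w q = w p"
        "of_nat (Suc n) * l x + g q = g p" using x unfolding S_def by blast
      obtain p' where p': "p' \<in> A" "g p' = of_nat m * g p" "w p' = pm_scale (of_nat m) (w p)"
        using mult[OF npq(1), of m'] Suc by auto
      obtain q' where q': "q' \<in> A" "g q' = of_nat m * g q" "w q' = pm_scale (of_nat m) (w q)"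
        using mult[OF npq(2), of m'] Suc by auto
      have k: "of_nat (Suc ((Suc n) * (Suc k) - 1)) = (of_nat (Suc n) * of_nat (Suc k) :: rat)"
        by (simp del: of_nat_Suc flip: of_nat_mult)
      have cancel: "N * c * (d / c * u) + d * s = d * (N * u + s)" if "c \<noteq> 0" for N c d u s :: rat
      proof -
        have "c * (d / c * u) = d * u" using that by simp
        then have "N * c * (d / c * u) = N * (d * u)" by (simp only: mult.assoc)
        then show ?thesis by (simp only: distrib_left mult.left_commute)
      qed
      have k0: "(of_nat (Suc k) :: rat) \<noteq> 0" by (simp del: of_nat_Suc)
      have "pm_scale (of_nat (Suc n) * of_nat (Suc k)) (pm_scale (of_nat m / of_nat (Suc k)) x) + w q' = w p'"
        unfolding p'(3) q'(3) npq(3)[symmetric] pm.scale_scale pm.scale_right_distrib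
        using k0 by (simp add: mult.commute del: of_nat_Suc)
      moreover have "of_nat (Suc n) * of_nat (Suc k) * l (pm_scale (of_nat m / of_nat (Suc k)) x) + g q' = g p'"
        unfolding p'(2) q'(2) npq(4)[symmetric] l_scale by (rule cancel[OF k0])
      ultimately show ?thesis
        unfolding S_def using p'(1) q'(1) k
        by (intro CollectI exI[of _ "(Suc n) * (Suc k) - 1"] bexI[of _ p'] bexI[of _ q']) auto
    qed
    have S_minus: "- x \<in> S" if x: "x \<in> S" for x
    proof -
      obtain n p q where npq: "p \<in> A" "q \<in> A" "pm_scale (of_nat (Suc n)) x + w q = w p"
        "of_nat (Suc n) * l x + g q = g p" using x unfolding S_def by blast
      have "l (- x) = - l x" using l_scale[of "-1" x] by simp
      then have "pm_scale (of_nat (Suc n)) (- x) + w p = w q \<and> of_nat (Suc n) * l (- x) + g p = g q"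
        unfolding npq(3,4)[symmetric] by (simp del: of_nat_Suc)
      then show ?thesis unfolding S_def using npq(1,2) by blast
    qed
    have "pm.subspace S"
    proof (rule pm.subspaceI)
      show "0 \<in> S" using S_pos[of _ 0 0] a unfolding S_def
        by (auto simp: l_0)
    next
      fix x y assume "x \<in> S" "y \<in> S"
      then obtain n p q n' p' q' where
        1: "p \<in> A" "q \<in> A" "pm_scale (of_nat (Suc n)) x + w q = w p" "of_nat (Suc n) * l x + g q = g p"
        and 2: "p' \<in> A" "q' \<in> A" "pm_scale (of_nat (Suc n')) y + w q' = w p'"
          "of_nat (Suc n') * l y + g q' = g p'"
        unfolding S_def by blast
      obtain p1 where p1: "p1 \<in> A" "g p1 = of_nat (Suc n') * g p" "w p1 = pm_scale (of_nat (Suc n')) (w p)"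
        using mult[OF 1(1)] by blast
      obtain q1 where q1: "q1 \<in> A" "g q1 = of_nat (Suc n') * g q" "w q1 = pm_scale (of_nat (Suc n')) (w q)"
        using mult[OF 1(2)] by blast
      obtain p2 where p2: "p2 \<in> A" "g p2 = of_nat (Suc n) * g p'" "w p2 = pm_scale (of_nat (Suc n)) (w p')"
        using mult[OF 2(1)] by blast
      obtain q2 where q2: "q2 \<in> A" "g q2 = of_nat (Suc n) * g q'" "w q2 = pm_scale (of_nat (Suc n)) (w q')"
        using mult[OF 2(2)] by blast
      obtain P where P: "P \<in> A" "g P = g p1 + g p2" "w P = w p1 + w p2" using plus p1(1) p2(1) by blast
      obtain Q where Q: "Q \<in> A" "g Q = g q1 + g q2" "w Q = w q1 + w q2" using plus q1(1) q2(1) by blast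
      have k: "of_nat (Suc ((Suc n) * (Suc n') - 1)) = (of_nat (Suc n) * of_nat (Suc n') :: rat)"
        by (simp del: of_nat_Suc flip: of_nat_mult)
      have expand: "N * N' * (u + u') + (N' * s + N * s') = N' * (N * u + s) + N * (N' * u' + s')"
        for N N' u u' s s' :: rat by (simp only: distrib_left mult_ac add_ac)
      have "pm_scale (of_nat (Suc n) * of_nat (Suc n')) (x + y) + w Q = w P"
        unfolding P(3) Q(3) p1(3) p2(3) q1(3) q2(3) 1(3)[symmetric] 2(3)[symmetric]
          pm.scale_right_distrib pm.scale_scale
        by (simp add: mult.commute add.assoc add.left_commute del: of_nat_Suc)
      moreover have "of_nat (Suc n) * of_nat (Suc n') * l (x + y) + g Q = g P"
        unfolding P(2) Q(2) p1(2) p2(2) q1(2) q2(2) 1(4)[symmetric] 2(4)[symmetric] l_add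
        by (rule expand)
      ultimately show "x + y \<in> S"
        unfolding S_def using P(1) Q(1) k
        by (intro CollectI exI[of _ "(Suc n) * (Suc n') - 1"] bexI[of _ P] bexI[of _ Q]) auto
    next
      fix r :: rat and x assume x: "x \<in> S"
      obtain m n where r: "r = of_int m / of_int n" "n > 0" by (cases r) (auto simp: Fract_of_int_quotient)
      obtain k where k: "n = int (Suc k)" using r(2) by (metis gr0_implies_Suc pos_int_cases)
      show "pm_scale r x \<in> S"
      proof (cases "m \<ge> 0")
        case True
        then have "r = of_nat (nat m) / of_nat (Suc k)" by (simp add: r(1) k)
        then show ?thesis using S_pos[OF x] by metis
      next
        case False
        then have "- r = of_nat (nat (- m)) / of_nat (Suc k)" by (simp add: r(1) k)
        then have "pm_scale (- r) x \<in> S" using S_pos[OF x] by metis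
        then show ?thesis using S_minus[of "pm_scale (- r) x"] by simp
      qed
    qed
    moreover have "B \<subseteq> S"
    proof
      fix x assume x: "x \<in> B"
      then obtain b where b: "b \<in> A" "x = w b" using B(1) by blast
      obtain c where "c \<in> A" "g c = g b + g b" "w c = w b + w b" using plus[OF b(1) b(1)] by blast
      then show "x \<in> S"
        unfolding S_def using b x l_B[OF b(1)]
        by (intro CollectI exI[of _ 0] bexI[of _ c] bexI[of _ b]) (auto simp: pm.scale_one)
    qed
    ultimately have "pm.span B \<subseteq> S" by (rule pm.span_minimal[rotated])
    then have "w a \<in> S" using B(3) a by blast
    then obtain n p q where npq: "p \<in> A" "q \<in> A" "pm_scale (of_nat (Suc n)) (w a) + w q = w p"
      "of_nat (Suc n) * l (w a) + g q = g p" unfolding S_def by blast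
    obtain c where c: "c \<in> A" "g c = of_nat (Suc n) * g a" "w c = pm_scale (of_nat (Suc n)) (w a)"
      using mult[OF a] by blast
    obtain d where d: "d \<in> A" "g d = g c + g q" "w d = w c + w q" using plus[OF c(1) npq(2)] by blast
    have "g d = g p" using w_eq[OF d(1) npq(1)] npq(3) c(3) d(3) by simp
    then have "of_nat (Suc n) * l (w a) = g c" using npq(4) d(2) by (metis add_right_cancel)
    then show ?thesis unfolding c(2) by (simp del: of_nat_Suc)
  qed
  show ?thesis
  proof (intro exI ballI)
    fix a assume a: "a \<in> A"
    have "w a = (\<Sum>i\<in>I. pm_scale (of_nat (v a i)) (Poly_Mapping.single i 1))"
      by (simp add: w_def pm_scale_single)
    then have "l (w a) = (\<Sum>i\<in>I. of_nat (v a i) * l (Poly_Mapping.single i 1))"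
      by (simp add: l_sum l_scale)
    then show "g a = (\<Sum>i\<in>I. l (Poly_Mapping.single i 1) * of_nat (v a i))"
      using l_w[OF a] by (simp add: mult.commute)
  qed
qed


section \<open>Graduations given by a degree of graphs\<close>

lemma same_graph_refl: "wf_hgraph G \<Longrightarrow> same_graph G G"
  by (simp add: same_graph_def graph_iso_refl)

lemma iso_class_eq_iff:
  "wf_hgraph G \<Longrightarrow> wf_hgraph H \<Longrightarrow> iso_class G = iso_class H \<longleftrightarrow> same_graph G H"
  using Quotient_rel[OF Quotient_fgraph, of G H] same_graph_refl by blast

lemma same_graph_rep: "wf_hgraph G \<Longrightarrow> same_graph (rep_fgraph (iso_class G)) G"
  by (rule Quotient_rep_abs[OF Quotient_fgraph same_graph_refl])

lemma iso_class_plus: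
  "wf_hgraph G \<Longrightarrow> wf_hgraph H \<Longrightarrow> iso_class G + iso_class H = iso_class (disj_union G H)"
  by (simp add: plus_fgraph.abs_eq same_graph_refl)

lemma same_graph_feynman:
  assumes "same_graph G H" "feynman T G"
  shows "feynman T H"
  using same_graphE[OF assms(1)] graph_isomorphism.feynman_iso assms(2) by metis

lemma span_single:
  "pm.span ((\<lambda>i. Poly_Mapping.single i (1::'k::field)) ` I) = {x. Poly_Mapping.keys x \<subseteq> I}"
proof (intro equalityI subsetI)
  fix x assume "x \<in> pm.span ((\<lambda>i. Poly_Mapping.single i (1::'k)) ` I)"
  moreover have "pm.subspace {x :: _ \<Rightarrow>\<^sub>0 'k. Poly_Mapping.keys x \<subseteq> I}"
  proof (rule pm.subspaceI)
    show "x + y \<in> {x :: _ \<Rightarrow>\<^sub>0 'k. Poly_Mapping.keys x \<subseteq> I}"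
      if "x \<in> {x. Poly_Mapping.keys x \<subseteq> I}" "y \<in> {x. Poly_Mapping.keys x \<subseteq> I}" for x y
      using that keys_add[of x y] by blast
    show "pm_scale c x \<in> {x. Poly_Mapping.keys x \<subseteq> I}"
      if "x \<in> {x. Poly_Mapping.keys x \<subseteq> I}" for c :: 'k and x
      using that by (auto simp: in_keys_iff lookup_pm_scale)
  qed simp
  moreover have "(\<lambda>i. Poly_Mapping.single i (1::'k)) ` I \<subseteq> {x. Poly_Mapping.keys x \<subseteq> I}" by auto
  ultimately show "x \<in> {x. Poly_Mapping.keys x \<subseteq> I}" using pm.span_minimal by blast
next
  fix x :: "_ \<Rightarrow>\<^sub>0 'k" assume x: "x \<in> {x. Poly_Mapping.keys x \<subseteq> I}"
  have "x = (\<Sum>i\<in>Poly_Mapping.keys x. pm_scale (Poly_Mapping.lookup x i) (Poly_Mapping.single i 1))"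
    by (rule poly_mapping_eqI)
       (auto simp: pm_scale_single lookup_sum lookup_single when_def sum.delta in_keys_iff)
  also have "\<dots> \<in> pm.span ((\<lambda>i. Poly_Mapping.single i 1) ` I)"
    using x by (intro pm.span_sum pm.span_scale pm.span_base) auto
  finally show "x \<in> pm.span ((\<lambda>i. Poly_Mapping.single i 1) ` I)" .
qed

lemma lookup_tensor:
  "Poly_Mapping.lookup (tensor y z) (p, q) = Poly_Mapping.lookup y p * Poly_Mapping.lookup z q"
proof -
  have "(\<Sum>b\<in>Poly_Mapping.keys z. Poly_Mapping.lookup y a * Poly_Mapping.lookup z b when (a, b) = (p, q))
      = (Poly_Mapping.lookup y a * Poly_Mapping.lookup z q when a = p)" for a
    by (cases "a = p") (auto simp: when_def sum.delta in_keys_iff)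
  then show ?thesis
    by (auto simp: tensor_def lookup_sum lookup_single when_def sum.delta in_keys_iff)
qed

lemma keys_tensor: "Poly_Mapping.keys (tensor y z) \<subseteq> Poly_Mapping.keys y \<times> Poly_Mapping.keys z"
  by (auto simp: in_keys_iff lookup_tensor)

lemma tensor_single:
  "tensor (Poly_Mapping.single p 1) (Poly_Mapping.single q (1::'k::field)) = Poly_Mapping.single (p, q) 1"
  by (rule poly_mapping_eqI) (auto simp: lookup_tensor lookup_single when_def split: prod.splits if_splits)

lemma graded_part_eq:
  "graded_part T deg a = {x :: _ \<Rightarrow>\<^sub>0 'k::field.
     Poly_Mapping.keys x \<subseteq> iso_class ` {G. feynman T G \<and> deg G = a}}"
  unfolding graded_part_def span_single[symmetric]
  by (rule arg_cong[of _ _ pm.span]) (auto simp: basis_vec_def)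

lemma span_tensors:
  "pm.span {tensor y z | y z b c. y \<in> {x. Poly_Mapping.keys x \<subseteq> K b} \<and>
      z \<in> {x. Poly_Mapping.keys x \<subseteq> K' c} \<and> R b c}
    = {x :: _ \<Rightarrow>\<^sub>0 'k::field. Poly_Mapping.keys x \<subseteq> (\<Union>(b, c)\<in>{(b, c). R b c}. K b \<times> K' c)}"
    (is "pm.span ?S = ?R")
proof
  have "?S \<subseteq> ?R" using keys_tensor by fastforce
  moreover have "pm.subspace ?R" unfolding span_single[symmetric] by (rule pm.subspace_span)
  ultimately show "pm.span ?S \<subseteq> ?R" by (rule pm.span_minimal)
  have "Poly_Mapping.single (p, q) 1 \<in> ?S" if "R b c" "p \<in> K b" "q \<in> K' c" for p q b c
  proof -
    have "Poly_Mapping.single p (1::'k) \<in> {x. Poly_Mapping.keys x \<subseteq> K b}"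
      "Poly_Mapping.single q (1::'k) \<in> {x. Poly_Mapping.keys x \<subseteq> K' c}" using that by auto
    then show ?thesis using that(1) tensor_single[of p q] by (metis (mono_tags, lifting) mem_Collect_eq)
  qed
  then show "?R \<subseteq> pm.span ?S"
    unfolding span_single[symmetric] by (intro pm.span_mono) auto
qed

text \<open>In characteristic zero the terms of the coproduct of a graph cannot cancel.\<close>

lemma keys_coproduct_graph:
  assumes "wf_hgraph G"
  shows "Poly_Mapping.keys (coproduct_graph T G :: _ \<Rightarrow>\<^sub>0 'k::field_char_0) =
    (\<lambda>G'. (iso_class G', iso_class (contract T G G'))) ` {G'. admissible T G' G}"
proof -
  let ?f = "\<lambda>G'. (iso_class G', iso_class (contract T G G'))"
  note fin = finite_admissible[OF assms, of T]
  have "Poly_Mapping.lookup (coproduct_graph T G :: _ \<Rightarrow>\<^sub>0 'k) pq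
      = of_nat (card {G'. admissible T G' G \<and> ?f G' = pq})" for pq
  proof -
    have "Poly_Mapping.lookup (coproduct_graph T G :: _ \<Rightarrow>\<^sub>0 'k) pq
        = (\<Sum>G' | admissible T G' G. if ?f G' = pq then 1 else 0)"
      by (simp add: coproduct_graph_def basis_vec_def tensor_single lookup_sum lookup_single when_def)
    also have "\<dots> = of_nat (card {G'. admissible T G' G \<and> ?f G' = pq})"
      using fin by (simp add: sum.If_cases Int_def)
    finally show ?thesis .
  qed
  moreover have "finite {G'. admissible T G' G \<and> ?f G' = pq}" for pq
    using fin by (rule rev_finite_subset) blast
  ultimately show ?thesis by (auto simp: in_keys_iff set_eq_iff)
qed

lemma keys_pm_scale: "Poly_Mapping.keys (pm_scale c y) \<subseteq> Poly_Mapping.keys y"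
  by (auto simp: in_keys_iff lookup_pm_scale)

lemma keys_coproduct:
  "Poly_Mapping.keys (coproduct T (x :: _ \<Rightarrow>\<^sub>0 'k::field)) \<subseteq>
    (\<Union>p\<in>Poly_Mapping.keys x. Poly_Mapping.keys (coproduct_graph T (rep_fgraph p) :: _ \<Rightarrow>\<^sub>0 'k))"
  unfolding coproduct_def
  by (rule order.trans[OF keys_sum]) (auto dest: keys_pm_scale[THEN subsetD])

lemma coproduct_basis_vec:
  "coproduct T (basis_vec G) = coproduct_graph T (rep_fgraph (iso_class G))"
  by (simp add: coproduct_def basis_vec_def pm.scale_one)

text \<open>Since the graded parts are spanned by basis vectors, the two conditions on a Hopf algebra
  graduation can be read off from the basis. The coproduct is only evaluated at the chosen
  representatives of the isomorphism classes.\<close>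

lemma hopf_graduation_iff:
  fixes deg :: "'h hgraph \<Rightarrow> 'd::ab_group_add"
  assumes inv: "\<And>G H. same_graph G H \<Longrightarrow> deg G = deg H"
  shows "hopf_graduation T (graded_part T deg :: 'd \<Rightarrow> ('h fgraph \<Rightarrow>\<^sub>0 'k::field_char_0) set) \<longleftrightarrow>
    (\<forall>G H. feynman T G \<longrightarrow> feynman T H \<longrightarrow> deg (disj_union G H) = deg G + deg H) \<and>
    (\<forall>G. feynman T G \<longrightarrow> (\<forall>C. admissible T C (rep_fgraph (iso_class G)) \<longrightarrow>
       deg G = deg C + deg (contract T (rep_fgraph (iso_class G)) C)))"
    (is "_ \<longleftrightarrow> ?P \<and> ?Q")
proof -
  define K where "K a = iso_class ` {G. feynman T G \<and> deg G = a}" for a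
  have M: "graded_part T deg = (\<lambda>a. {x :: 'h fgraph \<Rightarrow>\<^sub>0 'k. Poly_Mapping.keys x \<subseteq> K a})"
    by (rule ext) (simp add: graded_part_eq K_def)
  have wf: "wf_hgraph G" if "feynman T G" for G using that by (simp add: feynman_iff)
  have K_iff: "iso_class G \<in> K a \<longleftrightarrow> deg G = a" if "feynman T G" for G a
  proof
    assume "iso_class G \<in> K a"
    then obtain H where "feynman T H" "deg H = a" "iso_class G = iso_class H" by (auto simp: K_def)
    then show "deg G = a" using inv iso_class_eq_iff[OF wf[OF that] wf] by blast
  qed (use that in \<open>auto simp: K_def\<close>)
  have bv: "Poly_Mapping.keys (basis_vec G :: 'h fgraph \<Rightarrow>\<^sub>0 'k) = {iso_class G}" for G
    by (simp add: basis_vec_def)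
  have rep: "feynman T (rep_fgraph (iso_class G))" if "feynman T G" for G
    using same_graph_feynman[OF same_graph_sym[OF same_graph_rep[OF wf[OF that]]] that] .
  have adm: "feynman T C" "feynman T (contract T G C)" if "admissible T C G" for C G
    using that by (auto simp: admissible_def subgraph_def)
  have hg: "hopf_graduation T (graded_part T deg :: 'd \<Rightarrow> ('h fgraph \<Rightarrow>\<^sub>0 'k) set) \<longleftrightarrow>
    (\<forall>a b. \<forall>x y :: 'h fgraph \<Rightarrow>\<^sub>0 'k. Poly_Mapping.keys x \<subseteq> K a \<longrightarrow> Poly_Mapping.keys y \<subseteq> K b \<longrightarrow>
       Poly_Mapping.keys (x * y) \<subseteq> K (a + b)) \<and>
    (\<forall>a. \<forall>x :: 'h fgraph \<Rightarrow>\<^sub>0 'k. Poly_Mapping.keys x \<subseteq> K a \<longrightarrow>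
       Poly_Mapping.keys (coproduct T x) \<subseteq> (\<Union>(b, c)\<in>{(b, c). b + c = a}. K b \<times> K c))"
    unfolding hopf_graduation_def M span_tensors by auto
  show ?thesis
  proof
    assume h: "hopf_graduation T (graded_part T deg :: 'd \<Rightarrow> ('h fgraph \<Rightarrow>\<^sub>0 'k) set)"
    have ?P
    proof (intro allI impI)
      fix G H assume G: "feynman T G" and H: "feynman T H"
      have "Poly_Mapping.keys (basis_vec G * basis_vec H :: 'h fgraph \<Rightarrow>\<^sub>0 'k) \<subseteq> K (deg G + deg H)"
        using h unfolding hg by (simp add: bv K_iff G H)
      then have "iso_class (disj_union G H) \<in> K (deg G + deg H)"
        by (simp add: basis_vec_def mult_single iso_class_plus wf G H)
      then show "deg (disj_union G H) = deg G + deg H"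
        using K_iff[OF feynman_disj_union[OF wf[OF G] wf[OF H] G H]] by simp
    qed
    moreover have ?Q
    proof (intro allI impI)
      fix G C assume G: "feynman T G" and C: "admissible T C (rep_fgraph (iso_class G))"
      let ?R = "rep_fgraph (iso_class G)"
      have "Poly_Mapping.keys (coproduct T (basis_vec G) :: _ \<Rightarrow>\<^sub>0 'k)
          \<subseteq> (\<Union>(b, c)\<in>{(b, c). b + c = deg G}. K b \<times> K c)"
        using h unfolding hg by (simp add: bv K_iff G)
      moreover have "(iso_class C, iso_class (contract T ?R C))
          \<in> Poly_Mapping.keys (coproduct T (basis_vec G) :: _ \<Rightarrow>\<^sub>0 'k)"
        unfolding coproduct_basis_vec keys_coproduct_graph[OF wf[OF rep[OF G]]] using C by blast
      ultimately have "(iso_class C, iso_class (contract T ?R C))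
          \<in> (\<Union>(b, c)\<in>{(b, c). b + c = deg G}. K b \<times> K c)"
        by (rule subsetD)
      then show "deg G = deg C + deg (contract T ?R C)"
        using K_iff[OF adm(1)[OF C]] K_iff[OF adm(2)[OF C]] by auto
    qed
    ultimately show "?P \<and> ?Q" ..
  next
    assume PQ: "?P \<and> ?Q"
    show "hopf_graduation T (graded_part T deg :: 'd \<Rightarrow> ('h fgraph \<Rightarrow>\<^sub>0 'k) set)"
      unfolding hg
    proof (intro conjI allI impI subsetI)
      fix a b and x y :: "'h fgraph \<Rightarrow>\<^sub>0 'k" and r
      assume xy: "Poly_Mapping.keys x \<subseteq> K a" "Poly_Mapping.keys y \<subseteq> K b"
        and r: "r \<in> Poly_Mapping.keys (x * y)"
      obtain p q where pq: "p \<in> Poly_Mapping.keys x" "q \<in> Poly_Mapping.keys y" "r = p + q"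
        using r keys_mult[of x y] by blast
      then obtain G H where "feynman T G" "deg G = a" "p = iso_class G"
        "feynman T H" "deg H = b" "q = iso_class H"
        using xy unfolding K_def by blast
      then show "r \<in> K (a + b)"
        using PQ pq(3) feynman_disj_union[OF wf wf] by (simp add: iso_class_plus wf K_iff)
    next
      fix a and x :: "'h fgraph \<Rightarrow>\<^sub>0 'k" and r
      assume x: "Poly_Mapping.keys x \<subseteq> K a" and r: "r \<in> Poly_Mapping.keys (coproduct T x)"
      obtain p where p: "p \<in> Poly_Mapping.keys x"
        "r \<in> Poly_Mapping.keys (coproduct_graph T (rep_fgraph p) :: _ \<Rightarrow>\<^sub>0 'k)"
        using r keys_coproduct[of T x] by blast
      then obtain G where G: "feynman T G" "deg G = a" "p = iso_class G" using x unfolding K_def by blast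
      let ?R = "rep_fgraph (iso_class G)"
      obtain C where C: "admissible T C ?R" "r = (iso_class C, iso_class (contract T ?R C))"
        using p(2) unfolding G(3) keys_coproduct_graph[OF wf[OF rep[OF G(1)]]] by blast
      have "deg C + deg (contract T ?R C) = a" using PQ G(1,2) C(1) by metis
      moreover have "iso_class C \<in> K (deg C)" "iso_class (contract T ?R C) \<in> K (deg (contract T ?R C))"
        using K_iff[OF adm(1)[OF C(1)]] K_iff[OF adm(2)[OF C(1)]] by auto
      ultimately show "r \<in> (\<Union>(b, c)\<in>{(b, c). b + c = a}. K b \<times> K c)"
        unfolding C(2) by blast
    qed
  qed
qed


section \<open>Degrees and matrices\<close>

lemma finite_types:
  assumes "feynman_theory T"
  shows "finite (vtypes T)" "finite (etypes T)"
  using assms by (auto simp: feynman_theory_def etypes_def)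

text \<open>The matrix formula only involves the coordinates of \<open>V\<^sub>G - S\<^sub>G\<close> at vertex types.\<close>

lemma matrix_degree:
  assumes T: "feynman_theory T" and wf: "wf_hgraph G"
  shows "(mat_app (vtypes T) C (vertex_count T G)
      - mat_app (vtypes T \<union> etypes T) (adjoin_zero_columns T C) (structure_count T G)) $ n
    = (\<Sum>t\<in>vtypes T. C n t * of_int (balance G t))"
proof -
  note fin = finite_types[OF T]
  have "(\<Sum>t\<in>vtypes T \<union> etypes T. adjoin_zero_columns T C n t * of_nat (structure_count T G t))
      = (\<Sum>t\<in>vtypes T. C n t * of_nat (scount G t))"
    using fin by (intro sum.mono_neutral_cong_right)
      (auto simp: adjoin_zero_columns_def structure_count_eq[OF wf])
  moreover have "(\<Sum>t\<in>vtypes T. C n t * of_nat (vertex_count T G t))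
      = (\<Sum>t\<in>vtypes T. C n t * of_nat (vcount G t))"
    by (intro sum.cong) (auto simp: vertex_count_eq)
  ultimately show ?thesis
    by (simp add: mat_app_def balance_def sum_subtractf algebra_simps)
qed

text \<open>The types of vertices of irreducible graphs. That every vertex type occurs is not needed.\<close>

definition occurs :: "'h ftheory \<Rightarrow> 'h multiset \<Rightarrow> bool" where
  "occurs T t \<longleftrightarrow> (\<exists>G. one_PI T G \<and> (\<exists>v\<in>verts G. vertex_type G v = t))"

lemma vcount_not_occurs:
  assumes G: "feynman T G" and t: "\<not> occurs T t"
  shows "vcount G t = 0"
proof -
  have wf: "wf_hgraph G" using G by (simp add: feynman_iff)
  have "vertex_type G v \<noteq> t" if v: "v \<in> verts G" for v
  proof -
    obtain B where B: "B \<in> blocks G" "v \<in> B" by (rule block_ex[OF wf v])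
    then have "one_PI T (graph_on G B)" using G by (simp add: feynman_iff)
    moreover have "vertex_type (graph_on G B) v = vertex_type G v" "v \<in> verts (graph_on G B)"
      using B(2) by (simp_all add: vertex_type_graph_on)
    ultimately show ?thesis using t unfolding occurs_def by metis
  qed
  then have "{v \<in> verts G. vertex_type G v = t} = {}" by blast
  then show ?thesis by (simp only: vcount_def card.empty)
qed

lemma insertion_ex:
  assumes T: "feynman_theory T" and K: "one_PI T K"
    and type: "ext_type K \<in> etypes T \<or> occurs T (ext_type K)"
  obtains B \<phi> \<psi> where "one_PI T B" "embeds K B \<phi> \<psi>"
  using type
proof
  assume "ext_type K \<in> etypes T"
  then show thesis using edge_insertion_ex[OF T K] that by blast
next
  assume "occurs T (ext_type K)"
  then obtain G v where "one_PI T G" "v \<in> verts G" "vertex_type G v = ext_type K"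
    unfolding occurs_def by blast
  then show thesis using vertex_insertion_ex[OF _ K] that by blast
qed

text \<open>Inserting a graph with external structure \<open>w\<close> and contracting it again relates the coefficient
  of \<open>S\<^sub>G\<close> at \<open>w\<close> to that of \<open>V\<^sub>G\<close>.\<close>

lemma structure_coefficient:
  fixes deg :: "'h hgraph \<Rightarrow> rat"
  assumes T: "feynman_theory T" and real: "realizable T"
    and lin: "\<And>G. feynman T G \<Longrightarrow> deg G = (\<Sum>t\<in>vtypes T. c t * of_nat (vcount G t))
        + (\<Sum>t\<in>vtypes T \<union> etypes T. d t * of_nat (scount G t))"
    and contr: "\<And>G C. feynman T G \<Longrightarrow> admissible T C (rep_fgraph (iso_class G)) \<Longrightarrow>
        deg (rep_fgraph (iso_class G)) = deg C + deg (contract T (rep_fgraph (iso_class G)) C)"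
    and w: "w \<in> vtypes T \<union> etypes T" "w \<in> etypes T \<or> occurs T w"
  shows "d w = - (if w \<in> vtypes T then c w else 0)"
proof -
  note fin = finite_types[OF T]
  obtain K where K: "one_PI T K" "ext_type K = w" using real w(1) by (auto simp: realizable_def)
  obtain B \<phi> \<psi> where B: "one_PI T B" "embeds K B \<phi> \<psi>" by (rule insertion_ex[OF T K(1)]) (use w K in auto)
  define R where "R = rep_fgraph (iso_class B)"
  have wfB: "wf_hgraph B" and fB: "feynman T B" using B(1) one_PI_feynman by (auto simp: one_PI_iff)
  have same: "same_graph B R" unfolding R_def by (rule same_graph_sym[OF same_graph_rep[OF wfB]])
  obtain C where C: "admissible T C R" "\<And>t. vcount C t = vcount K t" "\<And>t. scount C t = scount K t"
    "\<And>t. vcount (contract T R C) t + vcount K t = vcount R t + (if w \<in> vtypes T \<and> w = t then 1 else 0)"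
    "\<And>t. scount (contract T R C) t = scount R t"
    using embedded_contraction[OF T B(1) K(1) B(2) same] K(2) by metis
  let ?Q = "contract T R C"
  have fR: "feynman T R" by (rule same_graph_feynman[OF same fB])
  have f: "feynman T C" "feynman T ?Q" using C(1) by (auto simp: admissible_def subgraph_def)
  have "deg R = deg C + deg ?Q" using contr[OF fB] C(1) unfolding R_def by blast
  then have "(\<Sum>t\<in>vtypes T. c t * of_nat (vcount R t)) =
      (\<Sum>t\<in>vtypes T. c t * of_nat (vcount ?Q t + vcount K t))
      + (\<Sum>t\<in>vtypes T \<union> etypes T. d t * of_nat (scount K t))"
    unfolding lin[OF fR] lin[OF f(1)] lin[OF f(2)] C(2,3,5)
    by (simp add: sum.distrib distrib_left)
  moreover have "(\<Sum>t\<in>vtypes T. c t * of_nat (vcount ?Q t + vcount K t)) =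
      (\<Sum>t\<in>vtypes T. c t * of_nat (vcount R t)) + (if w \<in> vtypes T then c w else 0)"
  proof -
    have "(\<Sum>t\<in>vtypes T. c t * of_nat (if w \<in> vtypes T \<and> w = t then 1 else 0)) =
        (if w \<in> vtypes T then c w else 0)"
      using fin by (simp add: if_distrib sum.delta' cong: if_cong)
    then show ?thesis unfolding C(4) by (simp only: of_nat_add distrib_left sum.distrib)
  qed
  moreover have "(\<Sum>t\<in>vtypes T \<union> etypes T. d t * of_nat (scount K t)) = d w"
    using w(1) fin by (simp add: scount_one_PI[OF K(1)] K(2) if_distrib sum.delta' cong: if_cong)
  ultimately show ?thesis by linarith
qed

theorem proposition38:
  fixes T :: "'h ftheory"
    and f :: "('h multiset \<Rightarrow> nat) \<times> ('h multiset \<Rightarrow> nat) \<Rightarrow> rat ^ 'n"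
    and deg :: "'h hgraph \<Rightarrow> rat ^ 'n"
  assumes "feynman_theory T"
    and "realizable T"
    and deg: "\<And>G. deg G = f (vertex_count T G, structure_count T G)"
  shows "hopf_graduation T (graded_part T deg :: rat ^ 'n \<Rightarrow> ('h fgraph \<Rightarrow>\<^sub>0 'k::field_char_0) set)
    \<longleftrightarrow> (\<exists>C :: ('n, 'h) rat_mat. \<forall>G. feynman T G \<longrightarrow>
           deg G = mat_app (vtypes T) C (vertex_count T G)
             - mat_app (vtypes T \<union> etypes T) (adjoin_zero_columns T C) (structure_count T G))"
proof -
  note T = assms(1)
  let ?V = "vtypes T" and ?E = "etypes T"
  note fin = finite_types[OF T]
  have wf: "wf_hgraph G" if "feynman T G" for G using that by (simp add: feynman_iff)
  have inv: "deg G = deg H" if same: "same_graph G H" for G H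
  proof -
    obtain \<phi> \<psi> where "graph_isomorphism G H \<phi> \<psi>" by (rule same_graphE[OF same])
    then show ?thesis by (simp add: deg graph_isomorphism.counts_iso)
  qed
  have rep: "same_graph (rep_fgraph (iso_class G)) G" "feynman T (rep_fgraph (iso_class G))"
    if "feynman T G" for G
    using same_graph_rep[OF wf[OF that]] same_graph_feynman[OF same_graph_sym] that by blast+
  have graduation_iff: "hopf_graduation T (graded_part T deg :: rat ^ 'n \<Rightarrow> ('h fgraph \<Rightarrow>\<^sub>0 'k) set) \<longleftrightarrow>
    (\<forall>G H. feynman T G \<longrightarrow> feynman T H \<longrightarrow> deg (disj_union G H) = deg G + deg H) \<and>
    (\<forall>G. feynman T G \<longrightarrow> (\<forall>C. admissible T C (rep_fgraph (iso_class G)) \<longrightarrow>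
       deg G = deg C + deg (contract T (rep_fgraph (iso_class G)) C)))"
    by (rule hopf_graduation_iff) (rule inv)
  show ?thesis
    unfolding graduation_iff
  proof
    assume "(\<forall>G H. feynman T G \<longrightarrow> feynman T H \<longrightarrow> deg (disj_union G H) = deg G + deg H) \<and>
      (\<forall>G. feynman T G \<longrightarrow> (\<forall>C. admissible T C (rep_fgraph (iso_class G)) \<longrightarrow>
         deg G = deg C + deg (contract T (rep_fgraph (iso_class G)) C)))"
    then have add: "\<And>G H. feynman T G \<Longrightarrow> feynman T H \<Longrightarrow> deg (disj_union G H) = deg G + deg H"
      and contr: "\<And>G C. feynman T G \<Longrightarrow> admissible T C (rep_fgraph (iso_class G)) \<Longrightarrow>
        deg G = deg C + deg (contract T (rep_fgraph (iso_class G)) C)" by blast+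
    define v where "v G = case_sum (vcount G) (scount G)" for G :: "'h hgraph"
    have "\<exists>c. \<forall>G\<in>{G. feynman T G}. deg G $ n = (\<Sum>i\<in>?V <+> (?V \<union> ?E). c i * of_nat (v G i))" for n
    proof (rule additive_imp_linear)
      show "finite (?V <+> (?V \<union> ?E))" using fin by simp
    next
      fix G H assume "G \<in> {G. feynman T G}" "H \<in> {G. feynman T G}"
      then show "\<exists>D\<in>{G. feynman T G}. deg D $ n = deg G $ n + deg H $ n \<and>
          (\<forall>i\<in>?V <+> (?V \<union> ?E). v D i = v G i + v H i)"
        by (intro bexI[of _ "disj_union G H"])
           (auto simp: add feynman_disj_union wf v_def vcount_disj_union scount_disj_union)
    next
      fix G H assume G: "G \<in> {G. feynman T G}" "H \<in> {G. feynman T G}"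
        and eq: "\<forall>i\<in>?V <+> (?V \<union> ?E). v G i = v H i"
      have "vcount G t = vcount H t" if "t \<in> ?V" for t
        using bspec[OF eq InlI[OF that]] by (simp add: v_def)
      moreover have "scount G t = scount H t" if "t \<in> ?V \<union> ?E" for t
        using bspec[OF eq InrI[OF that]] by (simp add: v_def)
      ultimately have "vertex_count T G = vertex_count T H" "structure_count T G = structure_count T H"
        using G by (auto simp: vertex_count_eq structure_count_eq wf restrict_def)
      then show "deg G $ n = deg H $ n" by (simp add: deg)
    qed
    then obtain c where c: "\<And>n G. feynman T G \<Longrightarrow>
        deg G $ n = (\<Sum>i\<in>?V <+> (?V \<union> ?E). c n i * of_nat (v G i))" by (metis mem_Collect_eq)
    have lin: "deg G $ n = (\<Sum>t\<in>?V. c n (Inl t) * of_nat (vcount G t))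
        + (\<Sum>t\<in>?V \<union> ?E. c n (Inr t) * of_nat (scount G t))" if "feynman T G" for n G
      using fin by (simp add: c[OF that] sum.Plus v_def)
    have coeff: "c n (Inr w) = - (if w \<in> ?V then c n (Inl w) else 0)"
      if w: "w \<in> ?V \<union> ?E" "w \<in> ?E \<or> occurs T w" for n w
    proof (rule structure_coefficient[OF T assms(2), where deg = "\<lambda>G. deg G $ n"])
      show "deg G $ n = (\<Sum>t\<in>?V. c n (Inl t) * of_nat (vcount G t))
        + (\<Sum>t\<in>?V \<union> ?E. c n (Inr t) * of_nat (scount G t))" if "feynman T G" for G
        by (rule lin[OF that])
      show "deg (rep_fgraph (iso_class G)) $ n =
          deg C $ n + deg (contract T (rep_fgraph (iso_class G)) C) $ n"
        if "feynman T G" "admissible T C (rep_fgraph (iso_class G))" for G C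
        using contr[OF that] inv[OF rep(1)[OF that(1)]] by simp
    qed (use w in auto)
    \<comment> \<open>If \<open>t\<close> does not occur, then its column does not affect \<open>C V\<^sub>G\<close> and is chosen to fit \<open>S\<^sub>G\<close>.\<close>
    define C where "C n t = (if occurs T t then c n (Inl t) else - c n (Inr t))" for n t
    have d: "c n (Inr t) = (if t \<in> ?V then - C n t else 0)" if "t \<in> ?V \<union> ?E" for n t
      using coeff[OF that, of n] that by (auto simp: C_def)
    have "deg G $ n = (\<Sum>t\<in>?V. C n t * of_int (balance G t))" if G: "feynman T G" for G n
    proof -
      have "(\<Sum>t\<in>?V. c n (Inl t) * of_nat (vcount G t)) = (\<Sum>t\<in>?V. C n t * of_nat (vcount G t))"
        by (intro sum.cong) (auto simp: C_def vcount_not_occurs[OF G])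
      moreover have "(\<Sum>t\<in>?V \<union> ?E. c n (Inr t) * of_nat (scount G t))
          = (\<Sum>t\<in>?V. - C n t * of_nat (scount G t))"
        using fin d by (intro sum.mono_neutral_cong_right) auto
      ultimately show ?thesis
        by (simp add: lin[OF G] balance_def sum_subtractf sum_negf algebra_simps)
    qed
    then show "\<exists>C :: ('n, 'h) rat_mat. \<forall>G. feynman T G \<longrightarrow>
        deg G = mat_app ?V C (vertex_count T G)
          - mat_app (?V \<union> ?E) (adjoin_zero_columns T C) (structure_count T G)"
      by (intro exI[of _ C]) (simp add: vec_eq_iff matrix_degree[OF T wf] del: vector_minus_component)
  next
    assume "\<exists>C :: ('n, 'h) rat_mat. \<forall>G. feynman T G \<longrightarrow>
        deg G = mat_app ?V C (vertex_count T G)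
          - mat_app (?V \<union> ?E) (adjoin_zero_columns T C) (structure_count T G)"
    then obtain C :: "('n, 'h) rat_mat" where matrix: "\<And>G. feynman T G \<Longrightarrow>
        deg G = mat_app ?V C (vertex_count T G)
          - mat_app (?V \<union> ?E) (adjoin_zero_columns T C) (structure_count T G)" by blast
    have C: "deg G $ n = (\<Sum>t\<in>?V. C n t * of_int (balance G t))" if "feynman T G" for G n
      unfolding matrix[OF that] by (rule matrix_degree[OF T wf[OF that]])
    have "deg (disj_union G H) = deg G + deg H" if G: "feynman T G" "feynman T H" for G H
    proof -
      have "balance (disj_union G H) t = balance G t + balance H t" for t
        by (simp add: balance_def vcount_disj_union scount_disj_union wf G)
      then show ?thesis
        using G by (simp add: vec_eq_iff C feynman_disj_union wf distrib_left sum.distrib)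
    qed
    moreover have "deg G = deg D + deg (contract T (rep_fgraph (iso_class G)) D)"
      if G: "feynman T G" and D: "admissible T D (rep_fgraph (iso_class G))" for G D
    proof -
      let ?R = "rep_fgraph (iso_class G)"
      have f: "feynman T D" "feynman T (contract T ?R D)"
        using D by (auto simp: admissible_def subgraph_def)
      have "deg ?R = deg D + deg (contract T ?R D)"
        by (simp add: vec_eq_iff C f rep(2)[OF G] balance_contract[OF T rep(2)[OF G] D]
            distrib_left sum.distrib)
      then show ?thesis using inv[OF rep(1)[OF G]] by simp
    qed
    ultimately show "(\<forall>G H. feynman T G \<longrightarrow> feynman T H \<longrightarrow> deg (disj_union G H) = deg G + deg H) \<and>
      (\<forall>G. feynman T G \<longrightarrow> (\<forall>C. admissible T C (rep_fgraph (iso_class G)) \<longrightarrow>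
         deg G = deg C + deg (contract T (rep_fgraph (iso_class G)) C)))" by blast
  qed
qed

end
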